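(* Let $N\ge 3$ be an integer and let $q,p,\alpha,\mu$ be real numbers with $0<q<1$, $\alpha\in(0,N)$, $\mu>0$, $0<2\alpha+\mu<N$ and $\frac{2N-2\alpha-\mu}{N}<p<\frac{2N-2\alpha-\mu}{N-2}$. Let $a:\mathbb{R}^N\to\mathbb{R}$ be continuous with $a>0$, $a\in L^{2/(2-q)}(\mathbb{R}^N)$ and $a\notin L^1(\mathbb{R}^N)$; let $b:\mathbb{R}^N\to\mathbb{R}$ be measurable with $b>0$, $b\in L^\infty(\mathbb{R}^N)$ and $b\in L^{\frac{2N}{2N-2\alpha-\mu-(N-2)(p-q)}}(\mathbb{R}^N)$; let $V:\mathbb{R}^N\to\mathbb{R}$ be continuous and positive with $\inf_{\mathbb{R}^N}V>0$ and $|\{x\in\mathbb{R}^N: V(x)\le M\}|<\infty$ for every $M>0$. Then problem $(Q)$ with $\lambda=\lambda^*$ does not admit any weak solution $u\in\mathcal{N}^0_{\lambda^*}$.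
   Context: Problem $(Q)$ with parameter $\lambda>0$ is $$-\Delta u+V(x)u=\lambda\frac{a(x)}{u^{1-q}}+\int_{\mathbb{R}^N}\frac{b(y)|u(y)|^p\,dy}{|x|^\alpha|x-y|^\mu|y|^\alpha}\,b(x)|u|^{p-2}u\ \text{ in }\mathbb{R}^N,\qquad u>0,\ u\in H^1(\mathbb{R}^N).$$ $X=\{u\in H^1(\mathbb{R}^N):\int_{\mathbb{R}^N} V u^2\,dx<\infty\}$ is the Hilbert space with inner product $\langle u,\varphi\rangle=\int_{\mathbb{R}^N}(\nabla u\cdot\nabla\varphi+Vu\varphi)\,dx$ and norm $\|u\|^2=\langle u,u\rangle$. $X_+=\{u\in X\setminus\{0\}:u\ge0\}$. $A(u)=\int_{\mathbb{R}^N}a|u|^q\,dx$, $B(u)=\int_{\mathbb{R}^N}\int_{\mathbb{R}^N}\frac{b(y)|u(y)|^p\,b(x)|u(x)|^p}{|x|^\alpha|x-y|^\mu|y|^\alpha}\,dx\,dy$, $J_\lambda(u)=\frac12\|u\|^2-\frac{\lambda}{q}A(u)-\frac1{2p}B(u)$, and $\phi_{\lambda,u}(t)=J_\lambda(tu)$ for $t>0$. $\mathcal{N}^0_\lambda=\{u\in X_+:\phi'_{\lambda,u}(1)=0,\ \phi''_{\lambda,u}(1)=0\}$. $H(u,\varphi)=\int_{\mathbb{R}^N}a|u|^{q-2}u\varphi\,dx$ and $D(u,\varphi)=\int_{\mathbb{R}^N}\int_{\mathbb{R}^N}\frac{b(y)|u(y)|^p\,b(x)|u(x)|^{p-2}u(x)\varphi(x)}{|x|^\alpha|x-y|^\mu|y|^\alpha}\,dx\,dy$.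 Weak solution of $(Q)$: $u\in X$ with $u>0$ a.e. in $\mathbb{R}^N$, $au^{q-1}\varphi\in L^1(\mathbb{R}^N)$ and $\langle u,\varphi\rangle=\lambda H(u,\varphi)+D(u,\varphi)$ for every $\varphi\in X$. For $u\in X_+$, $R_n(u)=\frac{\|u\|^2-B(u)}{A(u)}$, and $\lambda^*=\inf_{u\in X_+}\max_{t>0}R_n(tu)$. *)

theory Defs
  imports "HOL-Analysis.Analysis"
begin

text \<open>
  Lebesgue measurable functions are used throughout, and elements of function spaces are
  represented by functions rather than by classes modulo null sets; relations between them
  (\<open>u = 0\<close>, \<open>u \<ge> 0\<close>, \<open>u > 0\<close>) are accordingly read almost everywhere.
\<close>

definition Lp :: "real \<Rightarrow> ('a::euclidean_space \<Rightarrow> real) set" where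
  "Lp r = {f. f \<in> borel_measurable lebesgue \<and> integrable lebesgue (\<lambda>x. \<bar>f x\<bar> powr r)}"

definition Linfty :: "('a::euclidean_space \<Rightarrow> real) set" where
  "Linfty = {f. f \<in> borel_measurable lebesgue \<and> (\<exists>C. AE x in lebesgue. \<bar>f x\<bar> \<le> C)}"

primrec Ck :: "nat \<Rightarrow> ('a::euclidean_space \<Rightarrow> real) \<Rightarrow> bool" where
  "Ck 0 f \<longleftrightarrow> continuous_on UNIV f"
| "Ck (Suc k) f \<longleftrightarrow> (\<forall>x. f differentiable (at x)) \<and>
      (\<forall>i\<in>Basis. Ck k (\<lambda>x. frechet_derivative f (at x) i))"

definition test_function :: "('a::euclidean_space \<Rightarrow> real) \<Rightarrow> bool" where
  "test_function \<psi> \<longleftrightarrow> (\<forall>k. Ck k \<psi>) \<and> compact (closure {x. \<psi> x \<noteq> 0})"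

definition locally_integrable :: "('a::euclidean_space \<Rightarrow> 'b::euclidean_space) \<Rightarrow> bool" where
  "locally_integrable f \<longleftrightarrow> (\<forall>K. compact K \<longrightarrow> set_integrable lebesgue K f)"

definition has_weak_gradient ::
    "('a::euclidean_space \<Rightarrow> real) \<Rightarrow> ('a \<Rightarrow> 'a) \<Rightarrow> bool" where
  "has_weak_gradient u g \<longleftrightarrow> locally_integrable u \<and> locally_integrable g \<and>
     (\<forall>\<psi>. test_function \<psi> \<longrightarrow> (\<forall>i\<in>Basis.
        (LINT x|lebesgue. u x * frechet_derivative \<psi> (at x) i)
          = - (LINT x|lebesgue. (g x \<bullet> i) * \<psi> x)))"

text \<open>The weak gradient is unique up to a null set, so the choice does not affect integrals.\<close>

definition weak_gradient :: "('a::euclidean_space \<Rightarrow> real) \<Rightarrow> 'a \<Rightarrow> 'a" where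
  "weak_gradient u = (SOME g. has_weak_gradient u g)"

definition H1 :: "('a::euclidean_space \<Rightarrow> real) set" where
  "H1 = {u. u \<in> Lp 2 \<and> (\<exists>g. has_weak_gradient u g \<and> (\<lambda>x. norm (g x)) \<in> Lp 2)}"

definition X_space :: "('a::euclidean_space \<Rightarrow> real) \<Rightarrow> ('a \<Rightarrow> real) set" where
  "X_space V = {u \<in> H1. integrable lebesgue (\<lambda>x. V x * (u x)\<^sup>2)}"

definition X_inner ::
    "('a::euclidean_space \<Rightarrow> real) \<Rightarrow> ('a \<Rightarrow> real) \<Rightarrow> ('a \<Rightarrow> real) \<Rightarrow> real" where
  "X_inner V u \<phi> =
     (LINT x|lebesgue. weak_gradient u x \<bullet> weak_gradient \<phi> x + V x * u x * \<phi> x)"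

definition X_norm :: "('a::euclidean_space \<Rightarrow> real) \<Rightarrow> ('a \<Rightarrow> real) \<Rightarrow> real" where
  "X_norm V u = sqrt (X_inner V u u)"

definition X_plus :: "('a::euclidean_space \<Rightarrow> real) \<Rightarrow> ('a \<Rightarrow> real) set" where
  "X_plus V = {u \<in> X_space V. \<not> (AE x in lebesgue. u x = 0) \<and> (AE x in lebesgue. u x \<ge> 0)}"

definition A_fun :: "('a::euclidean_space \<Rightarrow> real) \<Rightarrow> real \<Rightarrow> ('a \<Rightarrow> real) \<Rightarrow> real" where
  "A_fun a q u = (LINT x|lebesgue. a x * \<bar>u x\<bar> powr q)"

text \<open>The denominators below vanish only on null sets, where the quotient is \<open>0\<close>.\<close>

definition B_fun ::
    "('a::euclidean_space \<Rightarrow> real) \<Rightarrow> real \<Rightarrow> real \<Rightarrow> real \<Rightarrow> ('a \<Rightarrow> real) \<Rightarrow> real" where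
  "B_fun b p \<alpha> \<mu> u = (LINT y|lebesgue. (LINT x|lebesgue.
     (b y * \<bar>u y\<bar> powr p * (b x * \<bar>u x\<bar> powr p))
       / (norm x powr \<alpha> * norm (x - y) powr \<mu> * norm y powr \<alpha>)))"

definition H_fun ::
    "('a::euclidean_space \<Rightarrow> real) \<Rightarrow> real \<Rightarrow> ('a \<Rightarrow> real) \<Rightarrow> ('a \<Rightarrow> real) \<Rightarrow> real" where
  "H_fun a q u \<phi> = (LINT x|lebesgue. a x * \<bar>u x\<bar> powr (q - 2) * u x * \<phi> x)"

definition D_fun ::
    "('a::euclidean_space \<Rightarrow> real) \<Rightarrow> real \<Rightarrow> real \<Rightarrow> real \<Rightarrow> ('a \<Rightarrow> real) \<Rightarrow> ('a \<Rightarrow> real) \<Rightarrow> real"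
  where
  "D_fun b p \<alpha> \<mu> u \<phi> = (LINT y|lebesgue. (LINT x|lebesgue.
     (b y * \<bar>u y\<bar> powr p * (b x * \<bar>u x\<bar> powr (p - 2) * u x * \<phi> x))
       / (norm x powr \<alpha> * norm (x - y) powr \<mu> * norm y powr \<alpha>)))"

definition J_fun ::
    "('a::euclidean_space \<Rightarrow> real) \<Rightarrow> ('a \<Rightarrow> real) \<Rightarrow> ('a \<Rightarrow> real) \<Rightarrow>
      real \<Rightarrow> real \<Rightarrow> real \<Rightarrow> real \<Rightarrow> real \<Rightarrow> ('a \<Rightarrow> real) \<Rightarrow> real" where
  "J_fun V a b q p \<alpha> \<mu> lam u =
     1 / 2 * (X_norm V u)\<^sup>2 - lam / q * A_fun a q u - 1 / (2 * p) * B_fun b p \<alpha> \<mu> u"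

definition fibering ::
    "('a::euclidean_space \<Rightarrow> real) \<Rightarrow> ('a \<Rightarrow> real) \<Rightarrow> ('a \<Rightarrow> real) \<Rightarrow>
      real \<Rightarrow> real \<Rightarrow> real \<Rightarrow> real \<Rightarrow> real \<Rightarrow> ('a \<Rightarrow> real) \<Rightarrow> real \<Rightarrow> real" where
  "fibering V a b q p \<alpha> \<mu> lam u t = J_fun V a b q p \<alpha> \<mu> lam (\<lambda>x. t * u x)"

definition N0 ::
    "('a::euclidean_space \<Rightarrow> real) \<Rightarrow> ('a \<Rightarrow> real) \<Rightarrow> ('a \<Rightarrow> real) \<Rightarrow>
      real \<Rightarrow> real \<Rightarrow> real \<Rightarrow> real \<Rightarrow> real \<Rightarrow> ('a \<Rightarrow> real) set" where
  "N0 V a b q p \<alpha> \<mu> lam = {u \<in> X_plus V.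
     deriv (fibering V a b q p \<alpha> \<mu> lam u) 1 = 0 \<and>
     deriv (deriv (fibering V a b q p \<alpha> \<mu> lam u)) 1 = 0}"

definition R_n ::
    "('a::euclidean_space \<Rightarrow> real) \<Rightarrow> ('a \<Rightarrow> real) \<Rightarrow> ('a \<Rightarrow> real) \<Rightarrow>
      real \<Rightarrow> real \<Rightarrow> real \<Rightarrow> real \<Rightarrow> ('a \<Rightarrow> real) \<Rightarrow> real" where
  "R_n V a b q p \<alpha> \<mu> u = ((X_norm V u)\<^sup>2 - B_fun b p \<alpha> \<mu> u) / A_fun a q u"

definition lambda_star ::
    "('a::euclidean_space \<Rightarrow> real) \<Rightarrow> ('a \<Rightarrow> real) \<Rightarrow> ('a \<Rightarrow> real) \<Rightarrow>
      real \<Rightarrow> real \<Rightarrow> real \<Rightarrow> real \<Rightarrow> real" where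
  "lambda_star V a b q p \<alpha> \<mu> = (INF u \<in> X_plus V.
     (GREATEST r. r \<in> (\<lambda>t. R_n V a b q p \<alpha> \<mu> (\<lambda>x. t * u x)) ` {0<..}))"

definition weak_solution ::
    "('a::euclidean_space \<Rightarrow> real) \<Rightarrow> ('a \<Rightarrow> real) \<Rightarrow> ('a \<Rightarrow> real) \<Rightarrow>
      real \<Rightarrow> real \<Rightarrow> real \<Rightarrow> real \<Rightarrow> real \<Rightarrow> ('a \<Rightarrow> real) \<Rightarrow> bool" where
  "weak_solution V a b q p \<alpha> \<mu> lam u \<longleftrightarrow>
     u \<in> X_space V \<and> (AE x in lebesgue. u x > 0) \<and>
     (\<forall>\<phi>\<in>X_space V.
        integrable lebesgue (\<lambda>x. a x * u x powr (q - 1) * \<phi> x) \<and>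
        X_inner V u \<phi> = lam * H_fun a q u \<phi> + D_fun b p \<alpha> \<mu> u \<phi>)"

end

theory Submission
  imports Defs
begin

text \<open>
Suppose \<open>u\<close> were a weak solution at \<open>\<lambda>\<^sup>*\<close> in the degenerate set. The vanishing of the first two fibre
derivatives says that \<open>t \<mapsto> R\<^sub>n(t u)\<close> has its maximum at \<open>t = 1\<close> with value \<open>\<lambda>\<^sup>*\<close>, so that \<open>u\<close> attains the
infimum that defines \<open>\<lambda>\<^sup>*\<close>. Stationarity of this minimisation reads
\<open>2 \<langle>u, \<phi>\<rangle> = q \<lambda>\<^sup>* H(u, \<phi>) + 2 p D(u, \<phi>)\<close>, whereas the weak equation is
\<open>\<langle>u, \<phi>\<rangle> = \<lambda>\<^sup>* H(u, \<phi>) + D(u, \<phi>)\<close>. Eliminating \<open>\<langle>u, \<phi>\<rangle>\<close> leaves \<open>(2 - q) \<lambda>\<^sup>* H = (2 p - 2) D\<close>, that is, almost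
everywhere \<open>a\<close> is a constant multiple of \<open>b u\<^bsup>p - q\<^esup> \<bar>x\<bar>\<^bsup>- \<alpha>\<^esup>\<close> times the Riesz potential of
\<open>f = b u\<^sup>p \<bar>x\<bar>\<^bsup>- \<alpha>\<^esup>\<close>. The right-hand side is integrable and \<open>a\<close> is not, a contradiction.

The first variation (\<open>variational_inequality\<close>) uses only nonnegative test functions that vanish near the
origin, and so yields only an inequality between the two densities. Equality (\<open>coefficient_identity\<close>)
follows because the difference of the densities integrates to zero against \<open>u\<close>: this is a
consequence of the two fibre identities. The passage from test functions to
densities needs the fundamental lemma of the calculus of variations, which also makes weak gradients
unique and hence the norm quadratic; smooth bumps are built for it from \<open>exp (- 1 / t)\<close>.

Integrability of the right-hand side (\<open>a_integrable\<close>) rests on two facts about the mutual energy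
\<open>E(f, g) = \<integral>\<integral> f(x) g(y) \<bar>x - y\<bar>\<^bsup>- \<mu>\<^esup> dx dy\<close>. First, the kernel is comparable to a positive semidefinite
one, so \<open>E(f, g)\<close> is finite when \<open>E(f, f)\<close> and \<open>E(g, g)\<close> are (\<open>mixed_energy_finite\<close>). Secondly,
\<open>E(g, g)\<close> is finite for bounded \<open>g\<close> in a subcritical \<open>L\<^sup>\<sigma>\<close> (\<open>energy_finite_if_bounded_Lp\<close>). Where \<open>u \<ge> 1\<close>
the right-hand side is dominated by the density of \<open>E(f, f)\<close>; where \<open>u \<le> 1\<close> and \<open>\<bar>x\<bar> > 1\<close> it is the
density of \<open>E(f, g)\<close> with a truncated, subcritical \<open>g\<close>.

Finiteness of \<open>E(f, f)\<close> itself comes from the fibre identities. They force \<open>B(u) > 0\<close>; a nonzero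
value of the iterated Bochner integral shows that the potential of \<open>f\<close> is finite at some point, hence
almost everywhere (\<open>potential_finite_AE\<close>), and then \<open>B(u)\<close> is \<open>E(f, f)\<close>.
\<close>

section \<open>Smooth bump functions\<close>

text \<open>
For \<open>P = 1\<close> this is the classical flat function. All \<open>P\<close> are treated at once because the family is
closed under differentiation.
\<close>

definition pexp :: "real poly \<Rightarrow> real \<Rightarrow> real" where
  "pexp P t = (if t > 0 then poly P (1 / t) * exp (- (1 / t)) else 0)"

lemma poly_times_exp_neg_tendsto_0:
  fixes P :: "real poly"
  shows "((\<lambda>s. poly P s * exp (- s)) \<longlongrightarrow> 0) at_top"
proof -
  have "((\<lambda>s. \<Sum>i\<le>degree P. coeff P i * (s ^ i / exp s)) \<longlongrightarrow> (\<Sum>i\<le>degree P. coeff P i * 0)) at_top"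
    by (intro tendsto_intros tendsto_power_div_exp_0)
  moreover have "poly P s * exp (- s) = (\<Sum>i\<le>degree P. coeff P i * (s ^ i / exp s))" for s
    unfolding poly_altdef sum_distrib_right
    by (intro sum.cong) (auto simp: exp_minus divide_inverse)
  ultimately show ?thesis by simp
qed

lemma pexp_has_derivative:
  "(pexp P has_real_derivative pexp ([:0, 0, 1:] * (P - pderiv P)) t) (at t)"
proof -
  consider "t > 0" | "t < 0" | "t = 0" by linarith
  then show ?thesis
  proof cases
    case 1
    have "((\<lambda>t. poly P (1 / t) * exp (- (1 / t))) has_real_derivative
        pexp ([:0, 0, 1:] * (P - pderiv P)) t) (at t)"
      unfolding pexp_def using 1
      by (auto intro!: derivative_eq_intros simp: field_simps power2_eq_square)
    then show ?thesis
      by (rule has_field_derivative_transform_within_open[where S = "{0<..}"])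
        (use 1 in \<open>auto simp: pexp_def\<close>)
  next
    case 2
    have "((\<lambda>t. 0) has_real_derivative pexp ([:0, 0, 1:] * (P - pderiv P)) t) (at t)"
      using 2 by (simp add: pexp_def)
    then show ?thesis
      by (rule has_field_derivative_transform_within_open[where S = "{..<0}"])
        (use 2 in \<open>auto simp: pexp_def\<close>)
  next
    case 3
    have "((\<lambda>s. poly (pCons 0 P) s * exp (- s)) \<longlongrightarrow> 0) at_top"
      by (rule poly_times_exp_neg_tendsto_0)
    then have "((\<lambda>y. poly (pCons 0 P) (inverse y) * exp (- inverse y)) \<longlongrightarrow> 0) (at_right 0)"
      using filterlim_compose filterlim_inverse_at_top_right by blast
    then have right: "((\<lambda>y. (pexp P y - pexp P 0) / (y - 0)) \<longlongrightarrow> 0) (at_right 0)"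
      by (rule Lim_transform_eventually)
        (auto simp: eventually_at_filter pexp_def field_simps)
    have left: "((\<lambda>y. (pexp P y - pexp P 0) / (y - 0)) \<longlongrightarrow> 0) (at_left 0)"
      by (rule Lim_transform_eventually[OF tendsto_const])
        (auto simp: eventually_at_filter pexp_def)
    show ?thesis using 3 left right
      by (simp add: has_field_derivative_iff filterlim_split_at pexp_def)
  qed
qed

text \<open>
Smoothness in the sense of \<^const>\<open>Ck\<close> is an infinite nest of differentiability statements about
iterated partial derivatives. It follows at once for any set of differentiable functions that is
stable under partial derivatives; the following set is one, and it contains enough bumps.
\<close>

inductive_set smooth_class :: "('a::euclidean_space \<Rightarrow> real) set" where
  const: "(\<lambda>x. c) \<in> smooth_class"
| inner: "(\<lambda>x. x \<bullet> i) \<in> smooth_class"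
| add: "f \<in> smooth_class \<Longrightarrow> g \<in> smooth_class \<Longrightarrow> (\<lambda>x. f x + g x) \<in> smooth_class"
| mult: "f \<in> smooth_class \<Longrightarrow> g \<in> smooth_class \<Longrightarrow> (\<lambda>x. f x * g x) \<in> smooth_class"
| pexp: "f \<in> smooth_class \<Longrightarrow> (\<lambda>x. pexp P (f x)) \<in> smooth_class"

lemma smooth_class_has_derivative:
  fixes f :: "'a::euclidean_space \<Rightarrow> real"
  assumes "f \<in> smooth_class"
  shows "\<exists>f'. (\<forall>x. (f has_derivative f' x) (at x)) \<and> (\<forall>i. (\<lambda>x. f' x i) \<in> smooth_class)"
  using assms
proof induction
  case (const c)
  show ?case
    by (rule exI[of _ "\<lambda>x i. 0"]) (auto intro: smooth_class.const)
next
  case (inner i)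
  show ?case
    by (rule exI[of _ "\<lambda>x j. j \<bullet> i"]) (auto intro!: smooth_class.const derivative_eq_intros)
next
  case (add f g)
  then obtain f' g' where "\<And>x. (f has_derivative f' x) (at x)" "\<And>i. (\<lambda>x. f' x i) \<in> smooth_class"
    "\<And>x. (g has_derivative g' x) (at x)" "\<And>i. (\<lambda>x. g' x i) \<in> smooth_class" by blast
  then show ?case
    by (intro exI[of _ "\<lambda>x i. f' x i + g' x i"])
      (auto intro!: smooth_class.add derivative_eq_intros)
next
  case (mult f g)
  then obtain f' g' where "\<And>x. (f has_derivative f' x) (at x)" "\<And>i. (\<lambda>x. f' x i) \<in> smooth_class"
    "\<And>x. (g has_derivative g' x) (at x)" "\<And>i. (\<lambda>x. g' x i) \<in> smooth_class" by blast
  with mult.hyps show ?case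
    by (intro exI[of _ "\<lambda>x i. f x * g' x i + f' x i * g x"])
      (auto intro!: smooth_class.add smooth_class.mult has_derivative_mult)
next
  case (pexp f P)
  then obtain f' where f': "\<And>x. (f has_derivative f' x) (at x)" "\<And>i. (\<lambda>x. f' x i) \<in> smooth_class"
    by blast
  let ?Q = "[:0, 0, 1:] * (P - pderiv P)"
  have "((\<lambda>x. pexp P (f x)) has_derivative (\<lambda>i. pexp ?Q (f x) * f' x i)) (at x)" for x
    using has_derivative_compose[OF f'(1) pexp_has_derivative[of P "f x",
          unfolded has_field_derivative_def]] by simp
  with f'(2) pexp.hyps show ?case
    by (intro exI[of _ "\<lambda>x i. pexp ?Q (f x) * f' x i"])
      (auto intro!: smooth_class.mult smooth_class.pexp)
qed

lemma smooth_class_Ck: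
  assumes "f \<in> smooth_class"
  shows "Ck k f"
  using assms
proof (induction k arbitrary: f)
  case 0
  then obtain f' where "\<And>x. (f has_derivative f' x) (at x)"
    using smooth_class_has_derivative by blast
  then show ?case
    by (auto intro!: continuous_at_imp_continuous_on has_derivative_continuous)
next
  case (Suc k)
  then obtain f' where f': "\<And>x. (f has_derivative f' x) (at x)" "\<And>i. (\<lambda>x. f' x i) \<in> smooth_class"
    using smooth_class_has_derivative by blast
  then have "frechet_derivative f (at x) = f' x" for x
    using frechet_derivative_at by metis
  with f' Suc.IH show ?case
    by (auto simp: differentiable_def)
qed

lemma smooth_class_sum:
  "finite I \<Longrightarrow> (\<And>i. i \<in> I \<Longrightarrow> f i \<in> smooth_class) \<Longrightarrow> (\<lambda>x. \<Sum>i\<in>I. f i x) \<in> smooth_class"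
  by (induction I rule: finite_induct) (auto intro: smooth_class.intros)

lemma smooth_class_prod:
  "finite I \<Longrightarrow> (\<And>i. i \<in> I \<Longrightarrow> f i \<in> smooth_class) \<Longrightarrow> (\<lambda>x. \<Prod>i\<in>I. f i x) \<in> smooth_class"
  by (induction I rule: finite_induct) (auto intro: smooth_class.intros)

lemma smooth_class_power:
  "f \<in> smooth_class \<Longrightarrow> (\<lambda>x. f x ^ k) \<in> smooth_class"
  by (induction k) (auto intro: smooth_class.intros)

lemma smooth_class_diff:
  assumes "f \<in> smooth_class" "g \<in> smooth_class"
  shows "(\<lambda>x. f x - g x) \<in> smooth_class"
proof -
  have "(\<lambda>x. f x + (-1) * g x) \<in> smooth_class"
    using assms by (intro smooth_class.intros)
  then show ?thesis by simp
qed

lemma smooth_class_norm_power2: "(\<lambda>x. (norm (x - c))\<^sup>2) \<in> smooth_class"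
proof -
  have "(\<lambda>x. \<Sum>i\<in>Basis. (x \<bullet> i - c \<bullet> i) ^ 2) \<in> smooth_class"
    by (intro smooth_class_sum smooth_class_power smooth_class_diff smooth_class.intros) auto
  moreover have "(norm (x - c))\<^sup>2 = (\<Sum>i\<in>Basis. (x \<bullet> i - c \<bullet> i) ^ 2)" for x
    by (metis (no_types, lifting) ext euclidean_inner inner_diff_left power2_eq_square power2_norm_eq_inner sum.cong)
  ultimately show ?thesis by simp
qed

lemma pexp_1: "pexp 1 t \<ge> 0" "pexp 1 t \<le> 1" "pexp 1 t > 0 \<longleftrightarrow> t > 0"
  by (auto simp: pexp_def)

lemma smooth_class_test_function:
  assumes "f \<in> smooth_class" "bounded {x. f x \<noteq> 0}"
  shows "test_function f"
  using assms by (auto simp: test_function_def smooth_class_Ck compact_closure)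

lemma square_less_iff:
  fixes x y :: real
  assumes "0 \<le> x" "0 \<le> y"
  shows "x\<^sup>2 < y\<^sup>2 \<longleftrightarrow> x < y"
  using assms power2_less_imp_less power_strict_mono[of x y 2] by auto

lemma ball_bump:
  fixes c :: "'a::euclidean_space"
  assumes "r > 0"
  obtains \<psi> where "\<psi> \<in> smooth_class" "\<And>x. 0 \<le> \<psi> x" "\<And>x. \<psi> x \<le> 1" "\<And>x. \<psi> x > 0 \<longleftrightarrow> x \<in> ball c r"
proof
  show "(\<lambda>x. pexp 1 (r\<^sup>2 - (norm (x - c))\<^sup>2)) \<in> smooth_class"
    by (intro smooth_class.pexp smooth_class_diff smooth_class.const smooth_class_norm_power2)
  show "0 < pexp 1 (r\<^sup>2 - (norm (x - c))\<^sup>2) \<longleftrightarrow> x \<in> ball c r" for x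
    using assms square_less_iff[of "norm (x - c)" r]
    by (auto simp: pexp_1 dist_norm norm_minus_commute)
qed (auto simp: pexp_1)

text \<open>
Bumps that vanish near the origin are the directions of the first variation: away from the origin
the weight \<open>1 / \<bar>x\<bar>\<^sup>\<alpha>\<close> is bounded.
\<close>

lemma annulus_bump:
  fixes \<delta> R :: real
  assumes "0 < \<delta>" "\<delta> < R"
  obtains \<psi> :: "'a::euclidean_space \<Rightarrow> real" where "test_function \<psi>" "\<And>x. 0 \<le> \<psi> x"
    "\<And>x. \<psi> x > 0 \<longleftrightarrow> \<delta> < norm x \<and> norm x < R"
proof
  let ?\<psi> = "\<lambda>x::'a. pexp 1 ((norm (x - 0))\<^sup>2 - \<delta>\<^sup>2) * pexp 1 (R\<^sup>2 - (norm (x - 0))\<^sup>2)"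
  have pos: "?\<psi> x > 0 \<longleftrightarrow> \<delta> < norm x \<and> norm x < R" for x
  proof -
    have "?\<psi> x > 0 \<longleftrightarrow> pexp 1 ((norm (x - 0))\<^sup>2 - \<delta>\<^sup>2) > 0 \<and> pexp 1 (R\<^sup>2 - (norm (x - 0))\<^sup>2) > 0"
      using pexp_1(1) by (metis less_eq_real_def mult_eq_0_iff mult_pos_pos order_less_irrefl)
    also have "\<dots> \<longleftrightarrow> \<delta>\<^sup>2 < (norm x)\<^sup>2 \<and> (norm x)\<^sup>2 < R\<^sup>2" by (auto simp: pexp_1)
    finally show ?thesis
      using assms square_less_iff[of \<delta> "norm x"] square_less_iff[of "norm x" R] by auto
  qed
  then show "?\<psi> x > 0 \<longleftrightarrow> \<delta> < norm x \<and> norm x < R" for x .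
  show nn: "0 \<le> ?\<psi> x" for x by (simp add: pexp_1)
  show "test_function ?\<psi>"
  proof (rule smooth_class_test_function)
    show "?\<psi> \<in> smooth_class"
      by (intro smooth_class.mult smooth_class.pexp smooth_class_diff smooth_class.const
          smooth_class_norm_power2)
    have "{x. ?\<psi> x \<noteq> 0} \<subseteq> ball 0 R" using pos nn by (auto simp: order_less_le)
    then show "bounded {x. ?\<psi> x \<noteq> 0}" using bounded_ball bounded_subset by blast
  qed
qed

section \<open>The fundamental lemma of the calculus of variations\<close>

text \<open>
Cover \<open>U\<close> by countably many balls \<open>B\<^sub>j\<close> and let \<open>0 \<le> \<psi>\<^sub>j \<le> 1\<close> be a bump that is positive exactly
on \<open>B\<^sub>j\<close>. Then the function \<open>1 - (\<Prod>j\<le>k. (1 - \<psi>\<^sub>j)\<^sup>k)\<close> tends to the indicator of \<open>U\<close>: a single positive \<open>\<psi>\<^sub>j\<close>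
drives the product to zero.
\<close>

lemma open_indicator_limit_of_test_functions:
  fixes U :: "'a::euclidean_space set"
  assumes "open U" "bounded U"
  obtains \<eta> :: "nat \<Rightarrow> 'a \<Rightarrow> real" where "\<And>k. test_function (\<eta> k)" "\<And>k x. 0 \<le> \<eta> k x"
    "\<And>k x. \<eta> k x \<le> 1" "\<And>k x. x \<notin> U \<Longrightarrow> \<eta> k x = 0" "\<And>x. (\<lambda>k. \<eta> k x) \<longlonglongrightarrow> indicator U x"
proof (cases "U = {}")
  case True
  show ?thesis
    by (rule that[of "\<lambda>k x. 0"])
      (use True in \<open>auto intro!: smooth_class_test_function smooth_class.const\<close>)
next
  case False
  define \<F> where "\<F> = {S. \<exists>c r. S = ball c r \<and> r > 0 \<and> ball c r \<subseteq> U}"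
  have "\<Union>\<F> = U"
  proof
    show "U \<subseteq> \<Union>\<F>"
    proof
      fix x assume "x \<in> U"
      then obtain e where "e > 0" "ball x e \<subseteq> U" using assms(1) openE by blast
      then show "x \<in> \<Union>\<F>" unfolding \<F>_def using centre_in_ball[of x e] by blast
    qed
  qed (auto simp: \<F>_def)
  moreover obtain \<F>' where \<F>': "\<F>' \<subseteq> \<F>" "countable \<F>'" "\<Union>\<F>' = \<Union>\<F>"
    using Lindelof[of \<F>] by (auto simp: \<F>_def)
  ultimately have cover: "\<Union>\<F>' = U" and "\<F>' \<noteq> {}" using False by auto
  define B where "B = from_nat_into \<F>'"
  have range_B: "range B = \<F>'" unfolding B_def using \<F>' \<open>\<F>' \<noteq> {}\<close> by (simp add: range_from_nat_into)
  have "\<exists>\<psi>. \<psi> \<in> smooth_class \<and> (\<forall>x. 0 \<le> \<psi> x) \<and> (\<forall>x. \<psi> x \<le> 1) \<and> (\<forall>x. \<psi> x > 0 \<longleftrightarrow> x \<in> B j)" for j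
  proof -
    have "B j \<in> \<F>" using range_B \<F>' by blast
    then obtain c r where "B j = ball c r" "r > 0" by (auto simp: \<F>_def)
    then show ?thesis using ball_bump[of r c] by metis
  qed
  then obtain \<psi> where \<psi>: "\<And>j. \<psi> j \<in> smooth_class" "\<And>j x. 0 \<le> \<psi> j x" "\<And>j x. \<psi> j x \<le> 1"
    "\<And>j x. \<psi> j x > 0 \<longleftrightarrow> x \<in> B j"
    by metis
  define \<eta> where "\<eta> k x = 1 - (\<Prod>j\<le>k. (1 - \<psi> j x) ^ k)" for k x
  have outside: "\<eta> k x = 0" if "x \<notin> U" for k x
  proof -
    have "\<psi> j x = 0" for j
      using that \<psi>(2)[of j x] \<psi>(4)[of j x] cover range_B by (metis UnionI less_eq_real_def rangeI)
    then show ?thesis by (simp add: \<eta>_def)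
  qed
  have range01: "0 \<le> (\<Prod>j\<le>k. (1 - \<psi> j x) ^ k)" "(\<Prod>j\<le>k. (1 - \<psi> j x) ^ k) \<le> 1" for k x
    using \<psi>(2,3) by (auto intro!: prod_nonneg prod_le_1 zero_le_power power_le_one)
  show ?thesis
  proof (rule that[of \<eta>])
    fix k
    have "\<eta> k \<in> smooth_class"
      unfolding \<eta>_def using \<psi>
      by (intro smooth_class_diff smooth_class_prod smooth_class_power smooth_class.const) auto
    moreover have "{x. \<eta> k x \<noteq> 0} \<subseteq> U" using outside by auto
    ultimately show "test_function (\<eta> k)"
      using assms bounded_subset smooth_class_test_function by blast
  next
    fix x
    show "(\<lambda>k. \<eta> k x) \<longlonglongrightarrow> indicator U x"
    proof (cases "x \<in> U")
      case True
      then obtain j where j: "x \<in> B j" using cover range_B by blast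
      have upper: "(\<Prod>i\<le>k. (1 - \<psi> i x) ^ k) \<le> (1 - \<psi> j x) ^ k" if "j \<le> k" for k
      proof -
        have "(\<Prod>i\<le>k. (1 - \<psi> i x) ^ k) = (1 - \<psi> j x) ^ k * (\<Prod>i\<in>{..k} - {j}. (1 - \<psi> i x) ^ k)"
          using that by (subst prod.remove[of _ j]) auto
        also have "\<dots> \<le> (1 - \<psi> j x) ^ k * 1"
          using \<psi>(2,3) by (intro mult_left_mono prod_le_1) (auto intro!: power_le_one)
        finally show ?thesis by simp
      qed
      have lim: "(\<lambda>k. (1 - \<psi> j x) ^ k) \<longlonglongrightarrow> 0"
        using \<psi>(2,3)[of j x] \<psi>(4)[of j x] j by (intro LIMSEQ_realpow_zero) auto
      have "(\<lambda>k. (\<Prod>i\<le>k. (1 - \<psi> i x) ^ k)) \<longlonglongrightarrow> 0"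
        by (rule tendsto_sandwich[OF _ _ tendsto_const[of 0] lim])
          (use upper range01 in \<open>auto intro: eventually_sequentiallyI[of j]\<close>)
      from tendsto_diff[OF tendsto_const[of 1] this] show ?thesis using True by (simp add: \<eta>_def)
    qed (simp add: outside)
  qed (use range01 outside in \<open>auto simp: \<eta>_def\<close>)
qed

text \<open>
The one-sided fundamental lemma of the calculus of variations. By dominated convergence the sign of
the test integrals passes to the integrals over open sets, and by outer regularity to the
integral over the set where \<open>g\<close> is negative.
\<close>

lemma AE_nonneg_if_test_integrals_nonneg:
  fixes g :: "'a::euclidean_space \<Rightarrow> real"
  assumes "open \<Omega>" "bounded \<Omega>" and int: "set_integrable lebesgue \<Omega> g"
    and test: "\<And>\<psi>. test_function \<psi> \<Longrightarrow> (\<And>x. 0 \<le> \<psi> x) \<Longrightarrow> (\<And>x. \<psi> x \<le> 1) \<Longrightarrow>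
      (\<And>x. x \<notin> \<Omega> \<Longrightarrow> \<psi> x = 0) \<Longrightarrow> 0 \<le> (LINT x|lebesgue. g x * \<psi> x)"
  shows "AE x in lebesgue. x \<in> \<Omega> \<longrightarrow> 0 \<le> g x"
proof -
  define G where "G x = indicator \<Omega> x * g x" for x
  have G: "integrable lebesgue G" using int by (simp add: G_def[abs_def] set_integrable_def)
  then have G_meas[measurable]: "G \<in> borel_measurable lebesgue" by auto
  have open_nonneg: "0 \<le> (LINT x|lebesgue. G x * indicator U x)" if "open U" for U
  proof -
    have "open (U \<inter> \<Omega>)" "bounded (U \<inter> \<Omega>)" using assms that by (auto intro: bounded_subset)
    then obtain \<eta> :: "nat \<Rightarrow> 'a \<Rightarrow> real" where \<eta>: "\<And>k. test_function (\<eta> k)" "\<And>k x. 0 \<le> \<eta> k x"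
      "\<And>k x. \<eta> k x \<le> 1" "\<And>k x. x \<notin> U \<inter> \<Omega> \<Longrightarrow> \<eta> k x = 0"
      "\<And>x. (\<lambda>k. \<eta> k x) \<longlonglongrightarrow> indicator (U \<inter> \<Omega>) x"
      using open_indicator_limit_of_test_functions by (smt (verit) Int_iff)
    have eq: "G x * \<eta> k x = g x * \<eta> k x" for k x
      using \<eta>(4)[of x k] by (cases "x \<in> \<Omega>") (auto simp: G_def)
    have [measurable]: "\<eta> k \<in> borel_measurable lebesgue" for k
    proof -
      have "Ck 0 (\<eta> k)" using \<eta>(1) test_function_def by blast
      then show ?thesis
        by (simp add: borel_measurable_continuous_onI measurable_completion)
    qed
    have [measurable]: "U \<inter> \<Omega> \<in> sets lebesgue" using \<open>open (U \<inter> \<Omega>)\<close> by auto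
    have "(\<lambda>k. LINT x|lebesgue. G x * \<eta> k x) \<longlonglongrightarrow> (LINT x|lebesgue. G x * indicator (U \<inter> \<Omega>) x)"
    proof (rule integral_dominated_convergence[where w = "\<lambda>x. \<bar>G x\<bar>"])
      show "AE x in lebesgue. (\<lambda>k. G x * \<eta> k x) \<longlonglongrightarrow> G x * indicator (U \<inter> \<Omega>) x"
        using \<eta>(5) by (auto intro!: tendsto_intros)
      show "AE x in lebesgue. norm (G x * \<eta> k x) \<le> \<bar>G x\<bar>" for k
        using \<eta>(2,3) by (auto simp: abs_mult intro!: mult_left_le)
    qed (use G in auto)
    moreover have "0 \<le> (LINT x|lebesgue. G x * \<eta> k x)" for k
      unfolding eq using test[OF \<eta>(1,2,3)] \<eta>(4) by auto
    ultimately have "0 \<le> (LINT x|lebesgue. G x * indicator (U \<inter> \<Omega>) x)"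
      by (intro LIMSEQ_le_const) auto
    also have "(\<lambda>x. G x * indicator (U \<inter> \<Omega>) x) = (\<lambda>x. G x * indicator U x)"
      by (auto simp: G_def indicator_def)
    finally show ?thesis .
  qed
  define S where "S = {x. G x < 0}"
  have S[measurable]: "S \<in> sets lebesgue"
    using measurable_sets[OF G_meas, of "{..<0}"] by (simp add: S_def vimage_def)
  have "\<exists>T. open T \<and> S \<subseteq> T \<and> emeasure lebesgue (T - S) < ennreal (inverse (real (Suc n)))" for n
    using sets_lebesgue_outer_open[OF S, of "inverse (real (Suc n))"] by (metis inverse_positive_iff_positive of_nat_0_less_iff zero_less_Suc)
  then obtain T where T: "\<And>n. open (T n)" "\<And>n. S \<subseteq> T n"
    "\<And>n. emeasure lebesgue (T n - S) < ennreal (inverse (real (Suc n)))" by metis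
  have [measurable]: "T n \<in> sets lebesgue" for n using T(1) by auto
  \<comment> \<open>Intersecting makes the sequence of open sets decrease, so that its indicators converge.\<close>
  define W where "W n = (\<Inter>m\<le>n. T m)" for n
  have W_open: "open (W n)" for n unfolding W_def using T(1) by (intro open_INT) auto
  have [measurable]: "W n \<in> sets lebesgue" for n using W_open by auto
  have null: "(\<Inter>n. T n) - S \<in> null_sets lebesgue"
  proof (rule null_setsI)
    have "emeasure lebesgue ((\<Inter>n. T n) - S) \<le> ennreal (inverse (real (Suc n)))" for n
    proof -
      have "emeasure lebesgue ((\<Inter>n. T n) - S) \<le> emeasure lebesgue (T n - S)"
        by (intro emeasure_mono) auto
      then show ?thesis using T(3)[of n] by simp
    qed
    moreover have "(\<lambda>n. ennreal (inverse (real (Suc n)))) \<longlonglongrightarrow> ennreal 0"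
      by (intro tendsto_ennrealI LIMSEQ_inverse_real_of_nat)
    ultimately show "emeasure lebesgue ((\<Inter>n. T n) - S) = 0"
      by (metis (no_types, lifting) LIMSEQ_le_const ennreal_0 le_zero_eq)
  qed auto
  have W_lim: "(\<lambda>n. indicator (W n) x :: real) \<longlonglongrightarrow> indicator (\<Inter>n. T n) x" for x
  proof (cases "x \<in> (\<Inter>n. T n)")
    case True
    then have "indicator (W n) x = (1::real)" for n by (auto simp: W_def)
    then show ?thesis using True by simp
  next
    case False
    then obtain m where "x \<notin> T m" by auto
    then have "indicator (W n) x = (0::real)" if "n \<ge> m" for n using that by (auto simp: W_def indicator_def)
    then have "(\<lambda>n. indicator (W n) x :: real) \<longlonglongrightarrow> 0"
      by (intro tendsto_eventually) (auto simp: eventually_sequentially)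
    then show ?thesis using False by simp
  qed
  have "(\<lambda>n. LINT x|lebesgue. G x * indicator (W n) x) \<longlonglongrightarrow> (LINT x|lebesgue. G x * indicator S x)"
  proof (rule integral_dominated_convergence[where w = "\<lambda>x. \<bar>G x\<bar>"])
    show "AE x in lebesgue. (\<lambda>k. G x * indicator (W k) x) \<longlonglongrightarrow> G x * indicator S x"
      using AE_not_in[OF null]
    proof eventually_elim
      case (elim x)
      then have "indicator (\<Inter>n. T n) x = (indicator S x :: real)" using T(2) by (auto simp: indicator_def)
      then show ?case using W_lim[of x] by (auto intro!: tendsto_intros)
    qed
    show "AE x in lebesgue. norm (G x * indicator (W k) x) \<le> \<bar>G x\<bar>" for k
      by (auto simp: abs_mult indicator_def)
  qed (use G in auto)
  then have "0 \<le> (LINT x|lebesgue. G x * indicator S x)"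
    using open_nonneg[OF W_open] by (intro LIMSEQ_le_const) auto
  moreover have int_S: "integrable lebesgue (\<lambda>x. - (G x * indicator S x))"
    using G by (auto intro!: integrable_real_mult_indicator)
  moreover have nonneg: "AE x in lebesgue. 0 \<le> - (G x * indicator S x)"
    by (auto simp: S_def indicator_def)
  ultimately have "(LINT x|lebesgue. - (G x * indicator S x)) = 0"
    using integral_nonneg_AE[OF nonneg] by simp
  then have "AE x in lebesgue. - (G x * indicator S x) = 0"
    using integral_nonneg_eq_0_iff_AE[OF int_S nonneg] by simp
  then show ?thesis
    by eventually_elim (auto simp: S_def G_def indicator_def split: if_splits)
qed

section \<open>Weak gradients and the energy space\<close>

lemma test_function_has_derivative:
  assumes "test_function \<psi>"
  shows "(\<psi> has_derivative frechet_derivative \<psi> (at x)) (at x)"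
proof -
  have "Ck 1 \<psi>" using assms by (simp add: test_function_def)
  then show ?thesis by (simp add: frechet_derivative_works)
qed

lemma test_function_continuous:
  assumes "test_function \<psi>"
  shows "continuous_on UNIV \<psi>"
    and "i \<in> Basis \<Longrightarrow> continuous_on UNIV (\<lambda>x. frechet_derivative \<psi> (at x) i)"
proof -
  have "Ck 0 \<psi>" "Ck 1 \<psi>" using assms by (simp_all add: test_function_def)
  then show "continuous_on UNIV \<psi>" "i \<in> Basis \<Longrightarrow> continuous_on UNIV (\<lambda>x. frechet_derivative \<psi> (at x) i)"
    by auto
qed

lemma borel_measurable_continuous_lebesgue:
  "continuous_on UNIV f \<Longrightarrow> f \<in> borel_measurable lebesgue"
  for f :: "'a::euclidean_space \<Rightarrow> 'b::euclidean_space"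
  by (simp add: borel_measurable_continuous_onI measurable_completion)

lemma test_function_measurable:
  assumes "test_function \<psi>"
  shows "\<psi> \<in> borel_measurable lebesgue"
    and "i \<in> Basis \<Longrightarrow> (\<lambda>x. frechet_derivative \<psi> (at x) i) \<in> borel_measurable lebesgue"
  using test_function_continuous[OF assms] by (auto intro: borel_measurable_continuous_lebesgue)

lemma continuous_bounded_off_compact:
  fixes f :: "'a::euclidean_space \<Rightarrow> real"
  assumes "continuous_on UNIV f" "compact K" "\<And>x. x \<notin> K \<Longrightarrow> f x = 0"
  shows "\<exists>C\<ge>0. \<forall>x. \<bar>f x\<bar> \<le> C"
proof -
  have "bounded (f ` K)"
    using assms(1,2) by (intro compact_imp_bounded compact_continuous_image)
      (auto intro: continuous_on_subset)
  then obtain C where "C > 0" "\<And>x. x \<in> K \<Longrightarrow> \<bar>f x\<bar> \<le> C" by (auto simp: bounded_pos)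
  then show ?thesis using assms(3) by (intro exI[of _ C]) (metis abs_zero less_eq_real_def)
qed

lemma test_function_support:
  fixes \<psi> :: "'a::euclidean_space \<Rightarrow> real"
  assumes "test_function \<psi>"
  obtains K C where "compact K" "C \<ge> 0" "\<And>x. x \<notin> K \<Longrightarrow> \<psi> x = 0"
    "\<And>x i. x \<notin> K \<Longrightarrow> frechet_derivative \<psi> (at x) i = 0"
    "\<And>x. \<bar>\<psi> x\<bar> \<le> C" "\<And>x i. i \<in> Basis \<Longrightarrow> \<bar>frechet_derivative \<psi> (at x) i\<bar> \<le> C"
proof -
  have "compact (closure {x. \<psi> x \<noteq> 0})"
    using assms unfolding test_function_def by (rule conjunct2)
  then obtain K where K: "compact K" and sub: "{x. \<psi> x \<noteq> 0} \<subseteq> K"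
    using closure_subset by metis
  have zero: "\<psi> x = 0" if "x \<notin> K" for x using that sub by blast
  have dzero: "frechet_derivative \<psi> (at x) i = 0" if "x \<notin> K" for x i
  proof -
    have "open (- K)" using K by (simp add: compact_imp_closed open_Compl)
    have "((\<lambda>x. 0) has_derivative (\<lambda>i. 0)) (at x)" by simp
    then have "(\<psi> has_derivative (\<lambda>i. 0)) (at x)"
      by (rule has_derivative_transform_within_open[OF _ \<open>open (- K)\<close>]) (use that zero in auto)
    then show ?thesis using frechet_derivative_at by metis
  qed
  have "\<forall>i\<in>Basis. \<exists>C\<ge>0. \<forall>x. \<bar>frechet_derivative \<psi> (at x) i\<bar> \<le> C"
    using continuous_bounded_off_compact[OF test_function_continuous(2)[OF assms] K dzero] by blast
  then obtain C where C: "\<And>i. i \<in> Basis \<Longrightarrow> C i \<ge> 0"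
    "\<And>i x. i \<in> Basis \<Longrightarrow> \<bar>frechet_derivative \<psi> (at x) i\<bar> \<le> C i" by metis
  obtain C0 where C0: "C0 \<ge> 0" "\<And>x. \<bar>\<psi> x\<bar> \<le> C0"
    using continuous_bounded_off_compact[OF test_function_continuous(1)[OF assms] K zero] by blast
  have C_le: "C i \<le> sum C Basis" if "i \<in> Basis" for i
    using C(1) that by (intro member_le_sum) auto
  have "0 \<le> sum C Basis" using C(1) by (simp add: sum_nonneg)
  show ?thesis
  proof (rule that[OF K, of "C0 + sum C Basis"])
    show "\<bar>frechet_derivative \<psi> (at x) i\<bar> \<le> C0 + sum C Basis" if "i \<in> Basis" for x i
      using C(2)[OF that, of x] C_le[OF that] C0 by linarith
    show "\<bar>\<psi> x\<bar> \<le> C0 + sum C Basis" for x using C0(2)[of x] \<open>0 \<le> sum C Basis\<close> by linarith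
  qed (use zero dzero C0 \<open>0 \<le> sum C Basis\<close> in auto)
qed

lemma integrable_locally_times:
  fixes f :: "'a::euclidean_space \<Rightarrow> real"
  assumes "locally_integrable f" "h \<in> borel_measurable lebesgue" "compact K"
    "\<And>x. x \<notin> K \<Longrightarrow> h x = 0" "\<And>x. \<bar>h x\<bar> \<le> C"
  shows "integrable lebesgue (\<lambda>x. f x * h x)"
proof -
  have int: "integrable lebesgue (\<lambda>x. indicator K x * f x)"
    using assms(1,3) by (auto simp: locally_integrable_def set_integrable_def)
  have eq: "f x * h x = (indicator K x * f x) * h x" for x
    using assms(4) by (auto simp: indicator_def)
  show ?thesis
  proof (rule Bochner_Integration.integrable_bound[where f = "\<lambda>x. C * (indicator K x * f x)"])
    show "(\<lambda>x. f x * h x) \<in> borel_measurable lebesgue"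
      unfolding eq using int assms(2) by measurable
    show "AE x in lebesgue. norm (f x * h x) \<le> norm (C * (indicator K x * f x))"
    proof (intro AE_I2)
      fix x
      have "\<bar>h x\<bar> \<le> \<bar>C\<bar>" using assms(5)[of x] by linarith
      then show "norm (f x * h x) \<le> norm (C * (indicator K x * f x))"
        unfolding eq by (simp add: abs_mult mult.commute[of _ "\<bar>h x\<bar>"] mult_right_mono)
    qed
  qed (use int in auto)
qed

lemma locally_integrable_measurable:
  fixes f :: "'a::euclidean_space \<Rightarrow> 'b::euclidean_space"
  assumes "locally_integrable f"
  shows "f \<in> borel_measurable lebesgue"
proof (rule borel_measurable_LIMSEQ_metric)
  show "(\<lambda>x. indicator (cball 0 (real n)) x *\<^sub>R f x) \<in> borel_measurable lebesgue" for n
    by (rule borel_measurable_integrable)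
      (use assms in \<open>simp add: locally_integrable_def set_integrable_def\<close>)
  fix x :: 'a
  obtain m where "norm x \<le> real m" using real_arch_simple by blast
  then have "indicator (cball 0 (real n)) x *\<^sub>R f x = f x" if "n \<ge> m" for n
    using that by (auto simp: indicator_def)
  then show "(\<lambda>n. indicator (cball 0 (real n)) x *\<^sub>R f x) \<longlonglongrightarrow> f x"
    by (intro tendsto_eventually) (auto simp: eventually_sequentially)
qed

lemma locally_integrable_inner:
  assumes "locally_integrable g"
  shows "locally_integrable (\<lambda>x. g x \<bullet> i)"
  unfolding locally_integrable_def set_integrable_def
proof (intro allI impI)
  fix K :: "'a set"
  assume "compact K"
  then have "integrable lebesgue (\<lambda>x. indicator K x *\<^sub>R g x)"
    using assms by (simp add: locally_integrable_def set_integrable_def)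
  then have "integrable lebesgue (\<lambda>x. (indicator K x *\<^sub>R g x) \<bullet> i)" by (rule integrable_inner_left)
  then show "integrable lebesgue (\<lambda>x. indicator K x *\<^sub>R (g x \<bullet> i))" by simp
qed

lemma locally_integrable_add_scaled:
  assumes "locally_integrable f" "locally_integrable g"
  shows "locally_integrable (\<lambda>x. f x + c *\<^sub>R g x)"
  unfolding locally_integrable_def set_integrable_def
proof (intro allI impI)
  fix K :: "'a set"
  assume "compact K"
  then have "integrable lebesgue (\<lambda>x. indicator K x *\<^sub>R f x)" "integrable lebesgue (\<lambda>x. indicator K x *\<^sub>R g x)"
    using assms by (simp_all add: locally_integrable_def set_integrable_def)
  then have "integrable lebesgue (\<lambda>x. indicator K x *\<^sub>R f x + c *\<^sub>R (indicator K x *\<^sub>R g x))"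
    by (intro Bochner_Integration.integrable_add integrable_scaleR_right)
  then show "integrable lebesgue (\<lambda>x. indicator K x *\<^sub>R (f x + c *\<^sub>R g x))"
    by (simp add: scaleR_add_right mult.commute)
qed

lemma has_weak_gradientD:
  assumes "has_weak_gradient u g"
  shows "locally_integrable u" "locally_integrable g"
    and "test_function \<psi> \<Longrightarrow> i \<in> Basis \<Longrightarrow>
      (LINT x|lebesgue. u x * frechet_derivative \<psi> (at x) i) = - (LINT x|lebesgue. (g x \<bullet> i) * \<psi> x)"
  using assms unfolding has_weak_gradient_def by blast+

lemma has_weak_gradient_integrable:
  assumes "has_weak_gradient u g" "test_function \<psi>" "i \<in> Basis"
  shows "integrable lebesgue (\<lambda>x. u x * frechet_derivative \<psi> (at x) i)"
    and "integrable lebesgue (\<lambda>x. (g x \<bullet> i) * \<psi> x)"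
proof -
  obtain K C where K: "compact K" "\<And>x. x \<notin> K \<Longrightarrow> \<psi> x = 0"
    "\<And>x i. x \<notin> K \<Longrightarrow> frechet_derivative \<psi> (at x) i = 0"
    "\<And>x. \<bar>\<psi> x\<bar> \<le> C" "\<And>x i. i \<in> Basis \<Longrightarrow> \<bar>frechet_derivative \<psi> (at x) i\<bar> \<le> C"
    by (rule test_function_support[OF assms(2)]) blast
  have loc: "locally_integrable u" "locally_integrable (\<lambda>x. g x \<bullet> i)"
    using has_weak_gradientD[OF assms(1)] by (auto intro: locally_integrable_inner)
  note meas = test_function_measurable[OF assms(2)]
  show "integrable lebesgue (\<lambda>x. u x * frechet_derivative \<psi> (at x) i)"
    by (rule integrable_locally_times[where f = u and h = "\<lambda>x. frechet_derivative \<psi> (at x) i" and K = K and C = C])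
      (use loc meas(2)[OF assms(3)] K(1,3) K(5)[OF assms(3)] in auto)
  show "integrable lebesgue (\<lambda>x. (g x \<bullet> i) * \<psi> x)"
    by (rule integrable_locally_times[where f = "\<lambda>x. g x \<bullet> i" and h = \<psi> and K = K and C = C])
      (use loc meas(1) K(1,2,4) in auto)
qed

lemma has_weak_gradient_add_scaled:
  assumes u: "has_weak_gradient u g" and v: "has_weak_gradient v h"
  shows "has_weak_gradient (\<lambda>x. u x + c * v x) (\<lambda>x. g x + c *\<^sub>R h x)"
  unfolding has_weak_gradient_def
proof (intro conjI allI impI ballI)
  show "locally_integrable (\<lambda>x. u x + c * v x)"
    using locally_integrable_add_scaled[OF has_weak_gradientD(1)[OF u] has_weak_gradientD(1)[OF v], of c] by simp
  show "locally_integrable (\<lambda>x. g x + c *\<^sub>R h x)"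
    by (rule locally_integrable_add_scaled[OF has_weak_gradientD(2)[OF u] has_weak_gradientD(2)[OF v]])
  fix \<psi> :: "'a \<Rightarrow> real" and i :: 'a
  assume \<psi>: "test_function \<psi>" and i: "i \<in> Basis"
  note int = has_weak_gradient_integrable[OF u \<psi> i] has_weak_gradient_integrable[OF v \<psi> i]
  have "(LINT x|lebesgue. (u x + c * v x) * frechet_derivative \<psi> (at x) i)
      = (LINT x|lebesgue. u x * frechet_derivative \<psi> (at x) i + c * (v x * frechet_derivative \<psi> (at x) i))"
    by (simp add: algebra_simps)
  also have "\<dots> = (LINT x|lebesgue. u x * frechet_derivative \<psi> (at x) i)
      + c * (LINT x|lebesgue. v x * frechet_derivative \<psi> (at x) i)"
    using int by simp
  also have "\<dots> = - ((LINT x|lebesgue. (g x \<bullet> i) * \<psi> x) + c * (LINT x|lebesgue. (h x \<bullet> i) * \<psi> x))"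
    using has_weak_gradientD(3)[OF u \<psi> i] has_weak_gradientD(3)[OF v \<psi> i] by simp
  also have "\<dots> = - (LINT x|lebesgue. (g x \<bullet> i) * \<psi> x + c * ((h x \<bullet> i) * \<psi> x))"
    using int by simp
  finally show "(LINT x|lebesgue. (u x + c * v x) * frechet_derivative \<psi> (at x) i)
      = - (LINT x|lebesgue. (g x + c *\<^sub>R h x) \<bullet> i * \<psi> x)"
    by (simp add: algebra_simps inner_add_left)
qed

lemma AE_zero_if_test_integrals_zero:
  fixes g :: "'a::euclidean_space \<Rightarrow> real"
  assumes "locally_integrable g" "\<And>\<psi>. test_function \<psi> \<Longrightarrow> (LINT x|lebesgue. g x * \<psi> x) = 0"
  shows "AE x in lebesgue. g x = 0"
proof -
  have int: "set_integrable lebesgue (ball 0 (real n)) g" for n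
  proof (rule set_integrable_subset)
    show "set_integrable lebesgue (cball 0 (real n)) g"
      using assms(1) by (simp add: locally_integrable_def)
  qed auto
  have int': "set_integrable lebesgue (ball 0 (real n)) (\<lambda>x. - g x)" for n
    using int[of n] by (simp add: set_integrable_def)
  have "AE x in lebesgue. x \<in> ball 0 (real n) \<longrightarrow> 0 \<le> g x" for n
    using assms(2) int by (intro AE_nonneg_if_test_integrals_nonneg) auto
  moreover have "AE x in lebesgue. x \<in> ball 0 (real n) \<longrightarrow> 0 \<le> - g x" for n
    using assms(2) int' by (intro AE_nonneg_if_test_integrals_nonneg) auto
  ultimately have "AE x in lebesgue. \<forall>n::nat. (x \<in> ball 0 (real n) \<longrightarrow> 0 \<le> g x) \<and> (x \<in> ball 0 (real n) \<longrightarrow> 0 \<le> - g x)"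
    by (auto simp: AE_all_countable)
  then show ?thesis
  proof eventually_elim
    case (elim x)
    obtain n where "norm x < real n" using reals_Archimedean2 by blast
    then show ?case using elim[rule_format, of n] by auto
  qed
qed

lemma has_weak_gradient_unique:
  assumes "has_weak_gradient u g" "has_weak_gradient u h"
  shows "AE x in lebesgue. g x = h x"
proof -
  have "AE x in lebesgue. (g x + (-1) *\<^sub>R h x) \<bullet> i = 0" if i: "i \<in> Basis" for i
  proof (rule AE_zero_if_test_integrals_zero)
    show "locally_integrable (\<lambda>x. (g x + (-1) *\<^sub>R h x) \<bullet> i)"
      by (intro locally_integrable_inner locally_integrable_add_scaled
          has_weak_gradientD(2)[OF assms(1)] has_weak_gradientD(2)[OF assms(2)])
    fix \<psi> :: "'a \<Rightarrow> real"
    assume \<psi>: "test_function \<psi>"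
    have "(LINT x|lebesgue. (g x + (-1) *\<^sub>R h x) \<bullet> i * \<psi> x)
        = (LINT x|lebesgue. g x \<bullet> i * \<psi> x - h x \<bullet> i * \<psi> x)"
      by (simp add: algebra_simps inner_diff_left)
    also have "\<dots> = (LINT x|lebesgue. g x \<bullet> i * \<psi> x) - (LINT x|lebesgue. h x \<bullet> i * \<psi> x)"
      using has_weak_gradient_integrable[OF assms(1) \<psi> i] has_weak_gradient_integrable[OF assms(2) \<psi> i]
      by simp
    also have "\<dots> = 0" using has_weak_gradientD(3)[OF assms(1) \<psi> i] has_weak_gradientD(3)[OF assms(2) \<psi> i] by simp
    finally show "(LINT x|lebesgue. (g x + (-1) *\<^sub>R h x) \<bullet> i * \<psi> x) = 0" .
  qed
  then have "AE x in lebesgue. \<forall>i\<in>Basis. (g x + (-1) *\<^sub>R h x) \<bullet> i = 0"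
    by (simp add: AE_ball_countable countable_finite)
  then show ?thesis
  proof eventually_elim
    case (elim x)
    show ?case by (rule euclidean_eqI) (use elim in \<open>simp add: inner_diff_left\<close>)
  qed
qed

text \<open>
This is what makes \<^const>\<open>X_inner\<close> computable: the unspecified choice in \<^const>\<open>weak_gradient\<close>
may be replaced by any weak gradient at hand, and is therefore linear up to null sets.
\<close>

lemma weak_gradient_AE_eq:
  assumes "has_weak_gradient u g"
  shows "has_weak_gradient u (weak_gradient u)" "AE x in lebesgue. weak_gradient u x = g x"
proof -
  show "has_weak_gradient u (weak_gradient u)"
    unfolding weak_gradient_def by (rule someI[of "has_weak_gradient u", OF assms])
  then show "AE x in lebesgue. weak_gradient u x = g x"
    by (rule has_weak_gradient_unique[OF _ assms])
qed

lemma Lp_2_iff: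
  "f \<in> Lp 2 \<longleftrightarrow> f \<in> borel_measurable lebesgue \<and> integrable lebesgue (\<lambda>x. (f x)\<^sup>2)"
proof -
  have "\<bar>f x\<bar> powr 2 = (f x)\<^sup>2" for x by (cases "f x = 0") (auto simp: powr_realpow')
  then show ?thesis by (simp add: Lp_def)
qed

lemma H1_weak_gradient:
  assumes "u \<in> H1"
  shows "has_weak_gradient u (weak_gradient u)" "weak_gradient u \<in> borel_measurable lebesgue"
    "integrable lebesgue (\<lambda>x. (norm (weak_gradient u x))\<^sup>2)"
    "u \<in> borel_measurable lebesgue" "integrable lebesgue (\<lambda>x. (u x)\<^sup>2)"
proof -
  obtain g where g: "has_weak_gradient u g" "(\<lambda>x. norm (g x)) \<in> Lp 2"
    using assms by (auto simp: H1_def)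
  show *: "has_weak_gradient u (weak_gradient u)" by (rule weak_gradient_AE_eq[OF g(1)])
  then show [measurable]: "weak_gradient u \<in> borel_measurable lebesgue"
    by (intro locally_integrable_measurable has_weak_gradientD(2))
  have [measurable]: "(\<lambda>x. norm (g x)) \<in> borel_measurable lebesgue" using g(2) by (simp add: Lp_2_iff)
  have "AE x in lebesgue. (norm (weak_gradient u x))\<^sup>2 = (norm (g x))\<^sup>2"
    using weak_gradient_AE_eq(2)[OF g(1)] by eventually_elim simp
  then show "integrable lebesgue (\<lambda>x. (norm (weak_gradient u x))\<^sup>2)"
    using g(2) by (subst integrable_cong_AE) (auto simp: Lp_2_iff)
  show "u \<in> borel_measurable lebesgue" "integrable lebesgue (\<lambda>x. (u x)\<^sup>2)"
    using assms by (auto simp: H1_def Lp_2_iff)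
qed

lemma integrable_inner_if_square_integrable:
  fixes f g :: "'a \<Rightarrow> 'b::euclidean_space"
  assumes [measurable]: "f \<in> borel_measurable M" "g \<in> borel_measurable M"
    and "integrable M (\<lambda>x. (norm (f x))\<^sup>2)" "integrable M (\<lambda>x. (norm (g x))\<^sup>2)"
  shows "integrable M (\<lambda>x. f x \<bullet> g x)"
proof (rule Bochner_Integration.integrable_bound)
  show "integrable M (\<lambda>x. (norm (f x))\<^sup>2 + (norm (g x))\<^sup>2)" using assms by auto
  show "AE x in M. norm (f x \<bullet> g x) \<le> norm ((norm (f x))\<^sup>2 + (norm (g x))\<^sup>2)"
  proof (intro AE_I2)
    fix x
    have "norm (f x \<bullet> g x) \<le> norm (f x) * norm (g x)" by (simp add: Cauchy_Schwarz_ineq2)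
    moreover have "2 * (norm (f x) * norm (g x)) \<le> (norm (f x))\<^sup>2 + (norm (g x))\<^sup>2"
      using sum_squares_bound[of "norm (f x)" "norm (g x)"] by (simp add: mult.assoc)
    moreover have "0 \<le> norm (f x) * norm (g x)" by simp
    ultimately have "norm (f x \<bullet> g x) \<le> (norm (f x))\<^sup>2 + (norm (g x))\<^sup>2" by linarith
    then show "norm (f x \<bullet> g x) \<le> norm ((norm (f x))\<^sup>2 + (norm (g x))\<^sup>2)" by simp
  qed
qed simp

lemma X_inner_integrable:
  assumes V: "V \<in> borel_measurable lebesgue" "\<And>x. V x > 0"
    and "u \<in> X_space V" "v \<in> X_space V"
  shows "integrable lebesgue (\<lambda>x. weak_gradient u x \<bullet> weak_gradient v x)"
    and "integrable lebesgue (\<lambda>x. V x * u x * v x)"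
proof -
  have H: "u \<in> H1" "v \<in> H1" using assms by (auto simp: X_space_def)
  show "integrable lebesgue (\<lambda>x. weak_gradient u x \<bullet> weak_gradient v x)"
    using H H1_weak_gradient by (intro integrable_inner_if_square_integrable) auto
  have [measurable]: "V \<in> borel_measurable lebesgue" "u \<in> borel_measurable lebesgue"
      "v \<in> borel_measurable lebesgue"
    using V H H1_weak_gradient by auto
  have sq: "(sqrt (V x) * w)\<^sup>2 = V x * w\<^sup>2" for w x
    using V(2)[of x] by (simp add: power_mult_distrib)
  have int: "integrable lebesgue (\<lambda>x. (sqrt (V x) * u x) \<bullet> (sqrt (V x) * v x))"
    using assms by (intro integrable_inner_if_square_integrable) (auto simp: sq X_space_def)
  have eq: "(sqrt (V x) * u x) \<bullet> (sqrt (V x) * v x) = V x * u x * v x" for x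
  proof -
    have "(sqrt (V x) * u x) \<bullet> (sqrt (V x) * v x) = (sqrt (V x) * sqrt (V x)) * u x * v x" by simp
    then show ?thesis using V(2)[of x] by simp
  qed
  show "integrable lebesgue (\<lambda>x. V x * u x * v x)" using int unfolding eq .
qed

lemma X_space_add_scaled:
  assumes V: "V \<in> borel_measurable lebesgue" "\<And>x. V x > 0"
    and u: "u \<in> X_space V" and v: "v \<in> X_space V"
  shows "(\<lambda>x. u x + c * v x) \<in> X_space V"
    and "X_inner V (\<lambda>x. u x + c * v x) (\<lambda>x. u x + c * v x)
      = X_inner V u u + 2 * c * X_inner V u v + c\<^sup>2 * X_inner V v v"
proof -
  have H: "u \<in> H1" "v \<in> H1" using u v by (auto simp: X_space_def)
  note gu = H1_weak_gradient[OF H(1)] and gv = H1_weak_gradient[OF H(2)]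
  let ?w = "\<lambda>x. u x + c * v x"
  let ?g = "\<lambda>x. weak_gradient u x + c *\<^sub>R weak_gradient v x"
  have gw: "has_weak_gradient ?w ?g" by (rule has_weak_gradient_add_scaled[OF gu(1) gv(1)])
  note [measurable] = gu(2,4) gv(2,4) V(1)
  have int_uv: "integrable lebesgue (\<lambda>x. u x * v x)"
    using integrable_inner_if_square_integrable[of u lebesgue v] gu gv by simp
  have "integrable lebesgue (\<lambda>x. (u x)\<^sup>2 + (2 * c) * (u x * v x) + c\<^sup>2 * (v x)\<^sup>2)"
    using int_uv gu gv by auto
  then have L2: "?w \<in> Lp 2"
    unfolding Lp_2_iff by (auto simp: power2_sum power_mult_distrib algebra_simps)
  have norm_g: "(norm (?g x))\<^sup>2 = (norm (weak_gradient u x))\<^sup>2 +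
      2 * c * (weak_gradient u x \<bullet> weak_gradient v x) + c\<^sup>2 * (norm (weak_gradient v x))\<^sup>2" for x
    unfolding power2_norm_eq_inner
    by (simp add: inner_add_left inner_add_right inner_commute power2_eq_square algebra_simps)
  have int_g: "integrable lebesgue (\<lambda>x. (norm (?g x))\<^sup>2)"
    unfolding norm_g using gu gv X_inner_integrable(1)[OF V u v] by auto
  have "?w \<in> H1"
    unfolding H1_def using L2 gw int_g by (auto simp: Lp_2_iff intro!: exI[of _ ?g])
  have V_w: "V x * (?w x)\<^sup>2 = V x * u x * u x + (2 * c) * (V x * u x * v x) + c\<^sup>2 * (V x * v x * v x)" for x
    by (simp add: power2_eq_square algebra_simps)
  have int_V: "integrable lebesgue (\<lambda>x. V x * (?w x)\<^sup>2)"
    unfolding V_w using X_inner_integrable(2)[OF V u v] X_inner_integrable(2)[OF V u u]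
      X_inner_integrable(2)[OF V v v] by auto
  with \<open>?w \<in> H1\<close> show w: "?w \<in> X_space V" by (simp add: X_space_def)
  have "X_inner V ?w ?w = (LINT x|lebesgue. (weak_gradient u x \<bullet> weak_gradient u x + V x * u x * u x)
      + (2 * c) * (weak_gradient u x \<bullet> weak_gradient v x + V x * u x * v x)
      + c\<^sup>2 * (weak_gradient v x \<bullet> weak_gradient v x + V x * v x * v x))"
    unfolding X_inner_def
  proof (rule integral_cong_AE)
    have [measurable]: "weak_gradient ?w \<in> borel_measurable lebesgue"
      using H1_weak_gradient[OF \<open>?w \<in> H1\<close>] by simp
    show "(\<lambda>x. weak_gradient ?w x \<bullet> weak_gradient ?w x + V x * ?w x * ?w x) \<in> borel_measurable lebesgue"
      by measurable
    show "AE x in lebesgue. weak_gradient ?w x \<bullet> weak_gradient ?w x + V x * ?w x * ?w x =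
        (weak_gradient u x \<bullet> weak_gradient u x + V x * u x * u x)
      + (2 * c) * (weak_gradient u x \<bullet> weak_gradient v x + V x * u x * v x)
      + c\<^sup>2 * (weak_gradient v x \<bullet> weak_gradient v x + V x * v x * v x)"
      using weak_gradient_AE_eq(2)[OF gw]
    proof eventually_elim
      case (elim x)
      show ?case unfolding elim
        by (simp add: inner_add_left inner_add_right inner_commute power2_eq_square algebra_simps)
    qed
  qed measurable
  also have "\<dots> = X_inner V u u + 2 * c * X_inner V u v + c\<^sup>2 * X_inner V v v"
    unfolding X_inner_def
    using X_inner_integrable[OF V u v] X_inner_integrable[OF V u u] X_inner_integrable[OF V v v]
    by simp
  finally show "X_inner V ?w ?w = X_inner V u u + 2 * c * X_inner V u v + c\<^sup>2 * X_inner V v v" .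
qed

lemma X_norm_power2:
  assumes "\<And>x. V x > 0"
  shows "(X_norm V u)\<^sup>2 = X_inner V u u" "0 \<le> X_inner V u u"
proof -
  have "0 \<le> V x * u x * u x" for x using assms[of x] by (simp add: mult.assoc)
  then show "0 \<le> X_inner V u u" unfolding X_inner_def by (intro integral_nonneg_AE) auto
  then show "(X_norm V u)\<^sup>2 = X_inner V u u" by (simp add: X_norm_def)
qed

text \<open>
The factor \<open>t\<close> is obtained from \<open>u + (t - 1) u\<close>.
\<close>

lemma X_inner_scale:
  assumes "V \<in> borel_measurable lebesgue" "\<And>x. V x > 0" "u \<in> X_space V"
  shows "X_inner V (\<lambda>x. t * u x) (\<lambda>x. t * u x) = t\<^sup>2 * X_inner V u u"
  using X_space_add_scaled(2)[OF assms assms(3), of "t - 1"]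
  by (simp add: algebra_simps power2_eq_square)

lemma X_inner_pos:
  assumes V: "V \<in> borel_measurable lebesgue" "\<And>x. V x > 0"
    and u: "u \<in> X_space V" "\<not> (AE x in lebesgue. u x = 0)"
  shows "0 < X_inner V u u"
proof -
  have nn: "0 \<le> V x * u x * u x" for x using V(2)[of x] by (simp add: mult.assoc)
  have "X_inner V u u \<noteq> 0"
  proof
    assume "X_inner V u u = 0"
    then have "AE x in lebesgue. weak_gradient u x \<bullet> weak_gradient u x + V x * u x * u x = 0"
      unfolding X_inner_def using X_inner_integrable[OF V u(1) u(1)] nn
      by (subst (asm) integral_nonneg_eq_0_iff_AE) auto
    then have "AE x in lebesgue. u x = 0"
    proof eventually_elim
      case (elim x)
      then have "V x * u x * u x = 0" using nn[of x] inner_ge_zero[of "weak_gradient u x"] by linarith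
      then show ?case using V(2)[of x] by auto
    qed
    with u(2) show False by simp
  qed
  then show ?thesis using X_norm_power2(2)[of V u, OF V(2)] by simp
qed

text \<open>
The integral of a difference quotient vanishes by translation invariance, and the mean value theorem
dominates the quotients by a multiple of the indicator of a ball.
\<close>

lemma integral_partial_derivative_eq_0:
  fixes F :: "'a::euclidean_space \<Rightarrow> real"
  assumes F: "\<And>x. (F has_derivative F' x) (at x)" and "compact K" "\<And>x. x \<notin> K \<Longrightarrow> F x = 0"
    and i: "i \<in> Basis" and cont: "continuous_on UNIV (\<lambda>x. F' x i)" and bound: "\<And>x. \<bar>F' x i\<bar> \<le> C"
  shows "(LINT x|lebesgue. F' x i) = 0"
proof -
  obtain R where R: "\<And>x. x \<in> K \<Longrightarrow> norm x \<le> R"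
    using compact_imp_bounded[OF \<open>compact K\<close>] by (auto simp: bounded_iff)
  define h where "h n = inverse (real (Suc n))" for n
  have h: "0 < h n" "h n \<le> 1" for n by (auto simp: h_def field_simps)
  have h_lim: "h \<longlonglongrightarrow> 0" unfolding h_def by (rule LIMSEQ_inverse_real_of_nat)
  have F_cont: "continuous_on UNIV F"
    using F by (auto intro!: continuous_at_imp_continuous_on has_derivative_continuous)
  have F_borel[measurable]: "F \<in> borel_measurable borel" using F_cont by (rule borel_measurable_continuous_onI)
  have F'_borel[measurable]: "(\<lambda>x. F' x i) \<in> borel_measurable borel" using cont by (rule borel_measurable_continuous_onI)
  have deriv: "((\<lambda>t. F (x + t *\<^sub>R i)) has_real_derivative F' (x + t *\<^sub>R i) i) (at t)" for x t
  proof -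
    have "((\<lambda>t. x + t *\<^sub>R i) has_derivative (\<lambda>s. s *\<^sub>R i)) (at t)"
      by (auto intro!: derivative_eq_intros)
    from has_derivative_compose[OF this F]
    have "((\<lambda>t. F (x + t *\<^sub>R i)) has_derivative (\<lambda>s. F' (x + t *\<^sub>R i) (s *\<^sub>R i))) (at t)" .
    moreover have "F' (x + t *\<^sub>R i) (s *\<^sub>R i) = F' (x + t *\<^sub>R i) i * s" for s
      using has_derivative_linear[OF F[of "x + t *\<^sub>R i"]] by (simp add: linear_cmul)
    ultimately show ?thesis by (simp add: has_field_derivative_def)
  qed
  define Q where "Q n x = (F (x + h n *\<^sub>R i) - F x) / h n" for n x
  have Q_bound: "\<bar>Q n x\<bar> \<le> C * indicator (cball 0 (R + 1)) x" for n x
  proof (cases "x \<in> cball 0 (R + 1)")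
    case True
    have "\<exists>z>0. z < h n \<and> F (x + h n *\<^sub>R i) - F (x + 0 *\<^sub>R i) = (h n - 0) * F' (x + z *\<^sub>R i) i"
      by (rule MVT2) (use deriv h(1) in auto)
    then obtain z where "F (x + h n *\<^sub>R i) - F (x + 0 *\<^sub>R i) = (h n - 0) * F' (x + z *\<^sub>R i) i"
      by blast
    then have "Q n x = F' (x + z *\<^sub>R i) i" using h(1)[of n] by (simp add: Q_def)
    then show ?thesis using bound True by simp
  next
    case False
    then have "norm x > R + 1" by simp
    moreover have "norm x \<le> norm (x + h n *\<^sub>R i) + norm (h n *\<^sub>R i)"
      by (metis add_diff_cancel_right' norm_triangle_ineq4)
    moreover have "norm (h n *\<^sub>R i) \<le> 1" using i h[of n] by simp
    ultimately have "x \<notin> K" "x + h n *\<^sub>R i \<notin> K" using R by fastforce+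
    then show ?thesis using assms(3) False by (simp add: Q_def indicator_def)
  qed
  have int_F: "integrable lborel F"
  proof -
    have "integrable lborel (\<lambda>x. indicator K x *\<^sub>R F x)"
      using F_cont \<open>compact K\<close> by (intro borel_integrable_compact) (auto intro: continuous_on_subset)
    moreover have "(\<lambda>x. indicator K x *\<^sub>R F x) = F" using assms(3) by (auto simp: fun_eq_iff indicator_def)
    ultimately show ?thesis by simp
  qed
  have shift: "integrable lborel (\<lambda>x. F (x + c))" "(LINT x|lborel. F (x + c)) = (LINT x|lborel. F x)" for c
  proof -
    have distr: "distr lborel borel ((+) c) = (lborel :: 'a measure)" by (rule lborel_distr_plus)
    have "integrable (distr lborel borel ((+) c)) F" using int_F by (simp add: distr)
    then show "integrable lborel (\<lambda>x. F (x + c))"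
      by (subst (asm) integrable_distr_eq) (auto simp: add.commute)
    have "(LINT x|lborel. F x) = (LINT x|distr lborel borel ((+) c). F x)" by (simp add: distr)
    also have "\<dots> = (LINT x|lborel. F (c + x))" by (rule integral_distr) auto
    finally show "(LINT x|lborel. F (x + c)) = (LINT x|lborel. F x)" by (simp add: add.commute)
  qed
  have Q_int: "(LINT x|lborel. Q n x) = 0" for n
    unfolding Q_def using shift[of "h n *\<^sub>R i"] int_F by simp
  have "(\<lambda>n. LINT x|lborel. Q n x) \<longlonglongrightarrow> (LINT x|lborel. F' x i)"
  proof (rule integral_dominated_convergence[where w = "\<lambda>x. C * indicator (cball 0 (R + 1)) x"])
    show "integrable lborel (\<lambda>x. C * indicator (cball 0 (R + 1)) x :: real)"
      by (intro integrable_mult_right integrable_real_indicator) (use emeasure_lborel_cball_finite[of 0 "R + 1"] in auto)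
    show "AE x in lborel. (\<lambda>n. Q n x) \<longlonglongrightarrow> F' x i"
    proof (intro AE_I2)
      fix x
      have "((\<lambda>s. (F (x + s *\<^sub>R i) - F x) / s) \<longlongrightarrow> F' x i) (at 0)"
        using deriv[of x 0] by (simp add: DERIV_def)
      moreover have "filterlim h (at 0) sequentially"
        using h_lim h(1) by (auto simp: filterlim_at less_imp_neq[symmetric])
      ultimately show "(\<lambda>n. Q n x) \<longlonglongrightarrow> F' x i" unfolding Q_def using filterlim_compose by blast
    qed
    show "AE x in lborel. norm (Q n x) \<le> C * indicator (cball 0 (R + 1)) x" for n
      using Q_bound by auto
    show "Q n \<in> borel_measurable lborel" for n unfolding Q_def by measurable
  qed measurable
  then have "(LINT x|lborel. F' x i) = 0" unfolding Q_int by (rule LIMSEQ_unique[OF _ tendsto_const])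
  then show ?thesis by (simp add: integral_completion)
qed

lemma continuous_locally_integrable:
  fixes f :: "'a::euclidean_space \<Rightarrow> 'b::euclidean_space"
  assumes "continuous_on UNIV f"
  shows "locally_integrable f"
  unfolding locally_integrable_def set_integrable_def
proof (intro allI impI)
  fix K :: "'a set"
  assume "compact K"
  then have "integrable lborel (\<lambda>x. indicator K x *\<^sub>R f x)"
    using assms by (intro borel_integrable_compact) (auto intro: continuous_on_subset)
  then show "integrable lebesgue (\<lambda>x. indicator K x *\<^sub>R f x)"
    by (subst integrable_completion) auto
qed

lemma integrable_continuous_compact_support:
  fixes f :: "'a::euclidean_space \<Rightarrow> 'b::euclidean_space"
  assumes "continuous_on UNIV f" "compact K" "\<And>x. x \<notin> K \<Longrightarrow> f x = 0"
  shows "integrable lebesgue f"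
proof -
  have "integrable lebesgue (\<lambda>x. indicator K x *\<^sub>R f x)"
    using continuous_locally_integrable[OF assms(1)] assms(2)
    by (simp add: locally_integrable_def set_integrable_def)
  moreover have "(\<lambda>x. indicator K x *\<^sub>R f x) = f" using assms(3) by (auto simp: fun_eq_iff indicator_def)
  ultimately show ?thesis by simp
qed

text \<open>
The classical gradient is a weak gradient: the product rule turns the defining identity into the
vanishing of the integral of a partial derivative of \<open>\<phi> \<psi>\<close>.
\<close>

lemma test_function_in_X_space:
  fixes \<phi> :: "'a::euclidean_space \<Rightarrow> real"
  assumes \<phi>: "test_function \<phi>" and V: "continuous_on UNIV V"
  shows "\<phi> \<in> X_space V"
proof -
  define g where "g x = (\<Sum>i\<in>Basis. frechet_derivative \<phi> (at x) i *\<^sub>R i)" for x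
  obtain K C where K: "compact K" "C \<ge> 0" "\<And>x. x \<notin> K \<Longrightarrow> \<phi> x = 0"
    "\<And>x i. x \<notin> K \<Longrightarrow> frechet_derivative \<phi> (at x) i = 0"
    "\<And>x. \<bar>\<phi> x\<bar> \<le> C" "\<And>x i. i \<in> Basis \<Longrightarrow> \<bar>frechet_derivative \<phi> (at x) i\<bar> \<le> C"
    using test_function_support[OF \<phi>] by metis
  note \<phi>_cont = test_function_continuous[OF \<phi>]
  have g_cont: "continuous_on UNIV g"
    unfolding g_def using \<phi>_cont by (intro continuous_intros) auto
  have g_inner: "g x \<bullet> i = frechet_derivative \<phi> (at x) i" if "i \<in> Basis" for x i
    using that by (simp add: g_def inner_sum_left inner_Basis if_distrib cong: if_cong)
  have "has_weak_gradient \<phi> g"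
    unfolding has_weak_gradient_def
  proof (intro conjI allI impI ballI)
    show "locally_integrable \<phi>" "locally_integrable g"
      using \<phi>_cont g_cont by (auto intro: continuous_locally_integrable)
    fix \<psi> :: "'a \<Rightarrow> real" and i :: 'a
    assume \<psi>: "test_function \<psi>" and i: "i \<in> Basis"
    obtain L D where L: "D \<ge> 0" "\<And>x. \<bar>\<psi> x\<bar> \<le> D" "\<And>x i. i \<in> Basis \<Longrightarrow> \<bar>frechet_derivative \<psi> (at x) i\<bar> \<le> D"
      using test_function_support[OF \<psi>] by metis
    note \<psi>_cont = test_function_continuous[OF \<psi>]
    let ?F' = "\<lambda>x i. \<phi> x * frechet_derivative \<psi> (at x) i + frechet_derivative \<phi> (at x) i * \<psi> x"
    have "(LINT x|lebesgue. ?F' x i) = 0"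
    proof (rule integral_partial_derivative_eq_0[where K = K and C = "C * D + C * D"])
      show "((\<lambda>x. \<phi> x * \<psi> x) has_derivative ?F' x) (at x)" for x
        using test_function_has_derivative[OF \<phi>] test_function_has_derivative[OF \<psi>]
        by (rule has_derivative_mult)
      show "continuous_on UNIV (\<lambda>x. ?F' x i)"
        using \<phi>_cont \<psi>_cont i by (intro continuous_intros) auto
      show "\<bar>?F' x i\<bar> \<le> C * D + C * D" for x
        using K(2,5,6) L i
        by (intro order_trans[OF abs_triangle_ineq] add_mono) (auto simp: abs_mult intro!: mult_mono)
    qed (use K i in auto)
    moreover have "integrable lebesgue (\<lambda>x. \<phi> x * frechet_derivative \<psi> (at x) i)"
        "integrable lebesgue (\<lambda>x. frechet_derivative \<phi> (at x) i * \<psi> x)"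
      using \<phi>_cont \<psi>_cont i K
      by (auto intro!: integrable_continuous_compact_support[OF _ K(1)] continuous_intros)
    ultimately show "(LINT x|lebesgue. \<phi> x * frechet_derivative \<psi> (at x) i) = - (LINT x|lebesgue. g x \<bullet> i * \<psi> x)"
      using i by (simp add: g_inner)
  qed
  moreover have "\<phi> \<in> Lp 2" "(\<lambda>x. norm (g x)) \<in> Lp 2" "integrable lebesgue (\<lambda>x. V x * (\<phi> x)\<^sup>2)"
    unfolding Lp_2_iff using \<phi>_cont g_cont V K
    by (auto intro!: integrable_continuous_compact_support[OF _ K(1)] continuous_intros
        borel_measurable_continuous_lebesgue simp: g_def)
  ultimately show ?thesis by (auto simp: X_space_def H1_def)
qed

section \<open>Riesz potentials and their energies\<close>

lemma sigma_finite_lebesgue: "sigma_finite_measure (lebesgue :: 'a::euclidean_space measure)"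
proof
  show "\<exists>A. countable A \<and> A \<subseteq> sets lebesgue \<and> \<Union>A = space (lebesgue :: 'a measure)
      \<and> (\<forall>a\<in>A. emeasure lebesgue a \<noteq> \<infinity>)"
  proof (intro exI[of _ "range (\<lambda>n::nat. ball (0::'a) (real n))"] conjI ballI)
    show "\<Union>(range (\<lambda>n::nat. ball (0::'a) (real n))) = space lebesgue"
      using reals_Archimedean2 by auto
    show "emeasure lebesgue a \<noteq> \<infinity>" if "a \<in> range (\<lambda>n::nat. ball (0::'a) (real n))" for a
      using that by (auto simp: emeasure_ball)
  qed auto
qed

lemma nn_integral_lebesgue_shift:
  fixes f :: "'a::euclidean_space \<Rightarrow> ennreal"
  assumes [measurable]: "f \<in> borel_measurable borel"
  shows "(\<integral>\<^sup>+x. f (x - y) \<partial>lebesgue) = (\<integral>\<^sup>+x. f x \<partial>lborel)"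
proof -
  have "(\<integral>\<^sup>+x. f x \<partial>lborel) = (\<integral>\<^sup>+x. f x \<partial>distr lborel borel ((+) (- y)))"
    by (simp add: lborel_distr_plus)
  also have "\<dots> = (\<integral>\<^sup>+x. f (- y + x) \<partial>lborel)" by (rule nn_integral_distr) auto
  finally show ?thesis by (simp add: nn_integral_completion)
qed

text \<open>
A dyadic decomposition in disguise: on the shell with index \<open>k\<close> the function is at most \<open>c k\<close>,
and the shell lies in a ball of radius \<open>r k\<close>.
\<close>

lemma nn_integral_finite_if_dominated_by_balls:
  fixes h :: "'a::euclidean_space \<Rightarrow> ennreal"
  assumes c: "\<And>k. 0 \<le> c k" and r: "\<And>k. 0 \<le> r k"
    and sum: "summable (\<lambda>k. c k * r k ^ DIM('a))"
    and cover: "\<And>z. z \<noteq> 0 \<Longrightarrow> h z \<noteq> 0 \<Longrightarrow> \<exists>k. norm z < r k \<and> h z \<le> ennreal (c k)"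
  shows "(\<integral>\<^sup>+z. h z \<partial>lborel) < \<infinity>"
proof -
  have "h z \<le> (\<Sum>k. ennreal (c k) * indicator (ball 0 (r k)) z)" if z0: "z \<noteq> 0" for z
  proof (cases "h z = 0")
    case False
    then obtain k where k: "norm z < r k" "h z \<le> ennreal (c k)" using cover[OF z0 False] by blast
    have "ennreal (c k) = (\<Sum>k\<in>{k}. ennreal (c k) * indicator (ball 0 (r k)) z)"
      using k by simp
    also have "\<dots> \<le> (\<Sum>k. ennreal (c k) * indicator (ball 0 (r k)) z)"
      by (intro sum_le_suminf) auto
    finally show ?thesis using k(2) by (rule order_trans[rotated])
  qed simp
  moreover have "AE z in (lborel :: 'a measure). z \<noteq> 0" by (rule AE_lborel_singleton)
  ultimately have "(\<integral>\<^sup>+z. h z \<partial>lborel) \<le> (\<integral>\<^sup>+z. (\<Sum>k. ennreal (c k) * indicator (ball 0 (r k)) z) \<partial>(lborel :: 'a measure))"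
    by (intro nn_integral_mono_AE) auto
  also have "\<dots> = (\<Sum>k. \<integral>\<^sup>+z. ennreal (c k) * indicator (ball 0 (r k)) z \<partial>(lborel :: 'a measure))"
    by (intro nn_integral_suminf borel_measurable_times_ennreal borel_measurable_const
        borel_measurable_indicator) simp
  also have "\<dots> = (\<Sum>k. ennreal (unit_ball_vol (real DIM('a)) * (c k * r k ^ DIM('a))))"
    using c r by (simp add: nn_integral_cmult_indicator emeasure_ball ennreal_mult'[symmetric] mult_ac)
  also have "\<dots> < \<infinity>"
    using summable_mult[OF sum, of "unit_ball_vol (real DIM('a))"] c r
    by (subst suminf_ennreal2) (auto intro!: mult_nonneg_nonneg)
  finally show ?thesis .
qed

lemma norm_powr_integrable_near_0:
  assumes "0 < \<mu>" "\<mu> < real DIM('a::euclidean_space)"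
  shows "(\<integral>\<^sup>+z. ennreal (1 / norm (z::'a) powr \<mu>) * indicator (ball 0 1) z \<partial>lborel) < \<infinity>"
proof (rule nn_integral_finite_if_dominated_by_balls)
  let ?c = "\<lambda>k::nat. (2 powr \<mu>) ^ Suc k" and ?r = "\<lambda>k::nat. (1 / 2 :: real) ^ k"
  have "2 powr \<mu> < 2 powr real DIM('a)" using assms by (intro powr_less_mono) auto
  then have "norm (2 powr \<mu> / 2 ^ DIM('a)) < 1" by (simp add: powr_realpow)
  then have "summable (\<lambda>k. 2 powr \<mu> * (2 powr \<mu> / 2 ^ DIM('a)) ^ k)"
    by (intro summable_mult summable_geometric)
  then show "summable (\<lambda>k. ?c k * ?r k ^ DIM('a))"
    by (simp add: power_divide power_mult[symmetric] mult.commute)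
  fix z :: 'a
  assume "z \<noteq> 0" "ennreal (1 / norm z powr \<mu>) * indicator (ball 0 1) z \<noteq> 0"
  then have z: "0 < norm z" "norm z < 1" by (auto simp: indicator_def split: if_splits)
  define n where "n = (LEAST n. (1 / 2 :: real) ^ n \<le> norm z)"
  obtain m where "(1 / 2 :: real) ^ m < norm z" using real_arch_pow_inv[of "norm z" "1/2"] z by auto
  then have n: "(1 / 2 :: real) ^ n \<le> norm z" unfolding n_def by (meson LeastI less_imp_le)
  then obtain k where k: "n = Suc k" using z by (cases n) auto
  then have "\<not> (1 / 2 :: real) ^ k \<le> norm z" using not_less_Least[of k "\<lambda>n. (1 / 2 :: real) ^ n \<le> norm z"] by (simp add: n_def)
  moreover have "1 / norm z powr \<mu> \<le> ?c k"
  proof -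
    have "1 / norm z powr \<mu> = (1 / norm z) powr \<mu>" using z by (simp add: powr_divide)
    also have "\<dots> \<le> (2 ^ n) powr \<mu>"
      using n z assms by (intro powr_mono2) (auto simp: field_simps power_divide)
    also have "\<dots> = ?c k" by (simp add: k powr_realpow[symmetric] powr_powr mult.commute powr_power del: power_Suc)
    finally show ?thesis .
  qed
  ultimately show "\<exists>k. norm z < ?r k \<and> ennreal (1 / norm z powr \<mu>) * indicator (ball 0 1) z \<le> ennreal (?c k)"
    using z by (intro exI[of _ k]) (auto simp: indicator_def)
qed auto

lemma norm_powr_integrable_near_infinity:
  assumes "real DIM('a::euclidean_space) < \<nu>"
  shows "(\<integral>\<^sup>+z. ennreal (1 / norm (z::'a) powr \<nu>) * indicator (- ball 0 1) z \<partial>lborel) < \<infinity>"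
proof (rule nn_integral_finite_if_dominated_by_balls)
  let ?c = "\<lambda>k::nat. (1 / 2 powr \<nu>) ^ k" and ?r = "\<lambda>k::nat. (2 :: real) ^ Suc k"
  have "2 powr real DIM('a) < 2 powr \<nu>" using assms by (intro powr_less_mono) auto
  then have "norm (2 ^ DIM('a) / 2 powr \<nu>) < 1" by (simp add: powr_realpow)
  then have "summable (\<lambda>k. 2 ^ DIM('a) * (2 ^ DIM('a) / 2 powr \<nu>) ^ k)"
    by (intro summable_mult summable_geometric)
  moreover have "?c k * ?r k ^ DIM('a) = 2 ^ DIM('a) * (2 ^ DIM('a) / 2 powr \<nu>) ^ k" for k
    by (simp add: power_divide power_mult_distrib power_mult[symmetric] mult.commute)
  ultimately show "summable (\<lambda>k. ?c k * ?r k ^ DIM('a))" by presburger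
  fix z :: 'a
  assume "ennreal (1 / norm z powr \<nu>) * indicator (- ball 0 1) z \<noteq> 0"
  then have z: "1 \<le> norm z" by (auto simp: indicator_def split: if_splits)
  define n where "n = (LEAST n. norm z < (2 :: real) ^ n)"
  obtain m where "norm z < (2 :: real) ^ m" using real_arch_pow[of 2 "norm z"] by auto
  then have n: "norm z < (2 :: real) ^ n" unfolding n_def by (rule LeastI)
  then obtain k where k: "n = Suc k" using z by (cases n) auto
  then have le: "(2 :: real) ^ k \<le> norm z" using not_less_Least[of k "\<lambda>n. norm z < (2 :: real) ^ n"] by (simp add: n_def)
  have "1 / norm z powr \<nu> \<le> ?c k"
  proof -
    have "0 < \<nu>" using assms by (meson of_nat_0_le_iff order.strict_trans1)
    then have "(2 ^ k) powr \<nu> \<le> norm z powr \<nu>" using le by (intro powr_mono2) auto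
    moreover have "z \<noteq> 0" using z by auto
    ultimately have "1 / norm z powr \<nu> \<le> 1 / (2 ^ k) powr \<nu>"
      by (intro divide_left_mono) auto
    also have "\<dots> = ?c k" by (simp add: powr_realpow[symmetric] powr_powr mult.commute powr_power power_divide)
    finally show ?thesis .
  qed
  then show "\<exists>k. norm z < ?r k \<and> ennreal (1 / norm z powr \<nu>) * indicator (- ball 0 1) z \<le> ennreal (?c k)"
    using n k z by (intro exI[of _ k]) (auto simp: indicator_def)
qed auto

text \<open>
The value on the diagonal is \<open>0\<close>, in agreement with division by zero in the double integrals
under study. The potential and the mutual energy are extended-real valued, so that finiteness can be
discussed before any integral is known to converge.
\<close>

definition riesz_kernel :: "real \<Rightarrow> 'a::euclidean_space \<Rightarrow> 'a \<Rightarrow> ennreal" where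
  "riesz_kernel \<mu> x y = ennreal (1 / norm (x - y) powr \<mu>)"

definition potential :: "real \<Rightarrow> ('a::euclidean_space \<Rightarrow> ennreal) \<Rightarrow> 'a \<Rightarrow> ennreal" where
  "potential \<mu> f y = (\<integral>\<^sup>+x. f x * riesz_kernel \<mu> x y \<partial>lebesgue)"

definition energy :: "real \<Rightarrow> ('a::euclidean_space \<Rightarrow> ennreal) \<Rightarrow> ('a \<Rightarrow> ennreal) \<Rightarrow> ennreal" where
  "energy \<mu> f g = (\<integral>\<^sup>+y. g y * potential \<mu> f y \<partial>lebesgue)"

lemma borel_measurable_fst_snd_lebesgue[measurable]:
  "fst \<in> borel_measurable ((lebesgue :: 'a::euclidean_space measure) \<Otimes>\<^sub>M M)"
  "snd \<in> borel_measurable (M \<Otimes>\<^sub>M (lebesgue :: 'a::euclidean_space measure))"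
proof -
  have id: "(\<lambda>x::'a. x) \<in> borel_measurable lebesgue" by (simp add: measurable_completion)
  show "fst \<in> borel_measurable ((lebesgue :: 'a::euclidean_space measure) \<Otimes>\<^sub>M M)"
    by (rule measurable_compose[OF measurable_fst id])
  show "snd \<in> borel_measurable (M \<Otimes>\<^sub>M (lebesgue :: 'a::euclidean_space measure))"
    by (rule measurable_compose[OF measurable_snd id])
qed

lemma riesz_kernel_measurable[measurable]:
  "(\<lambda>p. riesz_kernel \<mu> (fst p) (snd p)) \<in> borel_measurable (lebesgue \<Otimes>\<^sub>M lebesgue)"
  "(\<lambda>p. riesz_kernel \<mu> (snd p) (fst p)) \<in> borel_measurable (lebesgue \<Otimes>\<^sub>M lebesgue)"
  unfolding riesz_kernel_def by measurable

lemma riesz_kernel_measurable1[measurable]: "(\<lambda>x. riesz_kernel \<mu> x y) \<in> borel_measurable lebesgue"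
  using measurable_compose[of "\<lambda>x. (x, y)" lebesgue "lebesgue \<Otimes>\<^sub>M lebesgue", OF _ riesz_kernel_measurable(1)]
  by simp

lemma riesz_kernel_commute: "riesz_kernel \<mu> x y = riesz_kernel \<mu> y x"
  by (simp add: riesz_kernel_def norm_minus_commute)

lemma potential_measurable[measurable]:
  assumes [measurable]: "f \<in> borel_measurable lebesgue"
  shows "potential \<mu> f \<in> borel_measurable lebesgue"
proof -
  interpret sigma_finite_measure "lebesgue :: 'a measure" by (rule sigma_finite_lebesgue)
  have "(\<lambda>y. \<integral>\<^sup>+x. f x * riesz_kernel \<mu> x y \<partial>lebesgue) \<in> borel_measurable lebesgue"
    using borel_measurable_nn_integral[of "\<lambda>y x. f x * riesz_kernel \<mu> x y" lebesgue]
    by (simp add: split_beta)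
  then show ?thesis by (simp add: potential_def[abs_def])
qed

lemma energy_commute:
  assumes [measurable]: "f \<in> borel_measurable lebesgue" "g \<in> borel_measurable lebesgue"
  shows "energy \<mu> f g = energy \<mu> g f"
proof -
  interpret pair_sigma_finite "lebesgue :: 'a measure" "lebesgue :: 'a measure"
    using sigma_finite_lebesgue by (simp add: pair_sigma_finite_def)
  have "energy \<mu> f g = (\<integral>\<^sup>+y. (\<integral>\<^sup>+x. g y * (f x * riesz_kernel \<mu> x y) \<partial>lebesgue) \<partial>lebesgue)"
    unfolding energy_def potential_def by (simp add: nn_integral_cmult)
  also have "\<dots> = (\<integral>\<^sup>+x. (\<integral>\<^sup>+y. g y * (f x * riesz_kernel \<mu> x y) \<partial>lebesgue) \<partial>lebesgue)"
    by (rule Fubini') (simp add: split_beta)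
  also have "\<dots> = (\<integral>\<^sup>+x. (\<integral>\<^sup>+y. f x * (g y * riesz_kernel \<mu> y x) \<partial>lebesgue) \<partial>lebesgue)"
    by (simp add: riesz_kernel_commute mult_ac)
  also have "\<dots> = energy \<mu> g f"
    unfolding energy_def potential_def by (simp add: nn_integral_cmult)
  finally show ?thesis .
qed

lemma potential_mono_AE:
  assumes "AE x in lebesgue. f x \<le> f' x"
  shows "potential \<mu> f y \<le> potential \<mu> f' y"
  unfolding potential_def
proof (rule nn_integral_mono_AE)
  show "AE x in lebesgue. f x * riesz_kernel \<mu> x y \<le> f' x * riesz_kernel \<mu> x y"
    using assms by eventually_elim (rule mult_right_mono, simp_all)
qed

lemma energy_mono_AE:
  assumes "AE x in lebesgue. f x \<le> f' x" "AE x in lebesgue. g x \<le> g' x"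
  shows "energy \<mu> f g \<le> energy \<mu> f' g'"
  unfolding energy_def
proof (rule nn_integral_mono_AE)
  show "AE y in lebesgue. g y * potential \<mu> f y \<le> g' y * potential \<mu> f' y"
    using assms(2) by eventually_elim (rule mult_mono, simp_all add: potential_mono_AE[OF assms(1)])
qed

lemma energy_cong_AE:
  assumes "AE x in lebesgue. f x = f' x" "AE x in lebesgue. g x = g' x"
  shows "energy \<mu> f g = energy \<mu> f' g'"
  using assms by (intro antisym energy_mono_AE) (auto elim: eventually_mono)

lemma energy_add_scaled_right:
  assumes [measurable]: "f \<in> borel_measurable lebesgue" "g \<in> borel_measurable lebesgue"
    "h \<in> borel_measurable lebesgue"
  shows "energy \<mu> f (\<lambda>x. g x + c * h x) = energy \<mu> f g + c * energy \<mu> f h"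
  unfolding energy_def by (simp add: distrib_right nn_integral_add nn_integral_cmult mult.assoc)

lemma energy_add_scaled_left:
  assumes [measurable]: "f \<in> borel_measurable lebesgue" "g \<in> borel_measurable lebesgue"
    "h \<in> borel_measurable lebesgue"
  shows "energy \<mu> (\<lambda>x. g x + c * h x) f = energy \<mu> g f + c * energy \<mu> h f"
  using energy_add_scaled_right[of f g h] by (simp add: energy_commute[of _ f])

text \<open>
A crude form of the weighted inequality between geometric and arithmetic means (each factor is at
most the maximum). Integrated, it plays the part of the inequalities of Hoelder and Young.
\<close>

lemma weighted_product_le_sum:
  fixes X Y Z :: real
  assumes "0 \<le> X" "0 \<le> Y" "0 \<le> Z" "0 \<le> a" "0 \<le> b" "0 \<le> c" "a + b + c = 1"
  shows "X powr a * Y powr b * Z powr c \<le> X + Y + Z"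
proof -
  define m where "m = max X (max Y Z)"
  have "X powr a * Y powr b * Z powr c \<le> m powr a * m powr b * m powr c"
    using assms by (intro mult_mono powr_mono2) (auto simp: m_def)
  also have "\<dots> = m powr (a + b + c)" by (simp add: powr_add)
  also have "\<dots> = m" using assms by (simp add: m_def)
  also have "\<dots> \<le> X + Y + Z" using assms by (auto simp: m_def)
  finally show ?thesis .
qed

text \<open>
The subcritical Hardy--Littlewood--Sobolev estimate: the critical exponent is
\<open>2 N / (2 N - \<mu>)\<close>, and strictly below it the kernel may be split at distance one. The near part
is integrable and meets \<open>g\<^sup>2\<close>; the far part lies in \<open>L\<^sup>\<tau>\<close> with \<open>1 / \<tau> = 2 - 2 / \<sigma>\<close>, which is
the exponent in Young's convolution inequality.
\<close>

lemma energy_finite_if_bounded_Lp: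
  fixes g :: "'a::euclidean_space \<Rightarrow> real"
  assumes \<mu>: "0 < \<mu>" "\<mu> < real DIM('a)"
    and \<sigma>: "1 < \<sigma>" "1 - \<mu> / (2 * real DIM('a)) < 1 / \<sigma>"
    and [measurable]: "g \<in> borel_measurable lebesgue"
    and g: "\<And>x. 0 \<le> g x" "\<And>x. g x \<le> M"
    and int: "(\<integral>\<^sup>+x. ennreal (g x powr \<sigma>) \<partial>lebesgue) < \<infinity>"
  shows "energy \<mu> (\<lambda>x. ennreal (g x)) (\<lambda>x. ennreal (g x)) < \<infinity>"
proof -
  define N where "N = real DIM('a)"
  have "N > 0" by (simp add: N_def)
  \<comment> \<open>The reciprocal of the exponent of the far kernel; it is below \<open>\<mu> / N\<close> by subcriticality.\<close>
  define \<tau>' where "\<tau>' = 2 - 2 / \<sigma>"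
  have \<tau>': "0 < \<tau>'" "\<tau>' < \<mu> / N" "\<tau>' < 1"
  proof -
    show "0 < \<tau>'" using \<sigma> by (simp add: \<tau>'_def field_simps)
    show *: "\<tau>' < \<mu> / N" using \<sigma>(2) by (simp add: \<tau>'_def N_def field_simps)
    have "\<mu> / N < 1" using \<mu> \<open>N > 0\<close> by (simp add: N_def field_simps)
    with * show "\<tau>' < 1" by simp
  qed
  have \<sigma>2: "\<sigma> \<le> 2" using \<tau>'(3) \<sigma>(1) by (simp add: \<tau>'_def field_simps)
  have M: "0 \<le> M" using g order_trans by blast
  define \<nu> where "\<nu> = \<mu> / \<tau>'"
  have \<nu>: "real DIM('a) < \<nu>" using \<tau>' \<open>N > 0\<close> by (simp add: \<nu>_def N_def field_simps)
  define \<kappa> where "\<kappa> z = ennreal (M powr (2 - \<sigma>)) * (ennreal (1 / norm z powr \<mu>) * indicator (ball 0 1) z)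
      + ennreal (1 / norm z powr \<nu>) * indicator (- ball 0 1) z" for z :: 'a
  have [measurable]: "ball (0::'a) 1 \<in> sets borel" "- ball (0::'a) 1 \<in> sets borel" by auto
  have m: "(\<lambda>z::'a. ennreal (1 / norm z powr \<mu>) * indicator (ball 0 1) z) \<in> borel_measurable borel"
    "(\<lambda>z::'a. ennreal (1 / norm z powr \<nu>) * indicator (- ball 0 1) z) \<in> borel_measurable borel"
    by measurable
  have \<kappa>_meas[measurable]: "\<kappa> \<in> borel_measurable borel"
    unfolding \<kappa>_def[abs_def]
    by (intro borel_measurable_add borel_measurable_times_ennreal[OF borel_measurable_const] m)
  define I where "I = (\<integral>\<^sup>+z. \<kappa> z \<partial>lborel)"
  have "I = ennreal (M powr (2 - \<sigma>)) * (\<integral>\<^sup>+z. ennreal (1 / norm (z::'a) powr \<mu>) * indicator (ball 0 1) z \<partial>lborel)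
      + (\<integral>\<^sup>+z. ennreal (1 / norm (z::'a) powr \<nu>) * indicator (- ball 0 1) z \<partial>lborel)"
    unfolding I_def \<kappa>_def using m by (subst nn_integral_add) (auto simp: nn_integral_cmult)
  then have I: "I < \<infinity>"
    using norm_powr_integrable_near_0[OF \<mu>] norm_powr_integrable_near_infinity[OF \<nu>]
    by (auto simp: ennreal_mult_less_top)
  define S where "S = (\<integral>\<^sup>+x. ennreal (g x powr \<sigma>) \<partial>lebesgue)"
  have pointwise: "ennreal (g y) * (ennreal (g x) * riesz_kernel \<mu> x y)
      \<le> ennreal (g x powr \<sigma>) * \<kappa> (y - x) + (ennreal (g y powr \<sigma>) * \<kappa> (x - y)
        + ennreal (g y powr \<sigma>) * ennreal (g x powr \<sigma>))" for x y
  proof -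
    have g2: "g w * g w \<le> M powr (2 - \<sigma>) * g w powr \<sigma>" for w
    proof -
      have "g w * g w = g w powr (2 - \<sigma>) * g w powr \<sigma>"
        using g(1)[of w] by (simp add: powr_add[symmetric] powr_numeral power2_eq_square)
      also have "\<dots> \<le> M powr (2 - \<sigma>) * g w powr \<sigma>"
        using g \<sigma>2 by (intro mult_right_mono powr_mono2) auto
      finally show ?thesis .
    qed
    define k where "k = 1 / norm (x - y) powr \<mu>"
    have k: "0 \<le> k" by (simp add: k_def)
    have sym: "\<kappa> (y - x) = \<kappa> (x - y)" by (simp add: \<kappa>_def norm_minus_commute indicator_def)
    show ?thesis
    proof (cases "norm (x - y) < 1")
      case True
      then have \<kappa>: "\<kappa> (x - y) = ennreal (M powr (2 - \<sigma>) * k)"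
        using k by (subst ennreal_mult') (auto simp: \<kappa>_def indicator_def k_def)
      have "2 * (g y * g x) \<le> g y * g y + g x * g x"
        using sum_squares_bound[of "g y" "g x"] by (simp add: power2_eq_square mult.assoc)
      moreover have "0 \<le> g y * g x" using g by simp
      ultimately have "g y * g x \<le> g x * g x + g y * g y" by linarith
      also have "\<dots> \<le> M powr (2 - \<sigma>) * g x powr \<sigma> + M powr (2 - \<sigma>) * g y powr \<sigma>"
        using g2 by (intro add_mono) auto
      finally have "g y * g x * k \<le> (M powr (2 - \<sigma>) * g x powr \<sigma> + M powr (2 - \<sigma>) * g y powr \<sigma>) * k"
        using k by (rule mult_right_mono)
      then have "ennreal (g y * (g x * k)) \<le> ennreal (g x powr \<sigma> * (M powr (2 - \<sigma>) * k) + g y powr \<sigma> * (M powr (2 - \<sigma>) * k))"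
        by (intro ennreal_leI) (simp add: algebra_simps)
      also have "\<dots> = ennreal (g x powr \<sigma>) * \<kappa> (y - x) + ennreal (g y powr \<sigma>) * \<kappa> (x - y)"
        unfolding sym \<kappa> using k by (simp add: ennreal_mult' ennreal_plus)
      also have "ennreal (g y * (g x * k)) = ennreal (g y) * (ennreal (g x) * riesz_kernel \<mu> x y)"
        using g k by (simp add: riesz_kernel_def k_def[symmetric] ennreal_mult')
      finally show ?thesis by (simp add: add.assoc[symmetric] add_increasing2)
    next
      case False
      \<comment> \<open>Weights of the three factors; they sum to one and reproduce \<open>g y * g x * k\<close> exactly.\<close>
      define w1 where "w1 = 1 - \<tau>'"
      define w2 where "w2 = \<tau>' / 2"
      define X where "X = g y powr \<sigma> * g x powr \<sigma>"
      define L where "L = 1 / norm (x - y) powr \<nu>"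
      have n0: "0 < norm (x - y)" using False by linarith
      have \<kappa>: "\<kappa> (x - y) = ennreal L" using False by (simp add: \<kappa>_def indicator_def L_def)
      have wt: "\<sigma> * w1 + \<sigma> * w2 = 1" using \<sigma>(1) by (simp add: w1_def w2_def \<tau>'_def field_simps)
      have L0: "0 \<le> L" by (simp add: L_def)
      have L_pow: "L powr \<tau>' = k"
        using n0 \<tau>' by (simp add: L_def k_def \<nu>_def powr_divide powr_powr)
      have "X powr w1 * (g x powr \<sigma> * L) powr w2 * (g y powr \<sigma> * L) powr w2
          = (g x powr (\<sigma> * w1) * g x powr (\<sigma> * w2)) * (g y powr (\<sigma> * w1) * g y powr (\<sigma> * w2)) * (L powr w2 * L powr w2)"
        using g L0 by (simp add: X_def powr_mult powr_powr mult_ac)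
      also have "\<dots> = g x * g y * k"
        using g wt L_pow by (simp add: powr_add[symmetric] w2_def)
      finally have "g y * (g x * k) = X powr w1 * (g x powr \<sigma> * L) powr w2 * (g y powr \<sigma> * L) powr w2"
        by simp
      also have "\<dots> \<le> X + g x powr \<sigma> * L + g y powr \<sigma> * L"
        using \<tau>' by (intro weighted_product_le_sum) (auto simp: w1_def w2_def X_def L_def)
      finally have "ennreal (g y * (g x * k)) \<le> ennreal (X + g x powr \<sigma> * L + g y powr \<sigma> * L)"
        by (rule ennreal_leI)
      also have "\<dots> = ennreal (g y powr \<sigma>) * ennreal (g x powr \<sigma>) + ennreal (g x powr \<sigma>) * \<kappa> (y - x) + ennreal (g y powr \<sigma>) * \<kappa> (x - y)"
        unfolding sym \<kappa> using L0 by (simp add: X_def ennreal_mult' ennreal_plus)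
      also have "ennreal (g y * (g x * k)) = ennreal (g y) * (ennreal (g x) * riesz_kernel \<mu> x y)"
        using g k by (simp add: riesz_kernel_def k_def[symmetric] ennreal_mult')
      finally show ?thesis by (simp add: add_ac)
    qed
  qed
  interpret pair_sigma_finite "lebesgue :: 'a measure" "lebesgue :: 'a measure"
    using sigma_finite_lebesgue by (simp add: pair_sigma_finite_def)
  have [measurable]: "(\<lambda>p. \<kappa> (fst p - snd p)) \<in> borel_measurable (lebesgue \<Otimes>\<^sub>M lebesgue)"
      "(\<lambda>p. \<kappa> (snd p - fst p)) \<in> borel_measurable (lebesgue \<Otimes>\<^sub>M lebesgue)" by measurable
  have [measurable]: "(\<lambda>x. \<kappa> (x - y)) \<in> borel_measurable lebesgue" "(\<lambda>x. \<kappa> (y - x)) \<in> borel_measurable lebesgue" for y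
    by (auto intro!: measurable_completion)
  have shift: "(\<integral>\<^sup>+x. \<kappa> (x - y) \<partial>lebesgue) = I" for y
    unfolding I_def by (rule nn_integral_lebesgue_shift) simp
  have part: "(\<integral>\<^sup>+y. \<integral>\<^sup>+x. ennreal (g y powr \<sigma>) * \<kappa> (x - y) \<partial>lebesgue \<partial>lebesgue) = S * I"
    by (simp add: nn_integral_cmult nn_integral_multc shift S_def)
  have "(\<integral>\<^sup>+y. \<integral>\<^sup>+x. ennreal (g x powr \<sigma>) * \<kappa> (y - x) \<partial>lebesgue \<partial>lebesgue)
      = (\<integral>\<^sup>+x. \<integral>\<^sup>+y. ennreal (g x powr \<sigma>) * \<kappa> (y - x) \<partial>lebesgue \<partial>lebesgue)"
    by (rule Fubini') (simp add: split_beta)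
  with part have part': "(\<integral>\<^sup>+y. \<integral>\<^sup>+x. ennreal (g x powr \<sigma>) * \<kappa> (y - x) \<partial>lebesgue \<partial>lebesgue) = S * I" by simp
  have m1: "(\<lambda>y. \<integral>\<^sup>+x. ennreal (g x powr \<sigma>) * \<kappa> (y - x) \<partial>lebesgue) \<in> borel_measurable lebesgue"
    "(\<lambda>y. \<integral>\<^sup>+x. ennreal (g y powr \<sigma>) * \<kappa> (x - y) \<partial>lebesgue) \<in> borel_measurable lebesgue"
    by (intro M1.borel_measurable_nn_integral; simp add: split_beta)+
  have "energy \<mu> (\<lambda>x. ennreal (g x)) (\<lambda>x. ennreal (g x))
      = (\<integral>\<^sup>+y. \<integral>\<^sup>+x. ennreal (g y) * (ennreal (g x) * riesz_kernel \<mu> x y) \<partial>lebesgue \<partial>lebesgue)"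
    unfolding energy_def potential_def by (simp add: nn_integral_cmult)
  also have "\<dots> \<le> (\<integral>\<^sup>+y. \<integral>\<^sup>+x. ennreal (g x powr \<sigma>) * \<kappa> (y - x) + (ennreal (g y powr \<sigma>) * \<kappa> (x - y)
        + ennreal (g y powr \<sigma>) * ennreal (g x powr \<sigma>)) \<partial>lebesgue \<partial>lebesgue)"
    by (intro nn_integral_mono pointwise)
  also have "\<dots> = (\<integral>\<^sup>+y. (\<integral>\<^sup>+x. ennreal (g x powr \<sigma>) * \<kappa> (y - x) \<partial>lebesgue)
      + ((\<integral>\<^sup>+x. ennreal (g y powr \<sigma>) * \<kappa> (x - y) \<partial>lebesgue)
        + ennreal (g y powr \<sigma>) * S) \<partial>lebesgue)"
    by (simp add: nn_integral_add nn_integral_cmult S_def)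
  also have "\<dots> = S * I + (S * I + S * S)"
    using m1 part part' by (subst nn_integral_add; simp)+ (simp add: nn_integral_multc S_def)
  also have "\<dots> < \<infinity>" using int I by (simp add: S_def ennreal_mult_less_top)
  finally show ?thesis .
qed

section \<open>Positive definiteness of the Riesz kernel\<close>

text \<open>
Finiteness at a single point makes \<open>f\<close> locally integrable (the kernel is bounded below on balls) and
controls the potential of the part of \<open>f\<close> far away at all points nearby. The remaining part, near the
point of evaluation, has a potential whose integral over a ball is finite because the kernel is
locally integrable.
\<close>

lemma potential_finite_AE:
  fixes f :: "'a::euclidean_space \<Rightarrow> ennreal"
  assumes \<mu>: "0 < \<mu>" "\<mu> < real DIM('a)"
    and [measurable]: "f \<in> borel_measurable lebesgue"
    and fin: "potential \<mu> f y0 < \<infinity>"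
  shows "AE y in lebesgue. potential \<mu> f y < \<infinity>"
proof -
  have ball_case: "AE y in lebesgue. y \<in> ball y0 R \<longrightarrow> potential \<mu> f y < \<infinity>" if R: "0 < R" for R
  proof -
    have ball_meas[measurable]: "ball c r \<in> sets lebesgue" for c :: 'a and r by simp
    define B where "B = ball y0 (2 * R)"
    have B_meas[measurable]: "B \<in> sets lebesgue" by (simp add: B_def)
    have ne: "AE x in lebesgue. x \<noteq> y0" by (auto intro: AE_completion AE_lborel_singleton)
    define m where "m = (\<integral>\<^sup>+x. f x * indicator B x \<partial>lebesgue)"
    have "m \<le> (\<integral>\<^sup>+x. ennreal ((2 * R) powr \<mu>) * (f x * riesz_kernel \<mu> x y0) \<partial>lebesgue)"
      unfolding m_def
    proof (rule nn_integral_mono_AE, use ne in eventually_elim)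
      case (elim x)
      show ?case
      proof (cases "x \<in> B")
        case True
        then have n: "0 < norm (x - y0)" "norm (x - y0) < 2 * R"
          using elim by (auto simp: B_def dist_norm norm_minus_commute)
        then have "norm (x - y0) powr \<mu> \<le> (2 * R) powr \<mu>" using \<mu> by (intro powr_mono2) auto
        then have "1 \<le> (2 * R) powr \<mu> * (1 / norm (x - y0) powr \<mu>)" using n by (simp add: field_simps)
        then have "1 \<le> ennreal ((2 * R) powr \<mu>) * riesz_kernel \<mu> x y0"
          unfolding riesz_kernel_def by (subst ennreal_mult[symmetric]) (auto simp: ennreal_1[symmetric] simp del: ennreal_1)
        then have "f x * 1 \<le> f x * (ennreal ((2 * R) powr \<mu>) * riesz_kernel \<mu> x y0)" by (rule mult_left_mono) simp
        then show ?thesis using True by (simp add: mult_ac)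
      qed simp
    qed
    also have "\<dots> = ennreal ((2 * R) powr \<mu>) * potential \<mu> f y0"
      unfolding potential_def by (rule nn_integral_cmult) simp
    also have "\<dots> < \<infinity>" using fin by (simp add: ennreal_mult_less_top)
    finally have m: "m < \<infinity>" .
    \<comment> \<open>Outside \<open>B\<close> the distance to \<open>y\<close> is at least half the distance to \<open>y0\<close>.\<close>
    have far: "(\<integral>\<^sup>+x. f x * riesz_kernel \<mu> x y * indicator (- B) x \<partial>lebesgue) < \<infinity>" if y: "y \<in> ball y0 R" for y
    proof -
      have "(\<integral>\<^sup>+x. f x * riesz_kernel \<mu> x y * indicator (- B) x \<partial>lebesgue)
          \<le> (\<integral>\<^sup>+x. ennreal (2 powr \<mu>) * (f x * riesz_kernel \<mu> x y0) \<partial>lebesgue)"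
      proof (rule nn_integral_mono)
        fix x
        show "f x * riesz_kernel \<mu> x y * indicator (- B) x \<le> ennreal (2 powr \<mu>) * (f x * riesz_kernel \<mu> x y0)"
        proof (cases "x \<in> B")
          case False
          then have x: "2 * R \<le> norm (x - y0)" by (simp add: B_def dist_norm norm_minus_commute)
          have "norm (x - y0) \<le> norm (x - y) + norm (y - y0)" using norm_triangle_ineq[of "x - y" "y - y0"] by simp
          moreover have "norm (y - y0) < R" using y by (simp add: dist_norm norm_minus_commute)
          ultimately have *: "norm (x - y0) \<le> 2 * norm (x - y)" "0 < norm (x - y0)" "0 < norm (x - y)"
            using x R by linarith+
          then have "norm (x - y0) powr \<mu> \<le> (2 * norm (x - y)) powr \<mu>" using \<mu> by (intro powr_mono2) auto
          then have "1 / norm (x - y) powr \<mu> \<le> 2 powr \<mu> * (1 / norm (x - y0) powr \<mu>)"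
            using * by (simp add: powr_mult field_simps)
          then have "riesz_kernel \<mu> x y \<le> ennreal (2 powr \<mu>) * riesz_kernel \<mu> x y0"
            unfolding riesz_kernel_def by (subst ennreal_mult[symmetric]) (auto intro: ennreal_leI)
          then have "f x * riesz_kernel \<mu> x y \<le> f x * (ennreal (2 powr \<mu>) * riesz_kernel \<mu> x y0)" by (rule mult_left_mono) simp
          then show ?thesis using False by (simp add: mult_ac)
        qed simp
      qed
      also have "\<dots> = ennreal (2 powr \<mu>) * potential \<mu> f y0"
        unfolding potential_def by (rule nn_integral_cmult) simp
      also have "\<dots> < \<infinity>" using fin by (simp add: ennreal_mult_less_top)
      finally show ?thesis .
    qed
    \<comment> \<open>The potential of \<open>f\<close> restricted to \<open>B\<close> is integrated over \<open>ball y0 R\<close>.\<close>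
    define J where "J = (\<integral>\<^sup>+z. ennreal (1 / norm (z::'a) powr \<mu>) * indicator (ball 0 1) z \<partial>lborel)"
    have J: "J < \<infinity>" unfolding J_def by (rule norm_powr_integrable_near_0[OF \<mu>])
    define v where "v = emeasure lebesgue (ball y0 R)"
    have v: "v < \<infinity>" unfolding v_def using R by (simp add: emeasure_ball)
    have b1[measurable]: "ball (0::'a) 1 \<in> sets borel" by simp
    have kernel_mass: "(\<integral>\<^sup>+y. riesz_kernel \<mu> x y * indicator (ball y0 R) y \<partial>lebesgue) \<le> J + v" for x
    proof -
      have "(\<integral>\<^sup>+y. riesz_kernel \<mu> x y * indicator (ball y0 R) y \<partial>lebesgue)
          \<le> (\<integral>\<^sup>+y. ennreal (1 / norm (y - x) powr \<mu>) * indicator (ball 0 1) (y - x)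
              + indicator (ball y0 R) y \<partial>lebesgue)"
      proof (rule nn_integral_mono)
        fix y
        show "riesz_kernel \<mu> x y * indicator (ball y0 R) y \<le> ennreal (1 / norm (y - x) powr \<mu>) * indicator (ball 0 1) (y - x)
              + indicator (ball y0 R) y"
        proof (cases "norm (y - x) < 1")
          case True
          then show ?thesis by (auto simp: riesz_kernel_def norm_minus_commute indicator_def)
        next
          case False
          then have "1 \<le> norm (x - y) powr \<mu>" using \<mu> by (intro ge_one_powr_ge_zero) (auto simp: norm_minus_commute)
          then have "1 / norm (x - y) powr \<mu> \<le> 1" by (subst divide_le_eq_1) linarith
          then have "riesz_kernel \<mu> x y \<le> 1" unfolding riesz_kernel_def by simp
          then show ?thesis by (auto simp: indicator_def add_increasing)
        qed
      qed
      also have "\<dots> = (\<integral>\<^sup>+y. ennreal (1 / norm (y - x) powr \<mu>) * indicator (ball 0 1) (y - x) \<partial>lebesgue) + v"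
        unfolding v_def by (subst nn_integral_add) (auto intro!: measurable_completion)
      also have "(\<integral>\<^sup>+y. ennreal (1 / norm (y - x) powr \<mu>) * indicator (ball 0 1) (y - x) \<partial>lebesgue) = J"
        unfolding J_def
        by (rule nn_integral_lebesgue_shift[where f = "\<lambda>z. ennreal (1 / norm z powr \<mu>) * indicator (ball 0 1) z"]) measurable
      finally show ?thesis .
    qed
    interpret pair_sigma_finite "lebesgue :: 'a measure" "lebesgue :: 'a measure"
      using sigma_finite_lebesgue by (simp add: pair_sigma_finite_def)
    have near_meas: "(\<lambda>y. \<integral>\<^sup>+x. f x * riesz_kernel \<mu> x y * indicator B x \<partial>lebesgue) \<in> borel_measurable lebesgue"
      by (rule M1.borel_measurable_nn_integral) (simp add: split_beta)
    have [measurable]: "ball y0 R \<in> sets lebesgue" by simp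
    have "(\<integral>\<^sup>+y. (\<integral>\<^sup>+x. f x * riesz_kernel \<mu> x y * indicator B x \<partial>lebesgue) * indicator (ball y0 R) y \<partial>lebesgue)
        = (\<integral>\<^sup>+y. \<integral>\<^sup>+x. f x * riesz_kernel \<mu> x y * indicator B x * indicator (ball y0 R) y \<partial>lebesgue \<partial>lebesgue)"
      by (simp add: nn_integral_multc)
    also have "\<dots> = (\<integral>\<^sup>+x. \<integral>\<^sup>+y. f x * riesz_kernel \<mu> x y * indicator B x * indicator (ball y0 R) y \<partial>lebesgue \<partial>lebesgue)"
      by (rule Fubini') (simp add: split_beta)
    also have "\<dots> = (\<integral>\<^sup>+x. f x * indicator B x * (\<integral>\<^sup>+y. riesz_kernel \<mu> x y * indicator (ball y0 R) y \<partial>lebesgue) \<partial>lebesgue)"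
    proof (rule nn_integral_cong)
      fix x :: 'a
      have [measurable]: "(\<lambda>y. riesz_kernel \<mu> x y) \<in> borel_measurable lebesgue"
        using riesz_kernel_measurable1[of \<mu> x] by (simp add: riesz_kernel_commute)
      have "(\<integral>\<^sup>+y. f x * riesz_kernel \<mu> x y * indicator B x * indicator (ball y0 R) y \<partial>lebesgue)
          = (\<integral>\<^sup>+y. f x * indicator B x * (riesz_kernel \<mu> x y * indicator (ball y0 R) y) \<partial>lebesgue)"
        by (simp add: mult_ac)
      also have "\<dots> = f x * indicator B x * (\<integral>\<^sup>+y. riesz_kernel \<mu> x y * indicator (ball y0 R) y \<partial>lebesgue)"
        by (rule nn_integral_cmult) measurable
      finally show "(\<integral>\<^sup>+y. f x * riesz_kernel \<mu> x y * indicator B x * indicator (ball y0 R) y \<partial>lebesgue)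
          = f x * indicator B x * (\<integral>\<^sup>+y. riesz_kernel \<mu> x y * indicator (ball y0 R) y \<partial>lebesgue)" .
    qed
    also have "\<dots> \<le> (\<integral>\<^sup>+x. f x * indicator B x * (J + v) \<partial>lebesgue)"
      by (intro nn_integral_mono mult_left_mono kernel_mass) simp
    also have "\<dots> = m * (J + v)" unfolding m_def by (rule nn_integral_multc) measurable
    also have "\<dots> < \<infinity>" using m J v by (simp add: ennreal_mult_less_top)
    finally have "AE y in lebesgue. (\<integral>\<^sup>+x. f x * riesz_kernel \<mu> x y * indicator B x \<partial>lebesgue) * indicator (ball y0 R) y \<noteq> \<infinity>"
      using near_meas by (intro nn_integral_PInf_AE) auto
    then show ?thesis
    proof eventually_elim
      case (elim y)
      show ?case
      proof
        assume y: "y \<in> ball y0 R"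
        have "potential \<mu> f y = (\<integral>\<^sup>+x. f x * riesz_kernel \<mu> x y * indicator B x + f x * riesz_kernel \<mu> x y * indicator (- B) x \<partial>lebesgue)"
          unfolding potential_def by (intro nn_integral_cong) (auto simp: indicator_def)
        also have "\<dots> = (\<integral>\<^sup>+x. f x * riesz_kernel \<mu> x y * indicator B x \<partial>lebesgue)
            + (\<integral>\<^sup>+x. f x * riesz_kernel \<mu> x y * indicator (- B) x \<partial>lebesgue)"
          by (rule nn_integral_add) measurable
        also have "\<dots> < \<infinity>" using elim y far[OF y] by (simp add: less_top)
        finally show "potential \<mu> f y < \<infinity>" .
      qed
    qed
  qed
  have "AE y in lebesgue. \<forall>n::nat. y \<in> ball y0 (real (Suc n)) \<longrightarrow> potential \<mu> f y < \<infinity>"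
    unfolding AE_all_countable by (intro allI ball_case) simp
  then show ?thesis
  proof eventually_elim
    case (elim y)
    obtain n where "dist y0 y < real n" using reals_Archimedean2 by blast
    then show ?case using elim[rule_format, of n] by auto
  qed
qed

text \<open>
A kernel that factors through a feature map is positive semidefinite; the energy is the integral of a
product of two feature integrals.
\<close>

lemma factorized_kernel_energy:
  assumes N: "sigma_finite_measure N" and M: "sigma_finite_measure M"
    and [measurable]: "f \<in> borel_measurable N" "g \<in> borel_measurable N"
      "(\<lambda>p. m (fst p) (snd p)) \<in> borel_measurable (N \<Otimes>\<^sub>M M)"
  shows "(\<integral>\<^sup>+y. \<integral>\<^sup>+x. f x * g y * (\<integral>\<^sup>+s. m x s * m y s \<partial>M) \<partial>N \<partial>N)
    = (\<integral>\<^sup>+s. (\<integral>\<^sup>+x. f x * m x s \<partial>N) * (\<integral>\<^sup>+y. g y * m y s \<partial>N) \<partial>M :: ennreal)"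
proof -
  interpret NM: pair_sigma_finite N M using N M by (simp add: pair_sigma_finite_def)
  have m1[measurable]: "m x \<in> borel_measurable M" if "x \<in> space N" for x
    using measurable_compose[OF measurable_Pair1'[OF that] assms(5)] by simp
  have m2: "(\<lambda>x. m x s) \<in> borel_measurable N" if "s \<in> space M" for s
    using measurable_compose[OF measurable_Pair2'[OF that] assms(5)] by simp
  have F[measurable]: "(\<lambda>s. \<integral>\<^sup>+x. f x * m x s \<partial>N) \<in> borel_measurable M"
  proof (rule NM.M1.borel_measurable_nn_integral)
    have "(\<lambda>p. m (snd p) (fst p)) \<in> borel_measurable (M \<Otimes>\<^sub>M N)"
      using measurable_compose[OF measurable_pair_swap' assms(5)] by (simp add: split_beta)
    then show "(\<lambda>(s, x). f x * m x s) \<in> borel_measurable (M \<Otimes>\<^sub>M N)" by (simp add: split_beta)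
  qed
  have "(\<integral>\<^sup>+y. \<integral>\<^sup>+x. f x * g y * (\<integral>\<^sup>+s. m x s * m y s \<partial>M) \<partial>N \<partial>N)
      = (\<integral>\<^sup>+y. \<integral>\<^sup>+x. \<integral>\<^sup>+s. f x * g y * (m x s * m y s) \<partial>M \<partial>N \<partial>N)"
    by (intro nn_integral_cong) (simp add: nn_integral_cmult)
  also have "\<dots> = (\<integral>\<^sup>+y. \<integral>\<^sup>+s. \<integral>\<^sup>+x. f x * g y * (m x s * m y s) \<partial>N \<partial>M \<partial>N)"
  proof (intro nn_integral_cong)
    fix y assume y: "y \<in> space N"
    have [measurable]: "(\<lambda>p. m y (snd p)) \<in> borel_measurable (N \<Otimes>\<^sub>M M)"
      by (rule measurable_compose[OF measurable_snd m1[OF y]])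
    show "(\<integral>\<^sup>+x. \<integral>\<^sup>+s. f x * g y * (m x s * m y s) \<partial>M \<partial>N) = (\<integral>\<^sup>+s. \<integral>\<^sup>+x. f x * g y * (m x s * m y s) \<partial>N \<partial>M)"
      by (rule NM.Fubini'[symmetric]) (simp add: split_beta)
  qed
  also have "\<dots> = (\<integral>\<^sup>+y. \<integral>\<^sup>+s. g y * m y s * (\<integral>\<^sup>+x. f x * m x s \<partial>N) \<partial>M \<partial>N)"
  proof (intro nn_integral_cong)
    fix y s assume y: "y \<in> space N" and s: "s \<in> space M"
    have "(\<integral>\<^sup>+x. f x * g y * (m x s * m y s) \<partial>N) = (\<integral>\<^sup>+x. g y * m y s * (f x * m x s) \<partial>N)"
      by (simp add: mult_ac)
    also have "\<dots> = g y * m y s * (\<integral>\<^sup>+x. f x * m x s \<partial>N)"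
      using m2[OF s] by (intro nn_integral_cmult borel_measurable_times_ennreal assms(3))
    finally show "(\<integral>\<^sup>+x. f x * g y * (m x s * m y s) \<partial>N) = g y * m y s * (\<integral>\<^sup>+x. f x * m x s \<partial>N)" .
  qed
  also have "\<dots> = (\<integral>\<^sup>+s. \<integral>\<^sup>+y. g y * m y s * (\<integral>\<^sup>+x. f x * m x s \<partial>N) \<partial>N \<partial>M)"
    by (rule NM.Fubini'[symmetric]) (use assms(4,5) F in \<open>simp add: split_beta\<close>)
  also have "\<dots> = (\<integral>\<^sup>+s. (\<integral>\<^sup>+x. f x * m x s \<partial>N) * (\<integral>\<^sup>+y. g y * m y s \<partial>N) \<partial>M)"
  proof (intro nn_integral_cong)
    fix s assume s: "s \<in> space M"
    show "(\<integral>\<^sup>+y. g y * m y s * (\<integral>\<^sup>+x. f x * m x s \<partial>N) \<partial>N)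
        = (\<integral>\<^sup>+x. f x * m x s \<partial>N) * (\<integral>\<^sup>+y. g y * m y s \<partial>N)"
      using m2[OF s] by (subst nn_integral_multc) (auto simp: mult.commute)
  qed
  finally show ?thesis .
qed

text \<open>
The feature of \<open>x\<close> is indexed by the balls that contain it: the index \<open>(t, z)\<close> stands for the ball of
radius \<open>t\<close> about \<open>z\<close>. With \<open>\<beta> = (\<mu> + 1 + N) / 2\<close> the associated kernel integrates
\<open>t\<^bsup>- \<mu> - 1 - N\<^esup>\<close> times the volume of the intersection of the balls of radius \<open>t\<close> about \<open>x\<close> and \<open>y\<close>;
since only radii above half the distance contribute, it is comparable to the Riesz kernel.
\<close>

definition ball_feature :: "real \<Rightarrow> 'a::euclidean_space \<Rightarrow> real \<times> 'a \<Rightarrow> ennreal" where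
  "ball_feature \<beta> x s = (if norm (x - snd s) < fst s then ennreal (fst s powr (- \<beta>)) else 0)"

lemma ball_feature_measurable:
  "(\<lambda>p. ball_feature \<beta> (fst p) (snd p)) \<in> borel_measurable ((lebesgue :: 'a::euclidean_space measure) \<Otimes>\<^sub>M lborel)"
    (is "_ \<in> borel_measurable ?P")
  and ball_feature_measurable_swap:
  "(\<lambda>p. ball_feature \<beta> (snd p) (fst p)) \<in> borel_measurable (lborel \<Otimes>\<^sub>M (lebesgue :: 'a::euclidean_space measure))"
proof -
  have general: "(\<lambda>p. if a p < b p then ennreal (b p powr (- \<beta>)) else 0) \<in> borel_measurable ?P"
    if [measurable]: "a \<in> borel_measurable ?P" "b \<in> borel_measurable ?P" for a b :: "'a \<times> real \<times> 'a \<Rightarrow> real"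
    by measurable
  have norm_diff: "(\<lambda>p. norm (a p - b p)) \<in> borel_measurable ?P"
    if [measurable]: "a \<in> borel_measurable ?P" "b \<in> borel_measurable ?P" for a b :: "'a \<times> real \<times> 'a \<Rightarrow> 'a"
    by measurable
  have f: "(\<lambda>p. fst p) \<in> borel_measurable ?P" by (rule borel_measurable_fst_snd_lebesgue(1))
  have s: "(\<lambda>p. snd (snd p)) \<in> borel_measurable ?P"
    by (rule measurable_compose[OF measurable_snd])
      (simp add: borel_measurable_continuous_onI continuous_on_snd)
  have t: "(\<lambda>p. fst (snd p)) \<in> borel_measurable ?P"
    by (rule measurable_compose[OF measurable_snd])
      (simp add: borel_measurable_continuous_onI continuous_on_fst)
  have "(\<lambda>p. norm (fst p - snd (snd p))) \<in> borel_measurable ?P"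
    by (rule norm_diff[OF f s])
  from general[OF this t]
  show *: "(\<lambda>p. ball_feature \<beta> (fst p) (snd p)) \<in> borel_measurable ?P"
    by (simp add: ball_feature_def)
  show "(\<lambda>p. ball_feature \<beta> (snd p) (fst p)) \<in> borel_measurable (lborel \<Otimes>\<^sub>M (lebesgue :: 'a measure))"
    using measurable_compose[OF measurable_pair_swap' *] by (simp add: split_beta)
qed

definition ball_kernel :: "real \<Rightarrow> 'a::euclidean_space \<Rightarrow> 'a \<Rightarrow> ennreal" where
  "ball_kernel \<beta> x y = (\<integral>\<^sup>+s. ball_feature \<beta> x s * ball_feature \<beta> y s \<partial>lborel)"

lemma ball_kernel_eq:
  fixes x y :: "'a::euclidean_space"
  shows "ball_kernel \<beta> x y = (\<integral>\<^sup>+t. ennreal (t powr (- 2 * \<beta>)) * indicator {0<..} t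
      * emeasure lborel (ball x t \<inter> ball y t) \<partial>lborel)"
proof -
  have "ball_kernel \<beta> x y = (\<integral>\<^sup>+s. ball_feature \<beta> x s * ball_feature \<beta> y s \<partial>(lborel \<Otimes>\<^sub>M lborel))"
    by (simp add: ball_kernel_def lborel_prod)
  also have "\<dots> = (\<integral>\<^sup>+t. \<integral>\<^sup>+z. ball_feature \<beta> x (t, z) * ball_feature \<beta> y (t, z) \<partial>lborel \<partial>lborel)"
    unfolding ball_feature_def
    by (rule lborel.nn_integral_fst[symmetric]) measurable
  also have "\<dots> = (\<integral>\<^sup>+t. ennreal (t powr (- 2 * \<beta>)) * indicator {0<..} t
      * emeasure lborel (ball x t \<inter> ball y t) \<partial>lborel)"
  proof (intro nn_integral_cong)
    fix t :: real
    have "ball_feature \<beta> x (t, z) * ball_feature \<beta> y (t, z)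
        = ennreal (t powr (- 2 * \<beta>)) * indicator {0<..} t * indicator (ball x t \<inter> ball y t) z" for z
    proof (cases "z \<in> ball x t \<inter> ball y t")
      case True
      then have "norm (x - z) < t" by (simp add: dist_norm)
      then have "0 < t" using norm_ge_zero[of "x - z"] by linarith
      moreover have "t powr (- \<beta>) * t powr (- \<beta>) = t powr (- 2 * \<beta>)" by (simp add: powr_add[symmetric])
      ultimately show ?thesis using True
        by (simp add: ball_feature_def dist_norm ennreal_mult[symmetric])
    qed (auto simp: ball_feature_def dist_norm)
    then show "(\<integral>\<^sup>+z. ball_feature \<beta> x (t, z) * ball_feature \<beta> y (t, z) \<partial>lborel)
        = ennreal (t powr (- 2 * \<beta>)) * indicator {0<..} t * emeasure lborel (ball x t \<inter> ball y t)"
      by (simp add: nn_integral_cmult_indicator)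
  qed
  finally show ?thesis .
qed

lemma nn_integral_powr_tail:
  assumes "0 < d" "0 < \<mu>"
  shows "(\<integral>\<^sup>+t. ennreal (t powr (- \<mu> - 1)) * indicator {d..} t \<partial>lborel) = ennreal (d powr (- \<mu>) / \<mu>)"
proof -
  have "(\<integral>\<^sup>+t. ennreal (t powr (- \<mu> - 1)) * indicator {d..} t \<partial>lborel) = ennreal (0 - (- (d powr (- \<mu>)) / \<mu>))"
  proof (rule nn_integral_FTC_atLeast[where F = "\<lambda>t. - (t powr (- \<mu>)) / \<mu>"])
    show "((\<lambda>t. - (t powr (- \<mu>)) / \<mu>) has_real_derivative t powr (- \<mu> - 1)) (at t)" if "d \<le> t" for t
      using assms that by (auto intro!: derivative_eq_intros simp: field_simps)
    show "((\<lambda>t. - (t powr (- \<mu>)) / \<mu>) \<longlongrightarrow> 0) at_top"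
    proof -
      have "((\<lambda>t. t powr (- \<mu>)) \<longlongrightarrow> 0) at_top"
        using assms by (intro tendsto_neg_powr filterlim_ident) auto
      from tendsto_divide[OF tendsto_minus[OF this] tendsto_const[of \<mu>]] show ?thesis using assms by simp
    qed
  qed auto
  then show ?thesis by simp
qed

lemma ball_kernel_bounds:
  fixes x y :: "'a::euclidean_space"
  assumes \<mu>: "0 < \<mu>" and xy: "x \<noteq> y"
  defines "N \<equiv> real DIM('a)" and "\<omega> \<equiv> unit_ball_vol (real DIM('a))"
  shows "ball_kernel ((\<mu> + 1 + N) / 2) x y \<le> ennreal (\<omega> * 2 powr \<mu> / \<mu>) * riesz_kernel \<mu> x y"
    and "ennreal (\<omega> / 2 powr (N + \<mu>) / \<mu>) * riesz_kernel \<mu> x y \<le> ball_kernel ((\<mu> + 1 + N) / 2) x y"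
proof -
  let ?\<beta> = "(\<mu> + 1 + N) / 2"
  define d where "d = norm (x - y)"
  have d: "0 < d" using xy by (simp add: d_def)
  have \<omega>: "0 < \<omega>" by (simp add: \<omega>_def)
  have tN: "t powr (- 2 * ?\<beta>) * t ^ DIM('a) = t powr (- \<mu> - 1)" if "0 < t" for t :: real
  proof -
    have "- 2 * ?\<beta> + N = - \<mu> - 1" by (simp add: field_simps)
    moreover have "t powr (- 2 * ?\<beta> + N) = t powr (- 2 * ?\<beta>) * t ^ DIM('a)"
      using that by (simp add: powr_add N_def powr_realpow)
    ultimately show ?thesis by simp
  qed
  have "ball_kernel ?\<beta> x y \<le> (\<integral>\<^sup>+t. ennreal \<omega> * (ennreal (t powr (- \<mu> - 1)) * indicator {d / 2..} t) \<partial>lborel)"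
    unfolding ball_kernel_eq
  proof (rule nn_integral_mono)
    fix t :: real
    show "ennreal (t powr (- 2 * ?\<beta>)) * indicator {0<..} t * emeasure lborel (ball x t \<inter> ball y t)
        \<le> ennreal \<omega> * (ennreal (t powr (- \<mu> - 1)) * indicator {d / 2..} t)"
    proof (cases "d / 2 \<le> t")
      case True
      then have t: "0 < t" using d by linarith
      have "emeasure lborel (ball x t \<inter> ball y t) \<le> emeasure lborel (ball x t)" by (intro emeasure_mono) auto
      also have "\<dots> = ennreal (\<omega> * t ^ DIM('a))" using t by (simp add: emeasure_ball \<omega>_def)
      finally have "ennreal (t powr (- 2 * ?\<beta>)) * emeasure lborel (ball x t \<inter> ball y t)
          \<le> ennreal (t powr (- 2 * ?\<beta>)) * ennreal (\<omega> * t ^ DIM('a))" by (rule mult_left_mono) simp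
      also have "\<dots> = ennreal (\<omega> * (t powr (- 2 * ?\<beta>) * t ^ DIM('a)))"
        using \<omega> t by (subst ennreal_mult[symmetric]) (auto simp: mult_ac)
      also have "\<dots> = ennreal \<omega> * ennreal (t powr (- \<mu> - 1))"
        unfolding tN[OF t] using \<omega> by (simp add: ennreal_mult)
      finally show ?thesis using True t by simp
    next
      case False
      have "ball x t \<inter> ball y t = {}"
      proof (rule ccontr)
        assume "ball x t \<inter> ball y t \<noteq> {}"
        then obtain z where "dist x z < t" "dist y z < t" by auto
        then have "dist x y < 2 * t" using dist_triangle2[of x y z] by linarith
        with False show False by (simp add: d_def dist_norm)
      qed
      then show ?thesis by simp
    qed
  qed
  also have "\<dots> = ennreal \<omega> * ennreal ((d / 2) powr (- \<mu>) / \<mu>)"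
    using nn_integral_powr_tail[of "d / 2" \<mu>] d \<mu> by (subst nn_integral_cmult) auto
  also have "\<dots> = ennreal (\<omega> * ((d / 2) powr (- \<mu>) / \<mu>))" using \<omega> \<mu> by (subst ennreal_mult) auto
  also have "\<omega> * ((d / 2) powr (- \<mu>) / \<mu>) = (\<omega> * 2 powr \<mu> / \<mu>) * (1 / d powr \<mu>)"
    using d by (simp add: powr_minus_divide powr_divide)
  also have "ennreal \<dots> = ennreal (\<omega> * 2 powr \<mu> / \<mu>) * riesz_kernel \<mu> x y"
    unfolding riesz_kernel_def d_def[symmetric] using \<omega> \<mu> by (subst ennreal_mult) auto
  finally show "ball_kernel ?\<beta> x y \<le> ennreal (\<omega> * 2 powr \<mu> / \<mu>) * riesz_kernel \<mu> x y" .
  have "ennreal (\<omega> / 2 powr (N + \<mu>) / \<mu>) * riesz_kernel \<mu> x y = ennreal ((\<omega> / 2 powr (N + \<mu>) / \<mu>) * (1 / d powr \<mu>))"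
    unfolding riesz_kernel_def d_def[symmetric] using \<omega> \<mu> by (subst ennreal_mult) auto
  also have "(\<omega> / 2 powr (N + \<mu>) / \<mu>) * (1 / d powr \<mu>) = (\<omega> / 2 powr N) * ((2 * d) powr (- \<mu>) / \<mu>)"
    using d by (simp add: powr_minus_divide powr_mult powr_add)
  also have "ennreal \<dots> = ennreal (\<omega> / 2 powr N) * ennreal ((2 * d) powr (- \<mu>) / \<mu>)"
    using \<omega> \<mu> by (subst ennreal_mult) auto
  also have "\<dots> = (\<integral>\<^sup>+t. ennreal (\<omega> / 2 powr N) * (ennreal (t powr (- \<mu> - 1)) * indicator {2 * d..} t) \<partial>lborel)"
    using nn_integral_powr_tail[of "2 * d" \<mu>] d \<mu> by (subst nn_integral_cmult) auto
  also have "\<dots> \<le> ball_kernel ?\<beta> x y"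
    unfolding ball_kernel_eq
  proof (rule nn_integral_mono)
    fix t :: real
    show "ennreal (\<omega> / 2 powr N) * (ennreal (t powr (- \<mu> - 1)) * indicator {2 * d..} t)
       \<le> ennreal (t powr (- 2 * ?\<beta>)) * indicator {0<..} t * emeasure lborel (ball x t \<inter> ball y t)"
    proof (cases "2 * d \<le> t")
      case True
      then have t: "0 < t" using d by linarith
      have "ball x (t / 2) \<subseteq> ball x t \<inter> ball y t"
      proof
        fix z assume "z \<in> ball x (t / 2)"
        then have "dist x z < t / 2" by simp
        moreover have "dist y z \<le> d + dist x z"
          using dist_triangle[of y z x] by (simp add: d_def dist_norm norm_minus_commute)
        ultimately show "z \<in> ball x t \<inter> ball y t" using True t by simp
      qed
      then have "emeasure lborel (ball x (t / 2)) \<le> emeasure lborel (ball x t \<inter> ball y t)" by (intro emeasure_mono) auto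
      moreover have "emeasure lborel (ball x (t / 2)) = ennreal (\<omega> / 2 powr N * t ^ DIM('a))"
        using t by (simp add: emeasure_ball \<omega>_def N_def powr_realpow power_divide)
      ultimately have "ennreal (t powr (- 2 * ?\<beta>)) * ennreal (\<omega> / 2 powr N * t ^ DIM('a))
          \<le> ennreal (t powr (- 2 * ?\<beta>)) * emeasure lborel (ball x t \<inter> ball y t)"
        by (intro mult_left_mono) auto
      moreover have "ennreal (t powr (- 2 * ?\<beta>)) * ennreal (\<omega> / 2 powr N * t ^ DIM('a))
          = ennreal (\<omega> / 2 powr N * (t powr (- 2 * ?\<beta>) * t ^ DIM('a)))"
        using \<omega> t by (subst ennreal_mult[symmetric]) (auto simp: mult_ac)
      moreover have "\<dots> = ennreal (\<omega> / 2 powr N) * ennreal (t powr (- \<mu> - 1))"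
        unfolding tN[OF t] using \<omega> by (subst ennreal_mult) auto
      ultimately show ?thesis using True t by simp
    qed simp
  qed
  finally show "ennreal (\<omega> / 2 powr (N + \<mu>) / \<mu>) * riesz_kernel \<mu> x y \<le> ball_kernel ?\<beta> x y" .
qed

lemma mult_le_sum_squares_ennreal: "(a::ennreal) * b \<le> a * a + b * b"
proof (cases "a \<le> b")
  case True
  then have "a * b \<le> b * b" by (intro mult_right_mono) auto
  then show ?thesis by (simp add: add_increasing)
next
  case False
  then have "a * b \<le> a * a" by (intro mult_left_mono) auto
  then show ?thesis by (simp add: add_increasing2)
qed

text \<open>
A qualitative Cauchy--Schwarz inequality for the Riesz kernel, through the comparable kernel
\<^const>\<open>ball_kernel\<close> and \<open>F G \<le> F\<^sup>2 + G\<^sup>2\<close> for the feature integrals.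
\<close>

lemma mixed_energy_finite:
  fixes f g :: "'a::euclidean_space \<Rightarrow> ennreal"
  assumes \<mu>: "0 < \<mu>" and [measurable]: "f \<in> borel_measurable lebesgue" "g \<in> borel_measurable lebesgue"
    and fin: "energy \<mu> f f < \<infinity>" "energy \<mu> g g < \<infinity>"
  shows "energy \<mu> f g < \<infinity>"
proof -
  define N \<omega> where "N = real DIM('a)" and "\<omega> = unit_ball_vol (real DIM('a))"
  have \<omega>: "0 < \<omega>" by (simp add: \<omega>_def)
  define \<beta> where "\<beta> = (\<mu> + 1 + N) / 2"
  define C c where "C = \<omega> * 2 powr \<mu> / \<mu>" and "c = \<omega> / 2 powr (N + \<mu>) / \<mu>"
  have c: "0 < c" using \<omega> \<mu> by (simp add: c_def)
  define K where "K f g = (\<integral>\<^sup>+y. \<integral>\<^sup>+x. f x * g y * ball_kernel \<beta> x y \<partial>lebesgue \<partial>lebesgue)"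
    for f g :: "'a \<Rightarrow> ennreal"
  have [measurable]: "(\<lambda>p. ball_feature \<beta> (fst p) (snd p)) \<in> borel_measurable ((lebesgue :: 'a measure) \<Otimes>\<^sub>M lborel)"
    by (rule ball_feature_measurable)
  have K_eq: "K f g = (\<integral>\<^sup>+s. (\<integral>\<^sup>+x. f x * ball_feature \<beta> x s \<partial>lebesgue) * (\<integral>\<^sup>+y. g y * ball_feature \<beta> y s \<partial>lebesgue) \<partial>lborel)"
    if [measurable]: "f \<in> borel_measurable lebesgue" "g \<in> borel_measurable lebesgue" for f g :: "'a \<Rightarrow> ennreal"
    unfolding K_def ball_kernel_def
    by (rule factorized_kernel_energy[OF sigma_finite_lebesgue lborel.sigma_finite_measure_axioms]) measurable
  have feature_meas: "(\<lambda>s. \<integral>\<^sup>+x. f x * ball_feature \<beta> x s \<partial>lebesgue) \<in> borel_measurable lborel"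
    if [measurable]: "f \<in> borel_measurable lebesgue" for f :: "'a \<Rightarrow> ennreal"
  proof -
    interpret sigma_finite_measure "lebesgue :: 'a measure" by (rule sigma_finite_lebesgue)
    note ball_feature_measurable_swap[measurable]
    show ?thesis
      using borel_measurable_nn_integral[of "\<lambda>s x. f x * ball_feature \<beta> x s" lborel]
      by (simp add: split_beta)
  qed
  have ne: "AE x in lebesgue. x \<noteq> y" for y :: 'a by (auto intro: AE_completion AE_lborel_singleton)
  have scale: "(\<integral>\<^sup>+y. \<integral>\<^sup>+x. a * g y * (f x * riesz_kernel \<mu> x y) \<partial>lebesgue \<partial>lebesgue) = a * energy \<mu> f g"
    if [measurable]: "f \<in> borel_measurable lebesgue" "g \<in> borel_measurable lebesgue"
    for a and f g :: "'a \<Rightarrow> ennreal"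
  proof -
    have "(\<integral>\<^sup>+y. \<integral>\<^sup>+x. a * g y * (f x * riesz_kernel \<mu> x y) \<partial>lebesgue \<partial>lebesgue)
        = (\<integral>\<^sup>+y. a * (g y * potential \<mu> f y) \<partial>lebesgue)"
      unfolding potential_def by (simp add: nn_integral_cmult mult.assoc)
    also have "\<dots> = a * energy \<mu> f g" unfolding energy_def by (rule nn_integral_cmult) measurable
    finally show ?thesis .
  qed
  have upper: "K f f \<le> ennreal C * energy \<mu> f f" if [measurable]: "f \<in> borel_measurable lebesgue" for f :: "'a \<Rightarrow> ennreal"
  proof -
    have "K f f \<le> (\<integral>\<^sup>+y. \<integral>\<^sup>+x. ennreal C * f y * (f x * riesz_kernel \<mu> x y) \<partial>lebesgue \<partial>lebesgue)"
      unfolding K_def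
    proof (rule nn_integral_mono, rule nn_integral_mono_AE)
      fix y
      show "AE x in lebesgue. f x * f y * ball_kernel \<beta> x y \<le> ennreal C * f y * (f x * riesz_kernel \<mu> x y)"
        using ne[of y]
      proof eventually_elim
        case (elim x)
        have "f x * f y * ball_kernel \<beta> x y \<le> f x * f y * (ennreal C * riesz_kernel \<mu> x y)"
          using ball_kernel_bounds(1)[OF \<mu> elim] by (intro mult_left_mono) (auto simp: \<beta>_def C_def N_def \<omega>_def)
        then show ?case by (simp add: mult_ac)
      qed
    qed
    also have "\<dots> = ennreal C * energy \<mu> f f" by (rule scale) measurable
    finally show ?thesis .
  qed
  have "ennreal c * energy \<mu> f g = (\<integral>\<^sup>+y. \<integral>\<^sup>+x. f x * g y * (ennreal c * riesz_kernel \<mu> x y) \<partial>lebesgue \<partial>lebesgue)"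
  proof -
    have "ennreal c * energy \<mu> f g = (\<integral>\<^sup>+y. \<integral>\<^sup>+x. ennreal c * g y * (f x * riesz_kernel \<mu> x y) \<partial>lebesgue \<partial>lebesgue)"
      by (rule scale[symmetric]) measurable
    then show ?thesis by (simp add: mult_ac)
  qed
  also have "\<dots> \<le> K f g"
    unfolding K_def
  proof (rule nn_integral_mono, rule nn_integral_mono_AE)
    fix y
    show "AE x in lebesgue. f x * g y * (ennreal c * riesz_kernel \<mu> x y) \<le> f x * g y * ball_kernel \<beta> x y"
      using ne[of y]
    proof eventually_elim
      case (elim x)
      show ?case
        using ball_kernel_bounds(2)[OF \<mu> elim] by (intro mult_left_mono) (auto simp: \<beta>_def c_def N_def \<omega>_def)
    qed
  qed
  also have "\<dots> \<le> K f f + K g g"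
  proof -
    have "K f g \<le> (\<integral>\<^sup>+s. (\<integral>\<^sup>+x. f x * ball_feature \<beta> x s \<partial>lebesgue) * (\<integral>\<^sup>+x. f x * ball_feature \<beta> x s \<partial>lebesgue)
       + (\<integral>\<^sup>+y. g y * ball_feature \<beta> y s \<partial>lebesgue) * (\<integral>\<^sup>+y. g y * ball_feature \<beta> y s \<partial>lebesgue) \<partial>lborel)"
      unfolding K_eq[OF assms(2,3)] by (intro nn_integral_mono mult_le_sum_squares_ennreal)
    also have "\<dots> = K f f + K g g"
      unfolding K_eq[OF assms(2,2)] K_eq[OF assms(3,3)]
      by (intro nn_integral_add borel_measurable_times_ennreal feature_meas assms)
    finally show ?thesis .
  qed
  also have "\<dots> \<le> ennreal C * energy \<mu> f f + ennreal C * energy \<mu> g g"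
    using upper[OF assms(2)] upper[OF assms(3)] by (rule add_mono)
  also have "\<dots> < \<infinity>" using fin by (simp add: ennreal_mult_less_top)
  finally show ?thesis using c by (auto simp: ennreal_mult_less_top)
qed

section \<open>The nonlocal functionals and the fibre maps\<close>

text \<open>
The iterated Bochner integral assigns \<open>0\<close> to a divergent inner or outer integral. The inner
\<^const>\<open>enn2real\<close> records this for the inner integral, the outer one for the outer integral.
\<close>

lemma double_integral_eq:
  fixes f g :: "'a::euclidean_space \<Rightarrow> real"
  assumes [measurable]: "f \<in> borel_measurable lebesgue" "g \<in> borel_measurable lebesgue"
    and nn: "\<And>x. 0 \<le> f x" "\<And>x. 0 \<le> g x"
  shows "(LINT y|lebesgue. LINT x|lebesgue. g y * (f x * (1 / norm (x - y) powr \<mu>)))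
    = enn2real (\<integral>\<^sup>+y. ennreal (enn2real (ennreal (g y) * potential \<mu> (\<lambda>x. ennreal (f x)) y)) \<partial>lebesgue)"
proof -
  have id[measurable]: "(\<lambda>x::'a. x) \<in> borel_measurable lebesgue" by (simp add: measurable_completion)
  have inner: "(LINT x|lebesgue. g y * (f x * (1 / norm (x - y) powr \<mu>)))
      = enn2real (ennreal (g y) * potential \<mu> (\<lambda>x. ennreal (f x)) y)" for y
  proof -
    have "(LINT x|lebesgue. g y * (f x * (1 / norm (x - y) powr \<mu>)))
        = enn2real (\<integral>\<^sup>+x. ennreal (g y * (f x * (1 / norm (x - y) powr \<mu>))) \<partial>lebesgue)"
      using nn by (intro integral_eq_nn_integral AE_I2 mult_nonneg_nonneg) auto
    also have "(\<integral>\<^sup>+x. ennreal (g y * (f x * (1 / norm (x - y) powr \<mu>))) \<partial>lebesgue)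
        = (\<integral>\<^sup>+x. ennreal (g y) * (ennreal (f x) * riesz_kernel \<mu> x y) \<partial>lebesgue)"
      unfolding riesz_kernel_def using nn by (intro nn_integral_cong) (simp add: ennreal_mult' del: times_divide_eq_right)
    also have "\<dots> = ennreal (g y) * potential \<mu> (\<lambda>x. ennreal (f x)) y"
      unfolding potential_def by (rule nn_integral_cmult) measurable
    finally show ?thesis .
  qed
  show ?thesis
    unfolding inner by (intro integral_eq_nn_integral) auto
qed

lemma double_integral_eq_energy:
  fixes f g :: "'a::euclidean_space \<Rightarrow> real"
  assumes [measurable]: "f \<in> borel_measurable lebesgue" "g \<in> borel_measurable lebesgue"
    and nn: "\<And>x. 0 \<le> f x" "\<And>x. 0 \<le> g x"
    and fin: "energy \<mu> (\<lambda>x. ennreal (f x)) (\<lambda>x. ennreal (g x)) < \<infinity>"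
  shows "(LINT y|lebesgue. LINT x|lebesgue. g y * (f x * (1 / norm (x - y) powr \<mu>)))
    = enn2real (energy \<mu> (\<lambda>x. ennreal (f x)) (\<lambda>x. ennreal (g x)))"
proof -
  have "AE y in lebesgue. ennreal (g y) * potential \<mu> (\<lambda>x. ennreal (f x)) y \<noteq> \<infinity>"
    using fin unfolding energy_def by (intro nn_integral_PInf_AE) auto
  then have "AE y in lebesgue. ennreal (enn2real (ennreal (g y) * potential \<mu> (\<lambda>x. ennreal (f x)) y))
      = ennreal (g y) * potential \<mu> (\<lambda>x. ennreal (f x)) y"
    by eventually_elim (simp add: less_top)
  then show ?thesis
    unfolding double_integral_eq[OF assms(1-4)] energy_def by (subst nn_integral_cong_AE) auto
qed

text \<open>
If the potential were infinite everywhere, every inner integral would receive the value \<open>0\<close>. Hence a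
nonzero value yields a point where the potential is finite, so it is finite almost everywhere, and
the default values of the Bochner integral do not intervene.
\<close>

lemma energy_finite_if_double_integral_nonzero:
  fixes f g :: "'a::euclidean_space \<Rightarrow> real"
  assumes \<mu>: "0 < \<mu>" "\<mu> < real DIM('a)"
    and [measurable]: "f \<in> borel_measurable lebesgue" "g \<in> borel_measurable lebesgue"
    and nn: "\<And>x. 0 \<le> f x" "\<And>x. 0 \<le> g x"
    and nz: "(LINT y|lebesgue. LINT x|lebesgue. g y * (f x * (1 / norm (x - y) powr \<mu>))) \<noteq> 0"
  shows "AE y in lebesgue. potential \<mu> (\<lambda>x. ennreal (f x)) y < \<infinity>"
    and "energy \<mu> (\<lambda>x. ennreal (f x)) (\<lambda>x. ennreal (g x)) < \<infinity>"
proof -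
  let ?P = "potential \<mu> (\<lambda>x. ennreal (f x))"
  have nz': "enn2real (\<integral>\<^sup>+y. ennreal (enn2real (ennreal (g y) * ?P y)) \<partial>lebesgue) \<noteq> 0"
    using nz unfolding double_integral_eq[OF assms(3-6)] .
  have "\<exists>y. ?P y < \<infinity>"
  proof (rule ccontr)
    assume "\<nexists>y. ?P y < \<infinity>"
    then have "?P y = top" for y using less_top[of "?P y"] by auto
    then have "enn2real (ennreal (g y) * ?P y) = 0" for y by (simp add: enn2real_mult)
    with nz' show False by simp
  qed
  then show *: "AE y in lebesgue. ?P y < \<infinity>"
    using potential_finite_AE[OF \<mu>, of "\<lambda>x. ennreal (f x)"] by auto
  then have "AE y in lebesgue. ennreal (enn2real (ennreal (g y) * ?P y)) = ennreal (g y) * ?P y"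
    by eventually_elim (simp add: ennreal_mult_less_top)
  then have "energy \<mu> (\<lambda>x. ennreal (f x)) (\<lambda>x. ennreal (g x))
      = (\<integral>\<^sup>+y. ennreal (enn2real (ennreal (g y) * ?P y)) \<partial>lebesgue)"
    unfolding energy_def by (intro nn_integral_cong_AE) (auto elim: eventually_mono)
  then show "energy \<mu> (\<lambda>x. ennreal (f x)) (\<lambda>x. ennreal (g x)) < \<infinity>"
    using nz' by (auto simp: enn2real_eq_0_iff less_top)
qed

definition weighted :: "('a::euclidean_space \<Rightarrow> real) \<Rightarrow> real \<Rightarrow> ('a \<Rightarrow> real) \<Rightarrow> 'a \<Rightarrow> real" where
  "weighted b \<alpha> w x = b x * w x / norm x powr \<alpha>"

lemma weighted_measurable[measurable]:
  assumes [measurable]: "b \<in> borel_measurable lebesgue" "w \<in> borel_measurable lebesgue"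
  shows "weighted b \<alpha> w \<in> borel_measurable lebesgue"
proof -
  have [measurable]: "(\<lambda>x::'a. x) \<in> borel_measurable lebesgue" by (simp add: measurable_completion)
  show ?thesis unfolding weighted_def[abs_def] by measurable
qed

lemma weighted_nonneg: "0 < b x \<Longrightarrow> 0 \<le> w x \<Longrightarrow> 0 \<le> weighted b \<alpha> w x"
  by (simp add: weighted_def)

lemma weighted_mono: "0 < b x \<Longrightarrow> v x \<le> w x \<Longrightarrow> weighted b \<alpha> v x \<le> weighted b \<alpha> w x"
  by (simp add: weighted_def divide_right_mono)

lemma B_fun_eq:
  "B_fun b p \<alpha> \<mu> u = (LINT y|lebesgue. LINT x|lebesgue.
     weighted b \<alpha> (\<lambda>x. \<bar>u x\<bar> powr p) y * (weighted b \<alpha> (\<lambda>x. \<bar>u x\<bar> powr p) x * (1 / norm (x - y) powr \<mu>)))"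
  unfolding B_fun_def weighted_def by (simp add: mult_ac)

lemma B_fun_scale:
  assumes "0 < t"
  shows "B_fun b p \<alpha> \<mu> (\<lambda>x. t * u x) = t powr (2 * p) * B_fun b p \<alpha> \<mu> u"
proof -
  have "weighted b \<alpha> (\<lambda>x. \<bar>t * u x\<bar> powr p) y = t powr p * weighted b \<alpha> (\<lambda>x. \<bar>u x\<bar> powr p) y" for y
    using assms by (simp add: weighted_def abs_mult powr_mult)
  then have "B_fun b p \<alpha> \<mu> (\<lambda>x. t * u x) = (LINT y|lebesgue. LINT x|lebesgue. (t powr p * t powr p) *
     (weighted b \<alpha> (\<lambda>x. \<bar>u x\<bar> powr p) y * (weighted b \<alpha> (\<lambda>x. \<bar>u x\<bar> powr p) x * (1 / norm (x - y) powr \<mu>))))"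
    unfolding B_fun_eq by (simp add: mult_ac)
  also have "\<dots> = (t powr p * t powr p) * B_fun b p \<alpha> \<mu> u"
    unfolding B_fun_eq by (simp only: integral_mult_right_zero)
  finally show ?thesis by (simp add: powr_add[symmetric])
qed

lemma A_fun_scale:
  assumes "0 < t"
  shows "A_fun a q (\<lambda>x. t * u x) = t powr q * A_fun a q u"
proof -
  have "A_fun a q (\<lambda>x. t * u x) = (LINT x|lebesgue. t powr q * (a x * \<bar>u x\<bar> powr q))"
    using assms unfolding A_fun_def by (simp add: abs_mult powr_mult mult_ac)
  then show ?thesis by (simp add: A_fun_def)
qed

lemma B_fun_nonneg:
  assumes "\<And>x. 0 < b x"
  shows "0 \<le> B_fun b p \<alpha> \<mu> u"
  unfolding B_fun_eq using assms
  by (intro integral_nonneg_AE AE_I2 mult_nonneg_nonneg weighted_nonneg) auto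

lemma A_fun_nonneg:
  assumes "\<And>x. 0 < a x"
  shows "0 \<le> A_fun a q u"
  unfolding A_fun_def using assms
  by (intro integral_nonneg_AE AE_I2 mult_nonneg_nonneg) (auto intro: less_imp_le)

lemma powr_le_tangent:
  fixes s \<theta> :: real
  assumes "0 < s" "0 \<le> \<theta>" "\<theta> \<le> 1"
  shows "s powr \<theta> \<le> 1 + \<theta> * (s - 1)"
  using Youngs_inequality_0[of \<theta> "1 - \<theta>" s 1] assms by (simp add: algebra_simps)

lemma powr_add_le_tangent:
  fixes u \<delta> q :: real
  assumes "0 < u" "0 \<le> \<delta>" "0 \<le> q" "q \<le> 1"
  shows "(u + \<delta>) powr q \<le> u powr q + q * u powr (q - 1) * \<delta>"
proof -
  have "u + \<delta> = u * (1 + \<delta> / u)" using assms by (simp add: field_simps)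
  then have "(u + \<delta>) powr q = u powr q * (1 + \<delta> / u) powr q"
    using assms by (simp add: powr_mult)
  also have "\<dots> \<le> u powr q * (1 + q * (1 + \<delta> / u - 1))"
    using assms by (intro mult_left_mono powr_le_tangent) (auto simp: add_pos_nonneg)
  also have "\<dots> = u powr q + q * (u powr q / u) * \<delta>" using assms by (simp add: field_simps)
  finally show ?thesis using assms by (simp add: powr_diff)
qed

lemma powr_add_ge_tangent:
  fixes u \<delta> p :: real
  assumes "0 < u" "0 \<le> \<delta>" "1 < p"
  shows "u powr p + p * u powr (p - 1) * \<delta> \<le> (u + \<delta>) powr p"
proof -
  have pos: "0 < 1 + \<delta> / u" using assms by (simp add: add_pos_nonneg)
  have "((1 + \<delta> / u) powr p) powr (1 / p) \<le> 1 + 1 / p * ((1 + \<delta> / u) powr p - 1)"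
    using assms pos by (intro powr_le_tangent) auto
  then have "1 + \<delta> / u \<le> 1 + 1 / p * ((1 + \<delta> / u) powr p - 1)"
    using assms pos by (simp add: powr_powr)
  then have *: "1 + p * (\<delta> / u) \<le> (1 + \<delta> / u) powr p"
    using assms by (simp add: field_simps)
  have "u powr p + p * u powr (p - 1) * \<delta> = u powr p * (1 + p * (\<delta> / u))"
    using assms by (simp add: powr_diff field_simps)
  also have "\<dots> \<le> u powr p * (1 + \<delta> / u) powr p"
    using * by (rule mult_left_mono) simp
  also have "\<dots> = (u * (1 + \<delta> / u)) powr p"
    using assms by (simp add: powr_mult)
  also have "u * (1 + \<delta> / u) = u + \<delta>" using assms by (simp add: field_simps)
  finally show ?thesis .
qed

lemma powr_segment_le:
  fixes u v \<epsilon> p :: real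
  assumes "0 < u" "0 \<le> v" "0 \<le> \<epsilon>" "\<epsilon> \<le> 1" "1 < p"
  shows "(u + \<epsilon> * v) powr p \<le> u powr p + \<epsilon> * (u + v) powr p"
proof -
  have "((1 - \<epsilon>) *\<^sub>R u + \<epsilon> *\<^sub>R (u + v)) powr p \<le> (1 - \<epsilon>) * u powr p + \<epsilon> * (u + v) powr p"
    using assms by (intro convex_onD[OF powr_convex]) (auto simp: add_pos_nonneg)
  also have "(1 - \<epsilon>) *\<^sub>R u + \<epsilon> *\<^sub>R (u + v) = u + \<epsilon> * v" by (simp add: algebra_simps)
  also have "(1 - \<epsilon>) * u powr p + \<epsilon> * (u + v) powr p \<le> u powr p + \<epsilon> * (u + v) powr p"
    using assms by (simp add: mult_left_le_one_le)
  finally show ?thesis .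
qed

lemma fibre_difference_le:
  fixes \<tau> q p :: real
  assumes "0 < q" "q < 1" "1 < p" "0 < \<tau>"
  shows "\<tau> powr (2 - q) - (2 - q) / (2 * p - q) * \<tau> powr (2 * p - q) \<le> 1 - (2 - q) / (2 * p - q)"
proof -
  define \<theta> where "\<theta> = (2 - q) / (2 * p - q)"
  have "(\<tau> powr (2 * p - q)) powr \<theta> \<le> 1 + \<theta> * (\<tau> powr (2 * p - q) - 1)"
    using assms by (intro powr_le_tangent) (auto simp: \<theta>_def field_simps)
  moreover have "(\<tau> powr (2 * p - q)) powr \<theta> = \<tau> powr (2 - q)"
    using assms by (simp add: powr_powr \<theta>_def)
  ultimately show ?thesis unfolding \<theta>_def[symmetric] by (simp add: algebra_simps)
qed

text \<open>
After the substitution \<open>t = t0 \<tau>\<close> the difference is a positive multiple of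
\<open>\<tau>\<^bsup>2 - q\<^esup> - \<theta> \<tau>\<^bsup>2 p - q\<^esup>\<close> with \<open>\<theta> = (2 - q) / (2 p - q)\<close>, which Bernoulli's inequality maximises at
\<open>\<tau> = 1\<close>.
\<close>

lemma fibre_quotient_max:
  fixes n B q p :: real
  assumes "0 < n" "0 < B" and qp: "0 < q" "q < 1" "1 < p"
  defines "t0 \<equiv> ((2 - q) * n / ((2 * p - q) * B)) powr (1 / (2 * p - 2))"
  assumes t: "0 < t"
  shows "t powr (2 - q) * n - t powr (2 * p - q) * B \<le> t0 powr (2 - q) * n - t0 powr (2 * p - q) * B"
proof -
  let ?\<theta> = "(2 - q) / (2 * p - q)"
  have frac: "0 < (2 - q) * n / ((2 * p - q) * B)" using assms by simp
  then have t0: "0 < t0" unfolding t0_def powr_gt_zero by (metis less_irrefl)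
  have inverse_power: "(z powr (1 / (2 * p - 2))) powr (2 * p - 2) = z" if "0 < z" for z :: real
    using qp that by (simp add: powr_powr)
  have "t0 powr (2 * p - 2) = (2 - q) * n / ((2 * p - q) * B)"
    unfolding t0_def by (rule inverse_power[OF frac])
  then have t0_pow: "t0 powr (2 * p - 2) * B = ?\<theta> * n" using assms by (simp add: field_simps)
  have t0_split: "t0 powr (2 * p - q) = t0 powr (2 - q) * t0 powr (2 * p - 2)"
    by (simp add: powr_add[symmetric])
  define \<tau> where "\<tau> = t / t0"
  have \<tau>: "0 < \<tau>" "t = t0 * \<tau>" using t t0 by (auto simp: \<tau>_def)
  have "t powr (2 - q) * n - t powr (2 * p - q) * B
      = t0 powr (2 - q) * (\<tau> powr (2 - q) * n - \<tau> powr (2 * p - q) * (t0 powr (2 * p - 2) * B))"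
  proof -
    have split: "t powr c = t0 powr c * \<tau> powr c" for c using \<tau> t0 by (simp add: powr_mult)
    show ?thesis
      unfolding split[of "2 - q"] split[of "2 * p - q"] t0_split by (simp only: right_diff_distrib mult_ac)
  qed
  also have "\<dots> = t0 powr (2 - q) * n * (\<tau> powr (2 - q) - ?\<theta> * \<tau> powr (2 * p - q))"
    unfolding t0_pow by (simp add: algebra_simps)
  also have "\<dots> \<le> t0 powr (2 - q) * n * (1 - ?\<theta>)"
    using fibre_difference_le[OF qp \<tau>(1)] assms by (intro mult_left_mono) auto
  also have "\<dots> = t0 powr (2 - q) * n - t0 powr (2 - q) * (t0 powr (2 * p - 2) * B)"
    unfolding t0_pow by (simp add: algebra_simps)
  finally show ?thesis by (simp add: t0_split mult.assoc)
qed

lemma deriv_powr_sum: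
  fixes F :: "real \<Rightarrow> real"
  assumes F: "\<And>t. 0 < t \<Longrightarrow> F t = c2 * t\<^sup>2 + cq * t powr q + cp * t powr (2 * p)"
  shows "deriv F 1 = 2 * c2 + q * cq + 2 * p * cp"
    and "deriv (deriv F) 1 = 2 * c2 + q * (q - 1) * cq + 2 * p * (2 * p - 1) * cp"
proof -
  have F1: "(F has_real_derivative 2 * c2 * t + q * cq * t powr (q - 1) + 2 * p * cp * t powr (2 * p - 1)) (at t)"
    if "0 < t" for t
  proof -
    have "((\<lambda>t. c2 * t\<^sup>2 + cq * t powr q + cp * t powr (2 * p)) has_real_derivative
        2 * c2 * t + q * cq * t powr (q - 1) + 2 * p * cp * t powr (2 * p - 1)) (at t)"
      using that by (auto intro!: derivative_eq_intros simp: algebra_simps)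
    then show ?thesis
      by (rule has_field_derivative_transform_within_open[where S = "{0<..}"]) (use that F in auto)
  qed
  show "deriv F 1 = 2 * c2 + q * cq + 2 * p * cp" using DERIV_imp_deriv[OF F1[of 1]] by simp
  have F2: "((\<lambda>t. 2 * c2 * t + q * cq * t powr (q - 1) + 2 * p * cp * t powr (2 * p - 1)) has_real_derivative
      2 * c2 + q * (q - 1) * cq + 2 * p * (2 * p - 1) * cp) (at 1)"
    by (auto intro!: derivative_eq_intros simp: algebra_simps)
  have "(deriv F has_real_derivative 2 * c2 + q * (q - 1) * cq + 2 * p * (2 * p - 1) * cp) (at 1)"
    by (rule has_field_derivative_transform_within_open[OF F2, where S = "{0<..}"])
      (use DERIV_imp_deriv[OF F1] in auto)
  then show "deriv (deriv F) 1 = 2 * c2 + q * (q - 1) * cq + 2 * p * (2 * p - 1) * cp"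
    by (rule DERIV_imp_deriv)
qed

locale choquard_problem =
  fixes a b V :: "'a::euclidean_space \<Rightarrow> real" and q p \<alpha> \<mu> :: real
  assumes q: "0 < q" "q < 1" and p: "1 < p" and \<alpha>: "0 < \<alpha>" and \<mu>: "0 < \<mu>"
    and dim: "2 * \<alpha> + \<mu> < real DIM('a)"
    and a_cont: "continuous_on UNIV a" and a_pos: "\<And>x. 0 < a x"
    and b_meas[measurable]: "b \<in> borel_measurable lebesgue" and b_pos: "\<And>x. 0 < b x"
    and b_bounded: "\<exists>C. AE x in lebesgue. \<bar>b x\<bar> \<le> C"
    and V_cont: "continuous_on UNIV V" and V_pos: "\<And>x. 0 < V x"
begin

lemma \<mu>_less: "\<mu> < real DIM('a)" using \<alpha> dim by simp

lemma a_meas[measurable]: "a \<in> borel_measurable lebesgue"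
  using a_cont by (rule borel_measurable_continuous_lebesgue)

lemma V_meas[measurable]: "V \<in> borel_measurable lebesgue"
  using V_cont by (rule borel_measurable_continuous_lebesgue)

lemma X_space_measurable: "u \<in> X_space V \<Longrightarrow> u \<in> borel_measurable lebesgue"
  using H1_weak_gradient(4) by (auto simp: X_space_def)

abbreviation "A \<equiv> A_fun a q"
abbreviation "B \<equiv> B_fun b p \<alpha> \<mu>"
abbreviation "nrm u \<equiv> X_inner V u u"

text \<open>
The nonlocal functionals are energies of sources \<open>b w / \<bar>x\<bar>\<^sup>\<alpha>\<close>, with \<open>w = \<bar>u\<bar>\<^sup>p\<close> for \<open>B\<close> and one copy of
\<open>w = \<bar>u\<bar>\<^bsup>p - 1\<^esup> \<phi>\<close> for its derivative.
\<close>

definition src :: "('a \<Rightarrow> real) \<Rightarrow> 'a \<Rightarrow> ennreal" where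
  "src w x = ennreal (weighted b \<alpha> w x)"

lemma src_measurable[measurable]:
  "w \<in> borel_measurable lebesgue \<Longrightarrow> src w \<in> borel_measurable lebesgue"
  unfolding src_def[abs_def] by measurable

lemma B_eq_energy:
  assumes [measurable]: "u \<in> borel_measurable lebesgue"
    and "energy \<mu> (src (\<lambda>x. \<bar>u x\<bar> powr p)) (src (\<lambda>x. \<bar>u x\<bar> powr p)) < \<infinity>"
  shows "B u = enn2real (energy \<mu> (src (\<lambda>x. \<bar>u x\<bar> powr p)) (src (\<lambda>x. \<bar>u x\<bar> powr p)))"
  unfolding B_fun_eq src_def[abs_def] using assms(2) b_pos
  by (intro double_integral_eq_energy) (auto simp: src_def[abs_def] intro!: weighted_nonneg)

lemma energy_finite_if_B_nonzero:
  assumes [measurable]: "u \<in> borel_measurable lebesgue" and "B u \<noteq> 0"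
  shows "AE y in lebesgue. potential \<mu> (src (\<lambda>x. \<bar>u x\<bar> powr p)) y < \<infinity>"
    and "energy \<mu> (src (\<lambda>x. \<bar>u x\<bar> powr p)) (src (\<lambda>x. \<bar>u x\<bar> powr p)) < \<infinity>"
proof -
  let ?f = "weighted b \<alpha> (\<lambda>x. \<bar>u x\<bar> powr p)"
  have f: "?f \<in> borel_measurable lebesgue" and nn: "0 \<le> ?f x" for x
    using b_pos by (auto intro!: weighted_nonneg)
  note * = energy_finite_if_double_integral_nonzero[OF \<mu> \<mu>_less f f nn nn assms(2)[unfolded B_fun_eq]]
  show "AE y in lebesgue. potential \<mu> (src (\<lambda>x. \<bar>u x\<bar> powr p)) y < \<infinity>"
    unfolding src_def[abs_def] by (rule *(1))
  show "energy \<mu> (src (\<lambda>x. \<bar>u x\<bar> powr p)) (src (\<lambda>x. \<bar>u x\<bar> powr p)) < \<infinity>"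
    unfolding src_def[abs_def] by (rule *(2))
qed

lemma D_eq_energy:
  assumes [measurable]: "u \<in> borel_measurable lebesgue" "\<phi> \<in> borel_measurable lebesgue"
    and u: "AE x in lebesgue. 0 < u x" and \<phi>: "\<And>x. 0 \<le> \<phi> x"
    and fin: "energy \<mu> (src (\<lambda>x. \<bar>u x\<bar> powr (p - 1) * \<phi> x)) (src (\<lambda>x. \<bar>u x\<bar> powr p)) < \<infinity>"
  shows "D_fun b p \<alpha> \<mu> u \<phi> = enn2real (energy \<mu> (src (\<lambda>x. \<bar>u x\<bar> powr (p - 1) * \<phi> x)) (src (\<lambda>x. \<bar>u x\<bar> powr p)))"
proof -
  have [measurable]: "(\<lambda>x::'a. x) \<in> borel_measurable lebesgue" by (simp add: measurable_completion)
  have "D_fun b p \<alpha> \<mu> u \<phi> = (LINT y|lebesgue. LINT x|lebesgue. weighted b \<alpha> (\<lambda>x. \<bar>u x\<bar> powr p) y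
      * (weighted b \<alpha> (\<lambda>x. \<bar>u x\<bar> powr (p - 1) * \<phi> x) x * (1 / norm (x - y) powr \<mu>)))"
    unfolding D_fun_def
  proof (rule Bochner_Integration.integral_cong[OF refl], rule integral_cong_AE)
    fix y
    show "AE x in lebesgue. b y * \<bar>u y\<bar> powr p * (b x * \<bar>u x\<bar> powr (p - 2) * u x * \<phi> x) /
           (norm x powr \<alpha> * norm (x - y) powr \<mu> * norm y powr \<alpha>) =
        weighted b \<alpha> (\<lambda>x. \<bar>u x\<bar> powr p) y
      * (weighted b \<alpha> (\<lambda>x. \<bar>u x\<bar> powr (p - 1) * \<phi> x) x * (1 / norm (x - y) powr \<mu>))"
      using u
    proof eventually_elim
      case (elim x)
      then have "\<bar>u x\<bar> powr (p - 2) * u x = \<bar>u x\<bar> powr (p - 1)"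
        using powr_mult_base[of "u x" "p - 2"] by (simp add: mult.commute)
      then have eq: "b x * \<bar>u x\<bar> powr (p - 2) * u x * \<phi> x = b x * (\<bar>u x\<bar> powr (p - 1) * \<phi> x)"
        by (simp add: mult.assoc)
      show ?case unfolding eq by (simp add: weighted_def mult_ac)
    qed
  qed (unfold weighted_def, measurable)
  also have "\<dots> = enn2real (energy \<mu> (src (\<lambda>x. \<bar>u x\<bar> powr (p - 1) * \<phi> x)) (src (\<lambda>x. \<bar>u x\<bar> powr p)))"
    unfolding src_def[abs_def] using fin b_pos \<phi>
    by (intro double_integral_eq_energy) (auto simp: src_def[abs_def] intro!: weighted_nonneg)
  finally show ?thesis .
qed

lemma R_n_scale:
  assumes "u \<in> X_space V" "0 < t"
  shows "R_n V a b q p \<alpha> \<mu> (\<lambda>x. t * u x) = (t\<^sup>2 * nrm u - t powr (2 * p) * B u) / (t powr q * A u)"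
  unfolding R_n_def X_norm_power2(1)[OF V_pos]
  using X_inner_scale[OF V_meas V_pos assms(1), of t] A_fun_scale[OF assms(2), of a q u]
    B_fun_scale[OF assms(2), of b p \<alpha> \<mu> u] by simp

lemma R_n_scale':
  assumes "u \<in> X_space V" "0 < t"
  shows "R_n V a b q p \<alpha> \<mu> (\<lambda>x. t * u x) = (t powr (2 - q) * nrm u - t powr (2 * p - q) * B u) / A u"
proof -
  have "t\<^sup>2 = t powr q * t powr (2 - q)" "t powr (2 * p) = t powr q * t powr (2 * p - q)"
    using assms(2) by (simp_all add: powr_add[symmetric] powr_numeral)
  then have "t\<^sup>2 * nrm u - t powr (2 * p) * B u = t powr q * (t powr (2 - q) * nrm u - t powr (2 * p - q) * B u)"
    by (simp add: algebra_simps)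
  then show ?thesis unfolding R_n_scale[OF assms] using assms(2) by simp
qed

abbreviation "fibre_max u \<equiv> (GREATEST r. r \<in> (\<lambda>t. R_n V a b q p \<alpha> \<mu> (\<lambda>x. t * u x)) ` {0<..})"

lemma fibre_max_eq:
  assumes u: "u \<in> X_space V" and pos: "0 < nrm u" "0 < A u" "0 < B u"
  defines "t0 \<equiv> ((2 - q) * nrm u / ((2 * p - q) * B u)) powr (1 / (2 * p - 2))"
  shows "fibre_max u = (t0 powr (2 - q) * nrm u - t0 powr (2 * p - q) * B u) / A u"
proof (rule Greatest_equality)
  have "0 < (2 - q) * nrm u / ((2 * p - q) * B u)" using pos q p by simp
  then have t0: "0 < t0" unfolding t0_def powr_gt_zero by (metis less_irrefl)
  show "(t0 powr (2 - q) * nrm u - t0 powr (2 * p - q) * B u) / A u \<in> (\<lambda>t. R_n V a b q p \<alpha> \<mu> (\<lambda>x. t * u x)) ` {0<..}"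
    using t0 R_n_scale'[OF u t0] by (intro image_eqI[of _ _ t0]) auto
  fix r
  assume "r \<in> (\<lambda>t. R_n V a b q p \<alpha> \<mu> (\<lambda>x. t * u x)) ` {0<..}"
  then obtain t where t: "0 < t" "r = (t powr (2 - q) * nrm u - t powr (2 * p - q) * B u) / A u"
    using R_n_scale'[OF u] by auto
  show "r \<le> (t0 powr (2 - q) * nrm u - t0 powr (2 * p - q) * B u) / A u"
    unfolding t(2) t0_def using fibre_quotient_max[OF pos(1,3) q p t(1)] pos(2) by (intro divide_right_mono) auto
qed

text \<open>
A fibre map that attains its supremum has a nonnegative maximum, since it tends to \<open>0\<close> at \<open>t = 0\<close>. If
the supremum is not attained, \<^const>\<open>Greatest\<close> denotes an unspecified real number, but the same one for
every such \<open>u\<close>. In either case the value is at least the smaller of \<open>0\<close> and that number, which makes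
the infimum in the definition of \<open>\<lambda>\<^sup>*\<close> a lower bound.
\<close>

lemma fibre_max_bdd_below: "bdd_below (fibre_max ` X_plus V)"
proof -
  have cases: "fibre_max u = The (\<lambda>r::real. False) \<or> 0 \<le> fibre_max u" if u: "u \<in> X_plus V" for u
  proof (cases "\<exists>m. m \<in> (\<lambda>t. R_n V a b q p \<alpha> \<mu> (\<lambda>x. t * u x)) ` {0<..}
      \<and> (\<forall>r. r \<in> (\<lambda>t. R_n V a b q p \<alpha> \<mu> (\<lambda>x. t * u x)) ` {0<..} \<longrightarrow> r \<le> m)")
    case True
    then obtain m where m: "m \<in> (\<lambda>t. R_n V a b q p \<alpha> \<mu> (\<lambda>x. t * u x)) ` {0<..}"
      "\<And>r. r \<in> (\<lambda>t. R_n V a b q p \<alpha> \<mu> (\<lambda>x. t * u x)) ` {0<..} \<Longrightarrow> r \<le> m" by blast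
    have eq: "fibre_max u = m" by (rule Greatest_equality) (use m in auto)
    have uX: "u \<in> X_space V" using u by (simp add: X_plus_def)
    have "((\<lambda>t. (t powr (2 - q) * nrm u - t powr (2 * p - q) * B u) / A u) \<longlongrightarrow> (0 * nrm u - 0 * B u) / A u) (at_right 0)"
      unfolding divide_inverse
    proof (intro tendsto_intros)
      have "((\<lambda>t::real. t) \<longlongrightarrow> 0) (at_right 0)" by (rule tendsto_ident_at)
      then show "((\<lambda>t::real. t powr (2 - q)) \<longlongrightarrow> 0) (at_right 0)" "((\<lambda>t::real. t powr (2 * p - q)) \<longlongrightarrow> 0) (at_right 0)"
        using q p by (auto intro!: tendsto_zero_powrI[OF _ tendsto_const] simp: eventually_at_filter)
    qed
    moreover have "\<forall>\<^sub>F t in at_right 0. (t powr (2 - q) * nrm u - t powr (2 * p - q) * B u) / A u \<le> m"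
      unfolding eventually_at_filter
    proof (intro always_eventually allI impI)
      fix t :: real
      assume "t \<in> {0<..}"
      then have "R_n V a b q p \<alpha> \<mu> (\<lambda>x. t * u x) \<le> m" by (intro m(2) imageI)
      then show "(t powr (2 - q) * nrm u - t powr (2 * p - q) * B u) / A u \<le> m"
        using R_n_scale'[OF uX, of t] \<open>t \<in> {0<..}\<close> by auto
    qed
    ultimately have "0 \<le> m" using tendsto_upperbound[of _ 0 "at_right (0::real)"] by simp
    with eq show ?thesis by simp
  next
    case False
    then have "(\<lambda>m. m \<in> (\<lambda>t. R_n V a b q p \<alpha> \<mu> (\<lambda>x. t * u x)) ` {0<..}
      \<and> (\<forall>r. r \<in> (\<lambda>t. R_n V a b q p \<alpha> \<mu> (\<lambda>x. t * u x)) ` {0<..} \<longrightarrow> r \<le> m)) = (\<lambda>r. False)"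
      by (intro ext, unfold eq_False) (erule contrapos_nn, erule exI)
    then have "fibre_max u = The (\<lambda>r::real. False)" unfolding Greatest_def by (rule arg_cong[where f = The])
    then show ?thesis by (rule disjI1)
  qed
  show ?thesis
  proof (rule bdd_belowI2[of _ "min 0 (The (\<lambda>r::real. False))"])
    show "min 0 (The (\<lambda>r::real. False)) \<le> fibre_max u" if "u \<in> X_plus V" for u
      using cases[OF that] by (elim disjE) (simp_all only: min.cobounded2 min.coboundedI1)
  qed
qed

lemma lambda_star_le:
  assumes "u \<in> X_plus V" and pos: "0 < A u" "0 < B u"
  defines "t0 \<equiv> ((2 - q) * nrm u / ((2 * p - q) * B u)) powr (1 / (2 * p - 2))"
  shows "lambda_star V a b q p \<alpha> \<mu> * A u \<le> t0 powr (2 - q) * nrm u - t0 powr (2 * p - q) * B u"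
proof -
  have u: "u \<in> X_space V" "\<not> (AE x in lebesgue. u x = 0)" using assms by (auto simp: X_plus_def)
  have "lambda_star V a b q p \<alpha> \<mu> \<le> fibre_max u"
    unfolding lambda_star_def by (rule cINF_lower[OF fibre_max_bdd_below assms(1)])
  also have "\<dots> = (t0 powr (2 - q) * nrm u - t0 powr (2 * p - q) * B u) / A u"
    unfolding t0_def by (rule fibre_max_eq[OF u(1) X_inner_pos[OF V_meas V_pos u] pos])
  finally show ?thesis using pos(1) by (simp add: field_simps)
qed

text \<open>
The two fibre derivatives at \<open>1\<close>. The second identity says that the quotient \<open>R\<^sub>n(t u)\<close> is stationary at
\<open>t = 1\<close>, the first that its value there is the parameter.
\<close>

lemma N0_identities:
  assumes "u \<in> N0 V a b q p \<alpha> \<mu> lam"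
  shows "nrm u = lam * A u + B u" "(2 - q) * nrm u = (2 * p - q) * B u"
proof -
  have u: "u \<in> X_space V" using assms by (simp add: N0_def X_plus_def)
  have F: "fibering V a b q p \<alpha> \<mu> lam u t = (nrm u / 2) * t\<^sup>2 + (- lam / q * A u) * t powr q
      + (- B u / (2 * p)) * t powr (2 * p)" if "0 < t" for t
    unfolding fibering_def J_fun_def X_norm_power2(1)[OF V_pos]
    using X_inner_scale[OF V_meas V_pos u, of t] A_fun_scale[OF that, of a q u]
      B_fun_scale[OF that, of b p \<alpha> \<mu> u] by (simp add: mult_ac)
  note d = deriv_powr_sum[OF F]
  have d1: "nrm u - lam * A u - B u = 0" using d(1) assms q p by (simp add: N0_def)
  then show "nrm u = lam * A u + B u" by simp
  have d2: "nrm u - (q - 1) * (lam * A u) - (2 * p - 1) * B u = 0"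
  proof -
    have "2 * (nrm u / 2) + q * (q - 1) * (- lam / q * A u) + 2 * p * (2 * p - 1) * (- B u / (2 * p)) = 0"
      using d(2) assms by (simp only: N0_def mem_Collect_eq)
    moreover have "q * (q - 1) * (- lam / q * A u) = - ((q - 1) * (lam * A u))"
      "2 * p * (2 * p - 1) * (- B u / (2 * p)) = - ((2 * p - 1) * B u)"
      using q p by simp_all
    ultimately show ?thesis by simp
  qed
  have "lam * A u = nrm u - B u" using d1 by simp
  with d2 show "(2 - q) * nrm u = (2 * p - q) * B u" by (simp add: algebra_simps)
qed

end

section \<open>First variation at a degenerate solution\<close>

lemma energy_finite_of_le_sum:
  fixes f g h :: "'a::euclidean_space \<Rightarrow> ennreal"
  assumes \<mu>: "0 < \<mu>"
    and f[measurable]: "f \<in> borel_measurable lebesgue" and g[measurable]: "g \<in> borel_measurable lebesgue"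
    and fin: "energy \<mu> f f < \<infinity>" "energy \<mu> g g < \<infinity>" and c: "c < \<infinity>"
    and le: "AE x in lebesgue. h x \<le> c * f x + c * g x"
  shows "energy \<mu> h h < \<infinity>"
proof -
  have scale: "energy \<mu> k (\<lambda>x. c * l x) = c * energy \<mu> k l"
    if [measurable]: "k \<in> borel_measurable lebesgue" "l \<in> borel_measurable lebesgue" for k l :: "'a \<Rightarrow> ennreal"
    unfolding energy_def by (simp add: nn_integral_cmult mult.assoc)
  let ?F = "\<lambda>x. c * f x + c * g x"
  have [measurable]: "?F \<in> borel_measurable lebesgue" "(\<lambda>x. c * f x) \<in> borel_measurable lebesgue"
    by measurable
  have expand: "energy \<mu> ?F k = c * energy \<mu> f k + c * energy \<mu> g k"
    if k[measurable]: "k \<in> borel_measurable lebesgue" for k :: "'a \<Rightarrow> ennreal"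
  proof -
    have "energy \<mu> ?F k = energy \<mu> (\<lambda>x. c * f x) k + c * energy \<mu> g k"
      by (rule energy_add_scaled_left) measurable
    also have "energy \<mu> (\<lambda>x. c * f x) k = energy \<mu> k (\<lambda>x. c * f x)" by (rule energy_commute) measurable
    also have "\<dots> = c * energy \<mu> f k" unfolding scale[OF k f] by (simp add: energy_commute[OF k f])
    finally show ?thesis .
  qed
  have fg: "energy \<mu> f g < \<infinity>" "energy \<mu> g f < \<infinity>"
    using mixed_energy_finite[OF \<mu> f g fin] mixed_energy_finite[OF \<mu> g f fin(2,1)] by auto
  have "energy \<mu> f ?F < \<infinity>" "energy \<mu> g ?F < \<infinity>"
    using energy_commute[of f ?F \<mu>] energy_commute[of g ?F \<mu>] expand[OF f] expand[OF g] fg fin c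
    by (simp_all add: ennreal_mult_less_top)
  then have "energy \<mu> ?F ?F < \<infinity>" using c by (simp add: expand ennreal_mult_less_top)
  moreover have "energy \<mu> h h \<le> energy \<mu> ?F ?F" by (rule energy_mono_AE[OF le le])
  ultimately show ?thesis by (rule le_less_trans[rotated])
qed

context choquard_problem
begin

text \<open>
Such a source is bounded with compact support, so every exponent \<open>\<sigma>\<close> is available. The bound on \<open>b\<close>
holds only almost everywhere, hence the truncation.
\<close>

lemma energy_finite_if_bounded_support:
  assumes w[measurable]: "w \<in> borel_measurable lebesgue" and w_nn: "\<And>x. 0 \<le> w x" and w_le: "\<And>x. w x \<le> W"
    and K: "compact K" "\<And>x. x \<notin> K \<Longrightarrow> w x = 0"
    and \<delta>: "0 < \<delta>" "\<And>x. norm x \<le> \<delta> \<Longrightarrow> w x = 0"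
  shows "energy \<mu> (src w) (src w) < \<infinity>"
proof -
  obtain C where C: "AE x in lebesgue. \<bar>b x\<bar> \<le> C" using b_bounded by blast
  define C' where "C' = max C 0"
  define g where "g = weighted (\<lambda>x. min (b x) C') \<alpha> w"
  have g_meas[measurable]: "g \<in> borel_measurable lebesgue" unfolding g_def by measurable
  have ae: "AE x in lebesgue. src w x = ennreal (g x)"
    using C
  proof eventually_elim
    case (elim x)
    then have "min (b x) C' = b x" by (auto simp: C'_def)
    then show ?case by (simp add: src_def g_def weighted_def)
  qed
  have W: "0 \<le> W" using w_nn w_le order_trans by blast
  define M where "M = C' * W / \<delta> powr \<alpha>"
  have M: "0 \<le> M" using W by (simp add: M_def C'_def)
  have g_nn: "0 \<le> g x" for x
    using b_pos[of x] w_nn[of x] by (simp add: g_def weighted_def C'_def)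
  have g_le: "g x \<le> M" for x
  proof (cases "norm x \<le> \<delta>")
    case True
    then show ?thesis using \<delta>(2) M by (simp add: g_def weighted_def)
  next
    case False
    then have "\<delta> powr \<alpha> \<le> norm x powr \<alpha>" using \<delta> \<alpha> by (intro powr_mono2) auto
    moreover have "min (b x) C' * w x \<le> C' * W"
      using b_pos[of x] w_nn[of x] w_le[of x] by (intro mult_mono) (auto simp: C'_def)
    moreover have "0 \<le> C' * W" using W by (simp add: C'_def)
    ultimately show ?thesis unfolding g_def weighted_def M_def using \<delta>(1)
      by (intro frac_le) auto
  qed
  define \<sigma> where "\<sigma> = 1 / (1 - \<mu> / (4 * real DIM('a)))"
  have frac: "0 < \<mu> / (4 * real DIM('a))" "\<mu> / (4 * real DIM('a)) < 1" using \<mu> \<mu>_less by (auto simp: field_simps)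
  have \<sigma>: "1 < \<sigma>" using frac by (simp add: \<sigma>_def field_simps)
  have \<sigma>': "1 - \<mu> / (2 * real DIM('a)) < 1 / \<sigma>" using \<mu> by (simp add: \<sigma>_def field_simps)
  have "(\<integral>\<^sup>+x. ennreal (g x powr \<sigma>) \<partial>lebesgue) \<le> (\<integral>\<^sup>+x. ennreal (M powr \<sigma>) * indicator K x \<partial>lebesgue)"
  proof (rule nn_integral_mono)
    fix x
    show "ennreal (g x powr \<sigma>) \<le> ennreal (M powr \<sigma>) * indicator K x"
    proof (cases "x \<in> K")
      case True
      then show ?thesis using g_nn g_le \<sigma> by (auto intro!: ennreal_leI powr_mono2)
    qed (use K(2) in \<open>simp add: g_def weighted_def\<close>)
  qed
  also have "\<dots> = ennreal (M powr \<sigma>) * emeasure lebesgue K"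
    using K(1) by (intro nn_integral_cmult_indicator) (auto simp: compact_imp_closed)
  also have "\<dots> < \<infinity>"
    using emeasure_compact_finite[OF K(1)] K(1) by (simp add: ennreal_mult_less_top compact_imp_closed)
  finally have "energy \<mu> (\<lambda>x. ennreal (g x)) (\<lambda>x. ennreal (g x)) < \<infinity>"
    using energy_finite_if_bounded_Lp[OF \<mu> \<mu>_less \<sigma> \<sigma>' g_meas g_nn g_le] by simp
  then show ?thesis using energy_cong_AE[OF ae ae] by simp
qed

end

text \<open>
The object to be refuted: a solution at the extremal parameter that lies in the degenerate part of the
Nehari set.
\<close>

locale degenerate_solution = choquard_problem +
  fixes u :: "'a \<Rightarrow> real" and lam :: real
  defines "lam \<equiv> lambda_star V a b q p \<alpha> \<mu>"
  assumes N0: "u \<in> N0 V a b q p \<alpha> \<mu> lam" and sol: "weak_solution V a b q p \<alpha> \<mu> lam u"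
begin

lemma u_X: "u \<in> X_space V" and u_pos: "AE x in lebesgue. 0 < u x" and u_nz: "\<not> (AE x in lebesgue. u x = 0)"
  using N0 sol by (auto simp: weak_solution_def N0_def X_plus_def)

lemma u_meas[measurable]: "u \<in> borel_measurable lebesgue"
  by (rule X_space_measurable[OF u_X])

lemma weak_integrable: "\<phi> \<in> X_space V \<Longrightarrow> integrable lebesgue (\<lambda>x. a x * u x powr (q - 1) * \<phi> x)"
  and weak_equation: "\<phi> \<in> X_space V \<Longrightarrow> X_inner V u \<phi> = lam * H_fun a q u \<phi> + D_fun b p \<alpha> \<mu> u \<phi>"
  using sol by (auto simp: weak_solution_def)

lemma A_integrable: "integrable lebesgue (\<lambda>x. a x * \<bar>u x\<bar> powr q)"
proof -
  have "AE x in lebesgue. a x * u x powr (q - 1) * u x = a x * \<bar>u x\<bar> powr q"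
    using u_pos
  proof eventually_elim
    case (elim x)
    then show ?case using powr_mult_base[of "u x" "q - 1"] by (simp add: mult_ac)
  qed
  then show ?thesis using weak_integrable[OF u_X] by (subst (asm) integrable_cong_AE) auto
qed

lemma nrm_pos: "0 < nrm u"
  by (rule X_inner_pos[OF V_meas V_pos u_X u_nz])

lemma B_pos: "0 < B u"
proof -
  have "0 < (2 - q) * nrm u" using nrm_pos q by simp
  then show ?thesis using N0_identities(2)[OF N0] q p by (simp add: zero_less_mult_iff)
qed

lemma A_pos: "0 < A u"
proof -
  have nn: "AE x in lebesgue. 0 \<le> a x * \<bar>u x\<bar> powr q"
    by (intro AE_I2 mult_nonneg_nonneg less_imp_le[OF a_pos]) simp
  have "A u \<noteq> 0"
  proof
    assume "A u = 0"
    then have "AE x in lebesgue. a x * \<bar>u x\<bar> powr q = 0"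
      unfolding A_fun_def using integral_nonneg_eq_0_iff_AE[OF A_integrable nn] by simp
    then have "AE x in lebesgue. u x = 0"
    proof eventually_elim
      case (elim x)
      then show ?case using a_pos[of x] by auto
    qed
    with u_nz show False by simp
  qed
  then show ?thesis using A_fun_nonneg[of a q u] a_pos by (simp add: less_le)
qed

text \<open>
The integrated form of the pointwise identity between the two nonlinear terms that is derived below.
\<close>

lemma A_B_balance: "(2 - q) * (lam * A u) = (2 * p - 2) * B u"
proof -
  have "lam * A u = nrm u - B u" using N0_identities(1)[OF N0] by simp
  then show ?thesis unfolding \<open>lam * A u = nrm u - B u\<close>
    using N0_identities(2)[OF N0] by (simp add: algebra_simps)
qed

lemma lam_pos: "0 < lam"
proof -
  have "0 < (2 - q) * (lam * A u)" unfolding A_B_balance using B_pos p by simp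
  then show ?thesis using q A_pos by (simp add: zero_less_mult_iff)
qed

abbreviation "f_u \<equiv> src (\<lambda>x. \<bar>u x\<bar> powr p)"

lemma energy_u_finite: "energy \<mu> f_u f_u < \<infinity>" and potential_u_finite: "AE y in lebesgue. potential \<mu> f_u y < \<infinity>"
  using energy_finite_if_B_nonzero[OF u_meas] B_pos by auto

text \<open>
Compare \<open>v\<^sub>\<epsilon> = u + \<epsilon> \<phi>\<close> with \<open>u\<close> in the minimisation that defines \<open>\<lambda>\<^sup>*\<close>. Let \<open>T\<^sub>\<epsilon>\<close> be the maximum point of the
fibre of \<open>v\<^sub>\<epsilon>\<close>. The value of the fibre of \<open>v\<^sub>\<epsilon>\<close> at \<open>T\<^sub>\<epsilon>\<close> is at least \<open>\<lambda>\<^sup>*\<close>, and that of \<open>u\<close> at the same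
point is at most \<open>\<lambda>\<^sup>*\<close>; subtracting bounds the increment of \<open>A\<close> by the increments of the norm and of \<open>B\<close>.
Since \<open>T\<^sub>\<epsilon>\<close> tends to \<open>1\<close>, division by \<open>\<epsilon>\<close> gives \<open>q \<lambda>\<^sup>* H \<le> 2 \<langle>u, \<phi>\<rangle> - 2 p D\<close> in the limit, and the weak
equation eliminates \<open>\<langle>u, \<phi>\<rangle>\<close>.

Only nonnegative directions are used, because \<open>u + \<epsilon> \<phi>\<close> then remains admissible. Convexity of powers
bounds the increment of \<open>B\<close> from below by \<open>2 p \<epsilon> D\<close>, which is the direction that the estimate calls for.
\<close>

lemma variational_inequality:
  assumes \<phi>: "test_function \<phi>" and nn: "\<And>x. 0 \<le> \<phi> x"
    and \<delta>: "0 < \<delta>" "\<And>x. norm x \<le> \<delta> \<Longrightarrow> \<phi> x = 0"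
  shows "energy \<mu> (src (\<lambda>x. \<bar>u x\<bar> powr (p - 1) * \<phi> x)) f_u < \<infinity>"
    and "(2 * p - 2) * enn2real (energy \<mu> (src (\<lambda>x. \<bar>u x\<bar> powr (p - 1) * \<phi> x)) f_u)
      \<le> (2 - q) * lam * H_fun a q u \<phi>"
proof -
  obtain K C where K: "compact K" "0 \<le> C" "\<And>x. x \<notin> K \<Longrightarrow> \<phi> x = 0" "\<And>x. \<bar>\<phi> x\<bar> \<le> C"
    by (rule test_function_support[OF \<phi>]) blast
  have \<phi>_meas[measurable]: "\<phi> \<in> borel_measurable lebesgue" by (rule test_function_measurable[OF \<phi>])
  have \<phi>_X: "\<phi> \<in> X_space V" by (rule test_function_in_X_space[OF \<phi> V_cont])
  let ?h = "src (\<lambda>x. \<bar>u x\<bar> powr (p - 1) * \<phi> x)"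
  define v where "v \<epsilon> x = u x + \<epsilon> * \<phi> x" for \<epsilon> x
  define f where "f \<epsilon> = src (\<lambda>x. \<bar>v \<epsilon> x\<bar> powr p)" for \<epsilon>
  have v_meas[measurable]: "v \<epsilon> \<in> borel_measurable lebesgue" for \<epsilon> unfolding v_def[abs_def] by measurable
  have f_meas[measurable]: "f \<epsilon> \<in> borel_measurable lebesgue" for \<epsilon> unfolding f_def by measurable
  have h_meas[measurable]: "?h \<in> borel_measurable lebesgue" by measurable
  have fu_meas[measurable]: "f_u \<in> borel_measurable lebesgue" by measurable
  have v_X: "v \<epsilon> \<in> X_space V" for \<epsilon>
    unfolding v_def[abs_def] by (rule X_space_add_scaled(1)[OF V_meas V_pos u_X \<phi>_X])
  have v_nrm: "nrm (v \<epsilon>) = nrm u + 2 * \<epsilon> * X_inner V u \<phi> + \<epsilon>\<^sup>2 * nrm \<phi>" for \<epsilon>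
    unfolding v_def[abs_def] by (rule X_space_add_scaled(2)[OF V_meas V_pos u_X \<phi>_X])
  have v_ge: "AE x in lebesgue. 0 < u x \<and> u x \<le> v \<epsilon> x" if "0 \<le> \<epsilon>" for \<epsilon>
    using u_pos by eventually_elim (use that nn in \<open>simp add: v_def\<close>)
  have v_Xp: "v \<epsilon> \<in> X_plus V" if "0 \<le> \<epsilon>" for \<epsilon>
  proof -
    have "AE x in lebesgue. 0 \<le> v \<epsilon> x" using v_ge[OF that] by eventually_elim linarith
    moreover have "\<not> (AE x in lebesgue. v \<epsilon> x = 0)"
    proof
      assume "AE x in lebesgue. v \<epsilon> x = 0"
      then have "AE x in lebesgue. u x = 0" using v_ge[OF that] by eventually_elim linarith
      with u_nz show False by simp
    qed
    ultimately show ?thesis using v_X by (simp add: X_plus_def)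
  qed

  \<comment> \<open>All energies are dominated by that of \<open>f 1\<close>, which is finite by mixing \<open>f_u\<close> with a source of bounded support.\<close>
  have src_mono: "src w x \<le> src w' x" if "w x \<le> w' x" for w w' x
    unfolding src_def using that b_pos by (intro ennreal_leI weighted_mono) auto
  have g_fin: "energy \<mu> (src (\<lambda>x. \<bar>\<phi> x\<bar> powr p)) (src (\<lambda>x. \<bar>\<phi> x\<bar> powr p)) < \<infinity>"
    by (rule energy_finite_if_bounded_support[where W = "C powr p" and K = K and \<delta> = \<delta>])
      (use K \<delta> p in \<open>auto intro!: powr_mono2\<close>)
  have src_add: "src (\<lambda>x. c * w x + d * w' x) x = ennreal c * src w x + ennreal d * src w' x"
    if "0 \<le> c" "0 \<le> d" "0 \<le> w x" "0 \<le> w' x" for c d w w' x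
  proof -
    have "weighted b \<alpha> (\<lambda>x. c * w x + d * w' x) x = c * weighted b \<alpha> w x + d * weighted b \<alpha> w' x"
      by (simp add: weighted_def field_simps add_divide_distrib)
    moreover have "0 \<le> weighted b \<alpha> w x" "0 \<le> weighted b \<alpha> w' x"
      using that b_pos by (auto intro: weighted_nonneg)
    ultimately show ?thesis unfolding src_def
      using that by (simp add: ennreal_plus ennreal_mult)
  qed
  have E11: "energy \<mu> (f 1) (f 1) < \<infinity>"
  proof (rule energy_finite_of_le_sum[OF \<mu> fu_meas _ energy_u_finite g_fin])
    show "AE x in lebesgue. f 1 x \<le> ennreal (2 powr p) * f_u x + ennreal (2 powr p) * src (\<lambda>x. \<bar>\<phi> x\<bar> powr p) x"
      using u_pos
    proof eventually_elim
      case (elim x)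
      have "\<bar>v 1 x\<bar> powr p \<le> (2 * max (u x) (\<phi> x)) powr p"
        using elim nn[of x] p by (intro powr_mono2) (auto simp: v_def)
      also have "\<dots> = 2 powr p * (max (u x) (\<phi> x)) powr p" using elim by (simp add: powr_mult)
      also have "\<dots> \<le> 2 powr p * \<bar>u x\<bar> powr p + 2 powr p * \<bar>\<phi> x\<bar> powr p"
        using elim nn[of x] by (simp add: max_def)
      finally have "f 1 x \<le> src (\<lambda>x. 2 powr p * \<bar>u x\<bar> powr p + 2 powr p * \<bar>\<phi> x\<bar> powr p) x"
        unfolding f_def by (rule src_mono)
      then show ?case by (simp add: src_add)
    qed
  qed auto
  have fu_le: "AE x in lebesgue. f_u x \<le> f \<epsilon> x" if "0 \<le> \<epsilon>" for \<epsilon>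
    using v_ge[OF that]
    by eventually_elim (use p in \<open>auto simp: f_def intro!: src_mono powr_mono2\<close>)
  have f_le: "AE x in lebesgue. f \<epsilon> x \<le> f 1 x" if "0 \<le> \<epsilon>" "\<epsilon> \<le> 1" for \<epsilon>
    using v_ge[OF that(1)]
  proof eventually_elim
    case (elim x)
    have "v \<epsilon> x \<le> v 1 x" using that nn[of x] by (simp add: v_def mult_left_le_one_le)
    then show ?case using elim p by (auto simp: f_def intro!: src_mono powr_mono2)
  qed
  have tangent: "AE x in lebesgue. f_u x + ennreal (p * \<epsilon>) * ?h x \<le> f \<epsilon> x" if "0 \<le> \<epsilon>" for \<epsilon>
    using v_ge[OF that]
  proof eventually_elim
    case (elim x)
    have "1 * \<bar>u x\<bar> powr p + (p * \<epsilon>) * (\<bar>u x\<bar> powr (p - 1) * \<phi> x) \<le> \<bar>v \<epsilon> x\<bar> powr p"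
      using powr_add_ge_tangent[of "u x" "\<epsilon> * \<phi> x" p] elim nn[of x] that p by (simp add: v_def mult_ac)
    then have "src (\<lambda>x. 1 * \<bar>u x\<bar> powr p + (p * \<epsilon>) * (\<bar>u x\<bar> powr (p - 1) * \<phi> x)) x \<le> f \<epsilon> x"
      unfolding f_def by (rule src_mono)
    then show ?case using that p nn[of x] by (subst (asm) src_add) auto
  qed
  have chord: "AE x in lebesgue. f \<epsilon> x \<le> f_u x + ennreal \<epsilon> * f 1 x" if "0 \<le> \<epsilon>" "\<epsilon> \<le> 1" for \<epsilon>
    using v_ge[OF that(1)]
  proof eventually_elim
    case (elim x)
    have "\<bar>v \<epsilon> x\<bar> powr p \<le> 1 * \<bar>u x\<bar> powr p + \<epsilon> * \<bar>v 1 x\<bar> powr p"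
      using powr_segment_le[of "u x" "\<phi> x" \<epsilon> p] elim nn[of x] that p by (simp add: v_def)
    then have "f \<epsilon> x \<le> src (\<lambda>x. 1 * \<bar>u x\<bar> powr p + \<epsilon> * \<bar>v 1 x\<bar> powr p) x"
      unfolding f_def by (rule src_mono)
    then show ?case unfolding f_def using that by (subst (asm) src_add) auto
  qed
  have h_le: "AE x in lebesgue. ?h x \<le> f 1 x"
    using tangent[of 1, simplified]
  proof eventually_elim
    case (elim x)
    have "?h x \<le> ennreal p * ?h x" using p mult_right_mono[of 1 "ennreal p" "?h x"] by simp
    also have "\<dots> \<le> f_u x + ennreal p * ?h x" by (simp add: add_increasing)
    finally show ?case using elim by simp
  qed
  have "energy \<mu> ?h f_u \<le> energy \<mu> (f 1) (f 1)"
    by (rule energy_mono_AE[OF h_le fu_le]) simp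
  then show h_fin: "energy \<mu> ?h f_u < \<infinity>" using E11 by (rule le_less_trans)
  define D where "D = enn2real (energy \<mu> ?h f_u)"
  have D: "energy \<mu> ?h f_u = ennreal D" "0 \<le> D" using h_fin by (auto simp: D_def)
  define B1 where "B1 = enn2real (energy \<mu> (f 1) (f 1))"
  have B1: "energy \<mu> (f 1) (f 1) = ennreal B1" "0 \<le> B1" using E11 by (auto simp: B1_def)
  have Bu: "energy \<mu> f_u f_u = ennreal (B u)"
    using B_eq_energy[OF u_meas energy_u_finite] energy_u_finite by simp
  have Bv: "energy \<mu> (f \<epsilon>) (f \<epsilon>) = ennreal (B (v \<epsilon>))" if "0 \<le> \<epsilon>" "\<epsilon> \<le> 1" for \<epsilon>
  proof -
    have "energy \<mu> (f \<epsilon>) (f \<epsilon>) \<le> energy \<mu> (f 1) (f 1)" by (rule energy_mono_AE[OF f_le[OF that] f_le[OF that]])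
    then have fin: "energy \<mu> (f \<epsilon>) (f \<epsilon>) < \<infinity>" using E11 by (rule le_less_trans)
    then show ?thesis using B_eq_energy[OF v_meas fin[unfolded f_def]] by (simp add: f_def)
  qed
  have B_lower: "B u + 2 * p * \<epsilon> * D \<le> B (v \<epsilon>)" if "0 \<le> \<epsilon>" "\<epsilon> \<le> 1" for \<epsilon>
  proof -
    let ?g = "\<lambda>x. f_u x + ennreal (p * \<epsilon>) * ?h x"
    have left: "energy \<mu> ?g f_u = energy \<mu> f_u f_u + ennreal (p * \<epsilon>) * energy \<mu> ?h f_u"
      by (rule energy_add_scaled_left) measurable
    have right: "energy \<mu> ?g ?g = energy \<mu> ?g f_u + ennreal (p * \<epsilon>) * energy \<mu> ?g ?h"
      by (rule energy_add_scaled_right) measurable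
    have "energy \<mu> ?h f_u = energy \<mu> f_u ?h" by (rule energy_commute[OF h_meas fu_meas])
    also have "\<dots> \<le> energy \<mu> ?g ?h" by (intro energy_mono_AE) auto
    finally have cross: "energy \<mu> ?h f_u \<le> energy \<mu> ?g ?h" .
    have "energy \<mu> f_u f_u + ennreal (p * \<epsilon>) * energy \<mu> ?h f_u + ennreal (p * \<epsilon>) * energy \<mu> ?h f_u
        \<le> energy \<mu> f_u f_u + ennreal (p * \<epsilon>) * energy \<mu> ?h f_u + ennreal (p * \<epsilon>) * energy \<mu> ?g ?h"
      by (intro add_left_mono mult_left_mono cross) simp
    also have "\<dots> = energy \<mu> ?g ?g" by (simp only: left right)
    also have "\<dots> \<le> energy \<mu> (f \<epsilon>) (f \<epsilon>)"
      using tangent[OF that(1)] by (intro energy_mono_AE)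
    finally have "energy \<mu> f_u f_u + ennreal (p * \<epsilon>) * energy \<mu> ?h f_u + ennreal (p * \<epsilon>) * energy \<mu> ?h f_u
        \<le> energy \<mu> (f \<epsilon>) (f \<epsilon>)" .
    moreover have "ennreal (p * \<epsilon>) * ennreal D = ennreal (p * \<epsilon> * D)"
      using that p D(2) by (subst ennreal_mult) auto
    moreover have "ennreal (r + s + s) = ennreal r + ennreal s + ennreal s" if "0 \<le> r" "0 \<le> s" for r s
      using that by (metis ennreal_plus add_nonneg_nonneg)
    moreover have "0 \<le> B u" "0 \<le> p * \<epsilon> * D" using that p D(2) B_pos by auto
    ultimately have "ennreal (B u + p * \<epsilon> * D + p * \<epsilon> * D) \<le> ennreal (B (v \<epsilon>))"
      unfolding Bv[OF that] Bu D(1) by metis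
    then have "B u + p * \<epsilon> * D + p * \<epsilon> * D \<le> B (v \<epsilon>)"
      using B_fun_nonneg[of b p \<alpha> \<mu> "v \<epsilon>"] b_pos by (subst (asm) ennreal_le_iff) auto
    then show ?thesis by (simp add: mult_ac)
  qed
  have B_upper: "B (v \<epsilon>) \<le> B u + 3 * \<epsilon> * B1" if "0 \<le> \<epsilon>" "\<epsilon> \<le> 1" for \<epsilon>
  proof -
    let ?g = "\<lambda>x. f_u x + ennreal \<epsilon> * f 1 x"
    have "energy \<mu> (f \<epsilon>) (f \<epsilon>) \<le> energy \<mu> ?g ?g" using chord[OF that] by (intro energy_mono_AE)
    also have "\<dots> = energy \<mu> ?g f_u + ennreal \<epsilon> * energy \<mu> ?g (f 1)"
      by (rule energy_add_scaled_right) measurable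
    also have "energy \<mu> ?g f_u = energy \<mu> f_u f_u + ennreal \<epsilon> * energy \<mu> (f 1) f_u"
      by (rule energy_add_scaled_left) measurable
    also have "energy \<mu> ?g (f 1) = energy \<mu> f_u (f 1) + ennreal \<epsilon> * energy \<mu> (f 1) (f 1)"
      by (rule energy_add_scaled_left) measurable
    also have "energy \<mu> f_u f_u + ennreal \<epsilon> * energy \<mu> (f 1) f_u
          + ennreal \<epsilon> * (energy \<mu> f_u (f 1) + ennreal \<epsilon> * energy \<mu> (f 1) (f 1))
        \<le> ennreal (B u) + ennreal \<epsilon> * ennreal B1 + ennreal \<epsilon> * (ennreal B1 + ennreal \<epsilon> * ennreal B1)"
    proof -
      have "energy \<mu> (f 1) f_u \<le> ennreal B1" "energy \<mu> f_u (f 1) \<le> ennreal B1"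
        unfolding B1(1)[symmetric] using fu_le[of 1] by (auto intro!: energy_mono_AE)
      then show ?thesis unfolding Bu B1(1) by (intro add_mono mult_left_mono) auto
    qed
    also have "\<dots> = ennreal (B u + \<epsilon> * B1 + \<epsilon> * (B1 + \<epsilon> * B1))"
      using that B1(2) B_pos
      by (simp add: ennreal_mult[symmetric] ennreal_plus[symmetric] del: ennreal_plus)
    finally have "ennreal (B (v \<epsilon>)) \<le> ennreal (B u + \<epsilon> * B1 + \<epsilon> * (B1 + \<epsilon> * B1))"
      unfolding Bv[OF that] .
    then have "B (v \<epsilon>) \<le> B u + \<epsilon> * B1 + \<epsilon> * (B1 + \<epsilon> * B1)"
      using that B1(2) B_pos by (subst (asm) ennreal_le_iff) auto
    also have "\<dots> \<le> B u + \<epsilon> * B1 + \<epsilon> * (B1 + 1 * B1)"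
      using that B1(2) by (intro add_left_mono mult_left_mono mult_right_mono) auto
    finally show ?thesis by (simp add: algebra_simps)
  qed

  \<comment> \<open>Concavity bounds the quotient of the sublinear term by its limit, whose integrability is part of being a weak solution.\<close>
  have H_int: "integrable lebesgue (\<lambda>x. a x * u x powr (q - 1) * \<phi> x)" by (rule weak_integrable[OF \<phi>_X])
  have A_quot: "AE x in lebesgue. 0 \<le> a x * \<bar>v \<epsilon> x\<bar> powr q - a x * \<bar>u x\<bar> powr q \<and>
      a x * \<bar>v \<epsilon> x\<bar> powr q - a x * \<bar>u x\<bar> powr q \<le> \<epsilon> * (q * (a x * u x powr (q - 1) * \<phi> x))" if "0 \<le> \<epsilon>" for \<epsilon>
    using v_ge[OF that]
  proof eventually_elim
    case (elim x)
    have "\<bar>u x\<bar> powr q \<le> \<bar>v \<epsilon> x\<bar> powr q" using elim q by (intro powr_mono2) auto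
    then have lower: "a x * \<bar>u x\<bar> powr q \<le> a x * \<bar>v \<epsilon> x\<bar> powr q" using a_pos[of x] by simp
    have "\<bar>v \<epsilon> x\<bar> powr q \<le> \<bar>u x\<bar> powr q + q * u x powr (q - 1) * (\<epsilon> * \<phi> x)"
      using powr_add_le_tangent[of "u x" "\<epsilon> * \<phi> x" q] elim nn[of x] that q by (simp add: v_def)
    then have "a x * \<bar>v \<epsilon> x\<bar> powr q \<le> a x * (\<bar>u x\<bar> powr q + q * u x powr (q - 1) * (\<epsilon> * \<phi> x))"
      using a_pos[of x] by (intro mult_left_mono) auto
    with lower show ?case by (simp add: algebra_simps)
  qed
  have A_int: "integrable lebesgue (\<lambda>x. a x * \<bar>v \<epsilon> x\<bar> powr q)" if "0 \<le> \<epsilon>" for \<epsilon>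
  proof (rule Bochner_Integration.integrable_bound)
    show "integrable lebesgue (\<lambda>x. a x * \<bar>u x\<bar> powr q + \<epsilon> * (q * (a x * u x powr (q - 1) * \<phi> x)))"
      using A_integrable H_int by auto
    show "AE x in lebesgue. norm (a x * \<bar>v \<epsilon> x\<bar> powr q)
        \<le> norm (a x * \<bar>u x\<bar> powr q + \<epsilon> * (q * (a x * u x powr (q - 1) * \<phi> x)))"
      using A_quot[OF that]
    proof eventually_elim
      case (elim x)
      have "0 \<le> a x * \<bar>v \<epsilon> x\<bar> powr q" using a_pos[of x] by simp
      with elim show ?case by simp
    qed
  qed measurable
  define \<epsilon> where "\<epsilon> k = inverse (real (Suc k))" for k
  have \<epsilon>: "0 < \<epsilon> k" "\<epsilon> k \<le> 1" for k by (auto simp: \<epsilon>_def field_simps)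
  have \<epsilon>_lim: "\<epsilon> \<longlonglongrightarrow> 0" unfolding \<epsilon>_def by (rule LIMSEQ_inverse_real_of_nat)
  have A_lim: "(\<lambda>k. (A (v (\<epsilon> k)) - A u) / \<epsilon> k) \<longlonglongrightarrow> q * H_fun a q u \<phi>"
  proof -
    have eq: "(A (v (\<epsilon> k)) - A u) / \<epsilon> k
        = (LINT x|lebesgue. (a x * \<bar>v (\<epsilon> k) x\<bar> powr q - a x * \<bar>u x\<bar> powr q) / \<epsilon> k)" for k
      unfolding A_fun_def using A_int[of "\<epsilon> k"] A_integrable \<epsilon>(1)[of k] by (simp add: Bochner_Integration.integral_diff)
    have "(\<lambda>k. LINT x|lebesgue. (a x * \<bar>v (\<epsilon> k) x\<bar> powr q - a x * \<bar>u x\<bar> powr q) / \<epsilon> k)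
        \<longlonglongrightarrow> (LINT x|lebesgue. q * (a x * \<bar>u x\<bar> powr (q - 2) * u x * \<phi> x))"
    proof (rule integral_dominated_convergence[where w = "\<lambda>x. q * (a x * u x powr (q - 1) * \<phi> x)"])
      show "integrable lebesgue (\<lambda>x. q * (a x * u x powr (q - 1) * \<phi> x))" using H_int by simp
      show "AE x in lebesgue. norm ((a x * \<bar>v (\<epsilon> k) x\<bar> powr q - a x * \<bar>u x\<bar> powr q) / \<epsilon> k)
          \<le> q * (a x * u x powr (q - 1) * \<phi> x)" for k
        using A_quot[OF less_imp_le[OF \<epsilon>(1)], of k]
        by eventually_elim (use \<epsilon>(1)[of k] in \<open>auto simp: divide_le_eq mult.commute\<close>)
      show "AE x in lebesgue. (\<lambda>k. (a x * \<bar>v (\<epsilon> k) x\<bar> powr q - a x * \<bar>u x\<bar> powr q) / \<epsilon> k)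
          \<longlonglongrightarrow> q * (a x * \<bar>u x\<bar> powr (q - 2) * u x * \<phi> x)"
        using u_pos
      proof eventually_elim
        case (elim x)
        have "((\<lambda>t. a x * (u x + t * \<phi> x) powr q) has_real_derivative
            a x * (q * u x powr (q - 1) * \<phi> x)) (at 0)"
          using elim by (auto intro!: derivative_eq_intros)
        then have "((\<lambda>t. (a x * (u x + t * \<phi> x) powr q - a x * u x powr q) / t)
            \<longlongrightarrow> a x * (q * u x powr (q - 1) * \<phi> x)) (at 0)"
          by (simp add: DERIV_def)
        moreover have "filterlim \<epsilon> (at 0) sequentially"
          using \<epsilon>_lim \<epsilon>(1) by (auto simp: filterlim_at less_imp_neq[symmetric])
        ultimately have lim: "(\<lambda>k. (a x * (u x + \<epsilon> k * \<phi> x) powr q - a x * u x powr q) / \<epsilon> k)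
            \<longlonglongrightarrow> a x * (q * u x powr (q - 1) * \<phi> x)" by (rule filterlim_compose)
        have v_abs: "\<bar>v (\<epsilon> k) x\<bar> = u x + \<epsilon> k * \<phi> x" for k
          using elim nn[of x] \<epsilon>(1)[of k] by (simp add: v_def add_pos_nonneg)
        have "\<bar>u x\<bar> powr (q - 2) * u x = u x powr (q - 1)"
          using elim powr_mult_base[of "u x" "q - 2"] by (simp add: mult.commute)
        then have limit: "q * (a x * \<bar>u x\<bar> powr (q - 2) * u x * \<phi> x) = a x * (q * u x powr (q - 1) * \<phi> x)"
          by (simp add: mult.assoc)
        show ?case by (subst limit) (unfold v_abs abs_of_pos[OF elim], rule lim)
      qed
    qed measurable
    then show ?thesis unfolding eq H_fun_def by simp
  qed
  have A_ge: "A u \<le> A (v \<epsilon>)" if "0 \<le> \<epsilon>" for \<epsilon>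
    unfolding A_fun_def
  proof (rule integral_mono_AE[OF A_integrable A_int[OF that]])
    show "AE x in lebesgue. a x * \<bar>u x\<bar> powr q \<le> a x * \<bar>v \<epsilon> x\<bar> powr q"
      using A_quot[OF that] by eventually_elim simp
  qed

  \<comment> \<open>The maximum point of the fibre of \<open>v (\<epsilon> k)\<close>.\<close>
  define T where "T k = ((2 - q) * nrm (v (\<epsilon> k)) / ((2 * p - q) * B (v (\<epsilon> k)))) powr (1 / (2 * p - 2))" for k
  have Bv_pos: "0 < B (v (\<epsilon> k))" for k
  proof -
    have "0 \<le> 2 * p * \<epsilon> k * D" using p \<epsilon>[of k] D(2) by simp
    then show ?thesis using B_lower[of "\<epsilon> k"] \<epsilon>[of k] B_pos by linarith
  qed
  have B_lim: "(\<lambda>k. B (v (\<epsilon> k))) \<longlonglongrightarrow> B u"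
  proof (rule tendsto_sandwich)
    show "\<forall>\<^sub>F k in sequentially. B u \<le> B (v (\<epsilon> k))"
    proof (intro always_eventually allI)
      fix k
      have "0 \<le> 2 * p * \<epsilon> k * D" using p \<epsilon>[of k] D(2) by simp
      then show "B u \<le> B (v (\<epsilon> k))" using B_lower[of "\<epsilon> k"] \<epsilon>[of k] by linarith
    qed
    show "\<forall>\<^sub>F k in sequentially. B (v (\<epsilon> k)) \<le> B u + 3 * \<epsilon> k * B1"
      by (intro always_eventually allI B_upper less_imp_le[OF \<epsilon>(1)] \<epsilon>(2))
    have "(\<lambda>k. B u + 3 * \<epsilon> k * B1) \<longlonglongrightarrow> B u + 3 * 0 * B1" by (intro tendsto_intros \<epsilon>_lim)
    then show "(\<lambda>k. B u + 3 * \<epsilon> k * B1) \<longlonglongrightarrow> B u" by simp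
  qed simp
  have nrm_lim: "(\<lambda>k. nrm (v (\<epsilon> k))) \<longlonglongrightarrow> nrm u"
  proof -
    have "(\<lambda>k. nrm u + 2 * \<epsilon> k * X_inner V u \<phi> + (\<epsilon> k)\<^sup>2 * nrm \<phi>) \<longlonglongrightarrow> nrm u + 2 * 0 * X_inner V u \<phi> + 0\<^sup>2 * nrm \<phi>"
      by (intro tendsto_intros \<epsilon>_lim)
    then show ?thesis by (simp add: v_nrm)
  qed
  have T_lim: "T \<longlonglongrightarrow> 1"
  proof -
    have "(\<lambda>k. (2 - q) * nrm (v (\<epsilon> k)) / ((2 * p - q) * B (v (\<epsilon> k))))
        \<longlonglongrightarrow> (2 - q) * nrm u / ((2 * p - q) * B u)"
      using B_pos q p by (intro tendsto_intros nrm_lim B_lim) auto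
    also have "(2 - q) * nrm u / ((2 * p - q) * B u) = 1"
      using N0_identities(2)[OF N0] B_pos q p by simp
    finally have "T \<longlonglongrightarrow> 1 powr (1 / (2 * p - 2))"
      unfolding T_def[abs_def] by (intro tendsto_powr tendsto_const) auto
    then show ?thesis by simp
  qed
  have T_pos: "0 < T k" for k
  proof -
    have "0 < nrm (v (\<epsilon> k))"
      using v_Xp[of "\<epsilon> k"] \<epsilon>(1)[of k] by (intro X_inner_pos[OF V_meas V_pos]) (auto simp: X_plus_def)
    then have "0 < (2 - q) * nrm (v (\<epsilon> k)) / ((2 * p - q) * B (v (\<epsilon> k)))" using Bv_pos q p by simp
    then show ?thesis unfolding T_def powr_gt_zero by (metis less_irrefl)
  qed
  \<comment> \<open>The fibre of \<open>u\<close> has its maximum at \<open>1\<close>, where its value is \<open>lam\<close>.\<close>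
  have base: "T k powr (2 - q) * nrm u - T k powr (2 * p - q) * B u \<le> lam * A u" for k
  proof -
    have one: "(2 - q) * nrm u / ((2 * p - q) * B u) = 1"
      using N0_identities(2)[OF N0] B_pos q p by simp
    show ?thesis
      using fibre_quotient_max[OF nrm_pos B_pos q p T_pos[of k], unfolded one] N0_identities(1)[OF N0] by simp
  qed
  have step: "lam * ((A (v (\<epsilon> k)) - A u) / \<epsilon> k)
      \<le> T k powr (2 - q) * (2 * X_inner V u \<phi> + \<epsilon> k * nrm \<phi>) - T k powr (2 * p - q) * (2 * p * D)" for k
  proof -
    have "lam * A (v (\<epsilon> k)) \<le> T k powr (2 - q) * nrm (v (\<epsilon> k)) - T k powr (2 * p - q) * B (v (\<epsilon> k))"
      unfolding T_def lam_def
      using v_Xp[of "\<epsilon> k"] \<epsilon>(1)[of k] A_ge[of "\<epsilon> k"] A_pos Bv_pos[of k] by (intro lambda_star_le) auto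
    then have "lam * (A (v (\<epsilon> k)) - A u) \<le> T k powr (2 - q) * (nrm (v (\<epsilon> k)) - nrm u)
        - T k powr (2 * p - q) * (B (v (\<epsilon> k)) - B u)"
      using base[of k] by (simp add: algebra_simps)
    also have "\<dots> \<le> T k powr (2 - q) * (nrm (v (\<epsilon> k)) - nrm u) - T k powr (2 * p - q) * (2 * p * \<epsilon> k * D)"
      using B_lower[of "\<epsilon> k"] \<epsilon>[of k] by (intro diff_left_mono mult_left_mono) auto
    also have "\<dots> = \<epsilon> k * (T k powr (2 - q) * (2 * X_inner V u \<phi> + \<epsilon> k * nrm \<phi>) - T k powr (2 * p - q) * (2 * p * D))"
      unfolding v_nrm by (simp add: algebra_simps power2_eq_square)
    finally have "lam * (A (v (\<epsilon> k)) - A u) / \<epsilon> k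
        \<le> \<epsilon> k * (T k powr (2 - q) * (2 * X_inner V u \<phi> + \<epsilon> k * nrm \<phi>) - T k powr (2 * p - q) * (2 * p * D)) / \<epsilon> k"
      using \<epsilon>(1)[of k] by (intro divide_right_mono) auto
    then show ?thesis using \<epsilon>(1)[of k] by simp
  qed
  have "lam * (q * H_fun a q u \<phi>) \<le> 1 powr (2 - q) * (2 * X_inner V u \<phi> + 0 * nrm \<phi>) - 1 powr (2 * p - q) * (2 * p * D)"
  proof (rule LIMSEQ_le)
    show "(\<lambda>k. lam * ((A (v (\<epsilon> k)) - A u) / \<epsilon> k)) \<longlonglongrightarrow> lam * (q * H_fun a q u \<phi>)"
      by (intro tendsto_intros A_lim)
    show "(\<lambda>k. T k powr (2 - q) * (2 * X_inner V u \<phi> + \<epsilon> k * nrm \<phi>) - T k powr (2 * p - q) * (2 * p * D))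
        \<longlonglongrightarrow> 1 powr (2 - q) * (2 * X_inner V u \<phi> + 0 * nrm \<phi>) - 1 powr (2 * p - q) * (2 * p * D)"
      by (intro tendsto_intros T_lim \<epsilon>_lim) auto
  qed (use step in auto)
  moreover have "X_inner V u \<phi> = lam * H_fun a q u \<phi> + D"
    using weak_equation[OF \<phi>_X] D_eq_energy[OF u_meas \<phi>_meas u_pos nn h_fin] by (simp add: D_def)
  ultimately have "(2 * p - 2) * D \<le> (2 - q) * lam * H_fun a q u \<phi>" by (simp add: algebra_simps)
  then show "(2 * p - 2) * enn2real (energy \<mu> ?h f_u) \<le> (2 - q) * lam * H_fun a q u \<phi>"
    by (simp add: D_def)
qed

end

section \<open>The coefficient identity and its integrability\<close>

context degenerate_solution
begin

definition u_potential :: "'a \<Rightarrow> real" where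
  "u_potential y = enn2real (potential \<mu> f_u y)"

lemma u_potential_meas[measurable]: "u_potential \<in> borel_measurable lebesgue"
  unfolding u_potential_def[abs_def] by measurable

lemma u_potential_nonneg: "0 \<le> u_potential x"
  by (simp add: u_potential_def)

lemma energy_eq_nn_integral_potential:
  assumes [measurable]: "w \<in> borel_measurable lebesgue" and nn: "\<And>x. 0 \<le> w x"
  shows "energy \<mu> f_u (src w) = (\<integral>\<^sup>+x. ennreal (weighted b \<alpha> w x * u_potential x) \<partial>lebesgue)"
  unfolding energy_def
proof (rule nn_integral_cong_AE)
  show "AE x in lebesgue. src w x * potential \<mu> f_u x = ennreal (weighted b \<alpha> w x * u_potential x)"
    using potential_u_finite
  proof eventually_elim
    case (elim x)
    then show ?case using weighted_nonneg[where w = w and x = x, OF b_pos nn]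
      by (simp add: src_def u_potential_def ennreal_mult)
  qed
qed

lemma weighted_potential_integral:
  assumes [measurable]: "w \<in> borel_measurable lebesgue" and nn: "\<And>x. 0 \<le> w x"
    and fin: "energy \<mu> f_u (src w) < \<infinity>"
  shows "integrable lebesgue (\<lambda>x. weighted b \<alpha> w x * u_potential x)"
    and "(LINT x|lebesgue. weighted b \<alpha> w x * u_potential x) = enn2real (energy \<mu> f_u (src w))"
proof -
  have nn': "0 \<le> weighted b \<alpha> w x * u_potential x" for x
    using weighted_nonneg[where w = w and x = x, OF b_pos nn] u_potential_nonneg by simp
  show "integrable lebesgue (\<lambda>x. weighted b \<alpha> w x * u_potential x)"
    using fin unfolding energy_eq_nn_integral_potential[OF assms(1,2)]
    by (intro integrableI_nonneg) (use nn' in auto)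
  show "(LINT x|lebesgue. weighted b \<alpha> w x * u_potential x) = enn2real (energy \<mu> f_u (src w))"
    unfolding energy_eq_nn_integral_potential[OF assms(1,2)]
    by (intro integral_eq_nn_integral) (use nn' in auto)
qed

text \<open>
The density of the first variation of the fibre maximum, after the weak equation has been used: its
integral against a test function is the difference of the two sides of the variational inequality.
\<close>

definition defect :: "'a \<Rightarrow> real" where
  "defect x = (2 - q) * lam * (a x * \<bar>u x\<bar> powr (q - 1))
    - (2 * p - 2) * (weighted b \<alpha> (\<lambda>x. \<bar>u x\<bar> powr (p - 1)) x * u_potential x)"

lemma defect_meas[measurable]: "defect \<in> borel_measurable lebesgue"
  unfolding defect_def[abs_def] by measurable

lemma defect_test:
  assumes \<phi>: "test_function \<phi>" and nn: "\<And>x. 0 \<le> \<phi> x"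
    and \<delta>: "0 < \<delta>" "\<And>x. norm x \<le> \<delta> \<Longrightarrow> \<phi> x = 0"
  shows "integrable lebesgue (\<lambda>x. defect x * \<phi> x)" and "0 \<le> (LINT x|lebesgue. defect x * \<phi> x)"
proof -
  have \<phi>_meas[measurable]: "\<phi> \<in> borel_measurable lebesgue" by (rule test_function_measurable[OF \<phi>])
  have \<phi>_X: "\<phi> \<in> X_space V" by (rule test_function_in_X_space[OF \<phi> V_cont])
  let ?w = "\<lambda>x. \<bar>u x\<bar> powr (p - 1) * \<phi> x"
  note var = variational_inequality[OF \<phi> nn \<delta>]
  have comm: "energy \<mu> (src ?w) f_u = energy \<mu> f_u (src ?w)" by (rule energy_commute) measurable
  have w_nn: "0 \<le> ?w x" for x using nn[of x] by simp
  have w_meas: "?w \<in> borel_measurable lebesgue" by measurable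
  note Wint = weighted_potential_integral[OF w_meas w_nn var(1)[unfolded comm]]
  have H_int: "integrable lebesgue (\<lambda>x. a x * \<bar>u x\<bar> powr (q - 1) * \<phi> x)"
  proof -
    have "AE x in lebesgue. a x * u x powr (q - 1) * \<phi> x = a x * \<bar>u x\<bar> powr (q - 1) * \<phi> x"
      using u_pos by eventually_elim simp
    then show ?thesis using weak_integrable[OF \<phi>_X] by (subst (asm) integrable_cong_AE) auto
  qed
  have H_eq: "H_fun a q u \<phi> = (LINT x|lebesgue. a x * \<bar>u x\<bar> powr (q - 1) * \<phi> x)"
    unfolding H_fun_def
  proof (rule integral_cong_AE)
    show "AE x in lebesgue. a x * \<bar>u x\<bar> powr (q - 2) * u x * \<phi> x = a x * \<bar>u x\<bar> powr (q - 1) * \<phi> x"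
      using u_pos
    proof eventually_elim
      case (elim x)
      then have "\<bar>u x\<bar> powr (q - 2) * u x = \<bar>u x\<bar> powr (q - 1)"
        using powr_mult_base[of "u x" "q - 2"] by (simp add: mult.commute)
      then show ?case by (simp add: mult.assoc)
    qed
  qed measurable
  have split: "defect x * \<phi> x = (2 - q) * lam * (a x * \<bar>u x\<bar> powr (q - 1) * \<phi> x)
      - (2 * p - 2) * (weighted b \<alpha> ?w x * u_potential x)" for x
    by (simp add: defect_def weighted_def algebra_simps)
  show "integrable lebesgue (\<lambda>x. defect x * \<phi> x)"
    unfolding split using H_int Wint(1) by auto
  have "(LINT x|lebesgue. defect x * \<phi> x) = (2 - q) * lam * H_fun a q u \<phi>
      - (2 * p - 2) * enn2real (energy \<mu> f_u (src ?w))"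
    unfolding split using H_int Wint(1) by (simp add: H_eq Wint(2))
  then show "0 \<le> (LINT x|lebesgue. defect x * \<phi> x)" using var(2) by (simp add: comm)
qed

lemma defect_nonneg_annulus:
  assumes "0 < \<delta>" "\<delta> < R"
  shows "AE x in lebesgue. \<delta> < norm x \<and> norm x < R \<longrightarrow> 0 \<le> defect x"
proof -
  define \<Omega> where "\<Omega> = {x::'a. \<delta> < norm x \<and> norm x < R}"
  have \<Omega>_eq: "\<Omega> = ball 0 R - cball 0 \<delta>" by (auto simp: \<Omega>_def)
  have \<Omega>: "open \<Omega>" "bounded \<Omega>" unfolding \<Omega>_eq by (auto intro: bounded_subset[OF bounded_ball])
  have "\<delta> / 2 < 2 * R" "0 < \<delta> / 2" using assms by auto
  then obtain \<psi> :: "'a \<Rightarrow> real" where \<psi>: "test_function \<psi>" "\<And>x. 0 \<le> \<psi> x"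
    "\<And>x. 0 < \<psi> x \<longleftrightarrow> \<delta> / 2 < norm x \<and> norm x < 2 * R"
    using annulus_bump[of "\<delta> / 2" "2 * R"] by metis
  have \<psi>0: "\<psi> x = 0" if "norm x \<le> \<delta> / 2" for x
    using \<psi>(2)[of x] \<psi>(3)[of x] that by (auto simp: less_le)
  have defect\<psi>: "integrable lebesgue (\<lambda>x. defect x * \<psi> x)"
    by (rule defect_test(1)[OF \<psi>(1,2) \<open>0 < \<delta> / 2\<close> \<psi>0])
  obtain m where m: "0 < m" "\<And>x. x \<in> \<Omega> \<Longrightarrow> m \<le> \<psi> x"
  proof (cases "\<Omega> = {}")
    case True
    then show ?thesis using that[of 1] by auto
  next
    case False
    define S where "S = cball 0 R - ball (0::'a) \<delta>"
    have "\<Omega> \<subseteq> S" by (auto simp: S_def \<Omega>_eq)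
    then have "S \<noteq> {}" using False by auto
    moreover have "compact S" unfolding S_def by (intro compact_diff compact_cball open_ball)
    moreover have "continuous_on S \<psi>" using test_function_continuous(1)[OF \<psi>(1)] continuous_on_subset by blast
    ultimately obtain x0 where x0: "x0 \<in> S" "\<And>x. x \<in> S \<Longrightarrow> \<psi> x0 \<le> \<psi> x"
      using continuous_attains_inf[of S \<psi>] by blast
    then have "0 < \<psi> x0" unfolding \<psi>(3) using assms by (auto simp: S_def)
    then show ?thesis using that[of "\<psi> x0"] x0(2) \<open>\<Omega> \<subseteq> S\<close> by auto
  qed
  have [measurable]: "\<Omega> \<in> sets lebesgue" using \<Omega>(1) by auto
  have "set_integrable lebesgue \<Omega> defect"
    unfolding set_integrable_def
  proof (rule Bochner_Integration.integrable_bound)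
    show "integrable lebesgue (\<lambda>x. (1 / m) * (defect x * \<psi> x))" using defect\<psi> by (rule integrable_mult_right)
    show "AE x in lebesgue. norm (indicator \<Omega> x *\<^sub>R defect x) \<le> norm ((1 / m) * (defect x * \<psi> x))"
    proof (intro AE_I2)
      fix x
      show "norm (indicator \<Omega> x *\<^sub>R defect x) \<le> norm ((1 / m) * (defect x * \<psi> x))"
      proof (cases "x \<in> \<Omega>")
        case True
        have "1 \<le> \<psi> x / m" using m(1) m(2)[OF True] by simp
        then have "\<bar>defect x\<bar> * 1 \<le> \<bar>defect x\<bar> * (\<psi> x / m)" by (intro mult_left_mono) auto
        then show ?thesis using True m(1) \<psi>(2)[of x] by (simp add: abs_mult mult_ac)
      qed simp
    qed
  qed measurable
  then have "AE x in lebesgue. x \<in> \<Omega> \<longrightarrow> 0 \<le> defect x"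
  proof (rule AE_nonneg_if_test_integrals_nonneg[OF \<Omega>])
    fix \<eta> :: "'a \<Rightarrow> real"
    assume \<eta>: "test_function \<eta>" "\<And>x. 0 \<le> \<eta> x" "\<And>x. x \<notin> \<Omega> \<Longrightarrow> \<eta> x = 0"
    have "\<eta> x = 0" if "norm x \<le> \<delta>" for x using that by (intro \<eta>(3)) (auto simp: \<Omega>_def)
    from defect_test(2)[OF \<eta>(1,2) assms(1) this] show "0 \<le> (LINT x|lebesgue. defect x * \<eta> x)" by simp
  qed
  then show ?thesis by (simp add: \<Omega>_def)
qed

lemma defect_nonneg: "AE x in lebesgue. 0 \<le> defect x"
proof -
  have "AE x in lebesgue. \<forall>n::nat. 1 / (real n + 2) < norm x \<and> norm x < real n + 2 \<longrightarrow> 0 \<le> defect x"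
    unfolding AE_all_countable
  proof
    fix n :: nat
    have "1 / (real n + 2) < real n + 2" by (simp add: divide_less_eq) (simp add: algebra_simps add_pos_nonneg)
    then show "AE x in lebesgue. 1 / (real n + 2) < norm x \<and> norm x < real n + 2 \<longrightarrow> 0 \<le> defect x"
      by (intro defect_nonneg_annulus) auto
  qed
  moreover have "AE x in lebesgue. x \<noteq> (0::'a)" by (intro AE_completion AE_lborel_singleton)
  ultimately show ?thesis
  proof eventually_elim
    case (elim x)
    obtain n :: nat where n: "max (norm x) (1 / norm x) < real n" using reals_Archimedean2 by blast
    have "1 / norm x < real n + 2" "norm x < real n + 2" using n by auto
    moreover have "0 < norm x" using elim(2) by simp
    ultimately have "1 / (real n + 2) < norm x \<and> norm x < real n + 2" by (simp add: field_simps)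
    then show ?case using elim(1) by blast
  qed
qed

text \<open>
The defect is nonnegative, but its integral against \<open>u\<close> is zero by the balance of \<open>A\<close> and \<open>B\<close>. As
\<open>u\<close> is positive, the defect vanishes almost everywhere. Multiplication by \<open>u\<^bsup>1 - q\<^esup>\<close> isolates \<open>a\<close>.
\<close>

lemma coefficient_identity:
  "AE x in lebesgue. (2 - q) * lam * a x
    = (2 * p - 2) * (weighted b \<alpha> (\<lambda>x. \<bar>u x\<bar> powr (p - q)) x * u_potential x)"
proof -
  let ?U = "\<lambda>x. \<bar>u x\<bar> powr p"
  have U_meas: "?U \<in> borel_measurable lebesgue" by measurable
  note Wint = weighted_potential_integral[OF U_meas _ energy_u_finite, simplified]
  have B_eq: "(LINT x|lebesgue. weighted b \<alpha> ?U x * u_potential x) = B u"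
    using Wint(2) B_eq_energy[OF u_meas energy_u_finite] by simp
  define F where "F x = (2 - q) * lam * (a x * \<bar>u x\<bar> powr q) - (2 * p - 2) * (weighted b \<alpha> ?U x * u_potential x)" for x
  have F_int: "integrable lebesgue F" unfolding F_def using A_integrable Wint(1) by auto
  have "(LINT x|lebesgue. F x) = (2 - q) * lam * A u - (2 * p - 2) * B u"
    unfolding F_def A_fun_def B_eq[symmetric] using A_integrable Wint(1) by simp
  also have "\<dots> = 0" using A_B_balance by (simp add: mult.assoc)
  finally have zero: "(LINT x|lebesgue. F x) = 0" .
  have F_G: "AE x in lebesgue. F x = defect x * u x"
    using u_pos
  proof eventually_elim
    case (elim x)
    then have "\<bar>u x\<bar> powr q = \<bar>u x\<bar> powr (q - 1) * u x" "\<bar>u x\<bar> powr p = \<bar>u x\<bar> powr (p - 1) * u x"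
      using powr_mult_base[of "u x" "q - 1"] powr_mult_base[of "u x" "p - 1"] by (simp_all add: mult.commute)
    then show ?case by (simp add: F_def defect_def weighted_def algebra_simps)
  qed
  have "AE x in lebesgue. 0 \<le> F x"
    using F_G defect_nonneg u_pos by eventually_elim simp
  then have "AE x in lebesgue. F x = 0"
    using integral_nonneg_eq_0_iff_AE[OF F_int] zero by simp
  then show ?thesis
    using F_G u_pos
  proof eventually_elim
    case (elim x)
    then have "defect x = 0" by simp
    then have "0 = defect x * u x powr (1 - q)" by simp
    also have "\<dots> = (2 - q) * lam * a x * (u x powr (q - 1) * u x powr (1 - q))
        - (2 * p - 2) * (b x * (u x powr (p - 1) * u x powr (1 - q)) / norm x powr \<alpha> * u_potential x)"
      using elim by (simp add: defect_def weighted_def algebra_simps)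
    also have "u x powr (q - 1) * u x powr (1 - q) = 1" using elim by (simp add: powr_add[symmetric])
    also have "u x powr (p - 1) * u x powr (1 - q) = u x powr (p - q)" by (simp add: powr_add[symmetric])
    finally show ?case using elim by (simp add: weighted_def)
  qed
qed

text \<open>
Up to constants, the source to the power \<open>\<sigma>0\<close> is a product of powers of \<open>\<bar>b\<bar>\<^sup>r\<close>, \<open>u\<^sup>2\<close> and
\<open>\<bar>x\<bar>\<^bsup>- \<nu>\<^esup>\<close>, which are integrable over the region in question when \<open>\<nu> > N\<close>. The exponents fit because of the
strict inequality \<open>gap\<close>: at \<open>\<nu> = N\<close> the resulting \<open>\<sigma>0\<close> is still below the critical exponent. The
restrictions \<open>\<bar>u\<bar> \<le> 1\<close> and \<open>\<bar>x\<bar> > 1\<close> make the source bounded.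
\<close>

lemma tail_energy_finite:
  fixes r :: real
  assumes pq: "q < p" and r: "0 < r" and b_int: "integrable lebesgue (\<lambda>x. \<bar>b x\<bar> powr r)"
    and gap: "1 - \<mu> / (2 * real DIM('a)) < 1 / r + (p - q) / 2 + \<alpha> / real DIM('a)"
  defines "w \<equiv> \<lambda>x. if 1 < norm x \<and> \<bar>u x\<bar> \<le> 1 then \<bar>u x\<bar> powr (p - q) else 0"
  shows "energy \<mu> (src w) (src w) < \<infinity>"
proof -
  define N where "N = real DIM('a)"
  have N: "0 < N" by (simp add: N_def)
  have [measurable]: "(\<lambda>x::'a. x) \<in> borel_measurable lebesgue" by (simp add: measurable_completion)
  have w_meas[measurable]: "w \<in> borel_measurable lebesgue" unfolding w_def by measurable
  have w01: "0 \<le> w x" "w x \<le> 1" for x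
    using pq by (auto simp: w_def intro: powr_le1)
  obtain C where C: "AE x in lebesgue. \<bar>b x\<bar> \<le> C" using b_bounded by blast
  define C' where "C' = max C 0"
  define g where "g = weighted (\<lambda>x. min (b x) C') \<alpha> w"
  have g_meas[measurable]: "g \<in> borel_measurable lebesgue" unfolding g_def by measurable
  have ae: "AE x in lebesgue. src w x = ennreal (g x)"
    using C
  proof eventually_elim
    case (elim x)
    then have "min (b x) C' = b x" by (auto simp: C'_def)
    then show ?case by (simp add: src_def g_def weighted_def)
  qed
  have g_nn: "0 \<le> g x" for x
    using b_pos[of x] w01[of x] by (simp add: g_def weighted_def C'_def)
  have g_le: "g x \<le> C'" for x
  proof (cases "1 < norm x")
    case True
    then have "1 \<le> norm x powr \<alpha>" using \<alpha> by (intro ge_one_powr_ge_zero) auto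
    moreover have "min (b x) C' * w x \<le> C' * 1"
      using b_pos[of x] w01[of x] by (intro mult_mono) (auto simp: C'_def)
    moreover have "0 \<le> C'" by (simp add: C'_def)
    ultimately have "min (b x) C' * w x / norm x powr \<alpha> \<le> C' / 1" by (intro frac_le) auto
    then show ?thesis by (simp add: g_def weighted_def)
  qed (simp add: g_def weighted_def w_def C'_def)
  \<comment> \<open>Here \<open>\<nu>\<close> is chosen so close to \<open>N\<close> that \<open>\<alpha> / N - \<alpha> / \<nu>\<close> stays below the gap.\<close>
  define gp where "gp = 1 / r + (p - q) / 2 + \<alpha> / N - (1 - \<mu> / (2 * N))"
  have gp: "0 < gp" using gap by (simp add: gp_def N_def)
  define \<theta> where "\<theta> = min (1 / (2 * N)) (gp / (2 * \<alpha>))"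
  have \<theta>: "0 < \<theta>" "\<theta> < 1 / N" "\<alpha> * \<theta> < gp"
  proof -
    show "0 < \<theta>" using gp \<alpha> N by (simp add: \<theta>_def)
    have "\<theta> \<le> 1 / (2 * N)" by (simp add: \<theta>_def)
    also have "\<dots> < 1 / N" using N by (simp add: field_simps)
    finally show "\<theta> < 1 / N" .
    have "\<alpha> * \<theta> \<le> \<alpha> * (gp / (2 * \<alpha>))" using \<alpha> by (intro mult_left_mono) (auto simp: \<theta>_def)
    also have "\<dots> < gp" using \<alpha> gp by simp
    finally show "\<alpha> * \<theta> < gp" .
  qed
  define \<nu> where "\<nu> = 1 / (1 / N - \<theta>)"
  have inv_\<nu>: "1 / \<nu> = 1 / N - \<theta>" by (simp add: \<nu>_def)
  have \<nu>: "real DIM('a) < \<nu>"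
  proof -
    have "1 / N - \<theta> < 1 / N" "0 < 1 / N - \<theta>" using \<theta> by auto
    then have "1 / (1 / N) < 1 / (1 / N - \<theta>)" using N by (intro divide_strict_left_mono) auto
    then show ?thesis by (simp add: \<nu>_def N_def)
  qed
  have \<nu>0: "0 < \<nu>" using \<nu> N by (simp add: N_def)
  define \<sigma>0 where "\<sigma>0 = 1 / (1 / r + (p - q) / 2 + \<alpha> * (1 / \<nu>))"
  have inv_pos: "0 < 1 / r + (p - q) / 2 + \<alpha> * (1 / \<nu>)"
    using r pq \<alpha> \<nu>0 by (intro add_pos_pos) auto
  have \<sigma>0: "0 < \<sigma>0" using inv_pos by (simp add: \<sigma>0_def)
  have inv_\<sigma>0: "1 / \<sigma>0 = 1 / r + (p - q) / 2 + \<alpha> * (1 / \<nu>)" by (simp add: \<sigma>0_def)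
  have \<sigma>0_lt: "1 - \<mu> / (2 * N) < 1 / \<sigma>0"
    unfolding inv_\<sigma>0 inv_\<nu> using \<theta>(3) by (simp add: gp_def algebra_simps)
  \<comment> \<open>The exponent \<open>\<sigma>0\<close> may be at most \<open>1\<close>; as \<open>g\<close> is bounded it can be raised, and \<open>\<sigma>1\<close> is a subcritical exponent above \<open>1\<close>.\<close>
  define \<sigma>1 where "\<sigma>1 = 1 / (1 - \<mu> / (4 * N))"
  have frac: "0 < \<mu> / (4 * N)" "\<mu> / (4 * N) < 1" using \<mu> \<mu>_less N by (auto simp: N_def field_simps)
  have \<sigma>1: "1 < \<sigma>1" "1 - \<mu> / (2 * N) < 1 / \<sigma>1"
    using frac N \<mu> by (auto simp: \<sigma>1_def field_simps)
  define \<sigma> where "\<sigma> = max \<sigma>0 \<sigma>1"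
  have \<sigma>: "1 < \<sigma>" "1 - \<mu> / (2 * real DIM('a)) < 1 / \<sigma>"
    using \<sigma>1 \<sigma>0_lt by (auto simp: \<sigma>_def max_def N_def)
  have C'_nn: "0 \<le> C'" by (simp add: C'_def)
  have bound: "g x powr \<sigma>0 \<le> \<bar>b x\<bar> powr r + (u x)\<^sup>2 + 1 / norm x powr \<nu> * indicator (- ball 0 1) x" for x
  proof (cases "1 < norm x \<and> \<bar>u x\<bar> \<le> 1")
    case False
    then have "w x = 0" unfolding w_def by (rule if_not_P)
    then have "g x = 0" by (simp add: g_def weighted_def)
    then show ?thesis by (simp add: indicator_def)
  next
    case True
    define X Y Z where "X = \<bar>b x\<bar> powr r" and "Y = (u x)\<^sup>2" and "Z = 1 / norm x powr \<nu>"
    have nx: "0 < norm x" using True by linarith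
    have "g x \<le> \<bar>b x\<bar> * \<bar>u x\<bar> powr (p - q) * (1 / norm x powr \<alpha>)"
      using True b_pos[of x] by (auto simp: g_def weighted_def w_def intro!: divide_right_mono mult_right_mono)
    then have "g x powr \<sigma>0 \<le> (\<bar>b x\<bar> * \<bar>u x\<bar> powr (p - q) * (1 / norm x powr \<alpha>)) powr \<sigma>0"
      using g_nn \<sigma>0 by (intro powr_mono2) auto
    also have "\<dots> = \<bar>b x\<bar> powr \<sigma>0 * \<bar>u x\<bar> powr ((p - q) * \<sigma>0) * (1 / norm x powr \<alpha>) powr \<sigma>0"
      by (simp add: powr_mult powr_powr del: times_divide_eq_right)
    also have "\<bar>b x\<bar> powr \<sigma>0 = X powr (\<sigma>0 * (1 / r))" using r by (simp add: X_def powr_powr)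
    also have "\<bar>u x\<bar> powr ((p - q) * \<sigma>0) = Y powr (\<sigma>0 * ((p - q) / 2))"
    proof -
      have Y_powr: "Y = \<bar>u x\<bar> powr 2" by (cases "u x = 0") (auto simp: Y_def powr_realpow')
      have "(p - q) * \<sigma>0 = 2 * (\<sigma>0 * ((p - q) / 2))" by simp
      then show ?thesis unfolding Y_powr powr_powr by (rule arg_cong)
    qed
    also have "(1 / norm x powr \<alpha>) powr \<sigma>0 = Z powr (\<sigma>0 * (\<alpha> * (1 / \<nu>)))"
      using nx \<nu>0 by (simp add: Z_def powr_divide powr_powr mult_ac)
    also have "X powr (\<sigma>0 * (1 / r)) * Y powr (\<sigma>0 * ((p - q) / 2)) * Z powr (\<sigma>0 * (\<alpha> * (1 / \<nu>))) \<le> X + Y + Z"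
    proof (rule weighted_product_le_sum)
      have "\<sigma>0 * (1 / r) + \<sigma>0 * ((p - q) / 2) + \<sigma>0 * (\<alpha> * (1 / \<nu>)) = \<sigma>0 * (1 / \<sigma>0)"
        unfolding inv_\<sigma>0 by (simp only: distrib_left)
      then show "\<sigma>0 * (1 / r) + \<sigma>0 * ((p - q) / 2) + \<sigma>0 * (\<alpha> * (1 / \<nu>)) = 1" using \<sigma>0 by simp
    qed (use \<sigma>0 r pq \<alpha> \<nu>0 in \<open>auto simp: X_def Y_def Z_def\<close>)
    finally show ?thesis using True by (simp add: X_def Y_def Z_def indicator_def)
  qed
  have bound': "ennreal (g x powr \<sigma>) \<le> ennreal (C' powr (\<sigma> - \<sigma>0)) * (ennreal (\<bar>b x\<bar> powr r) + ennreal ((u x)\<^sup>2)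
      + ennreal (1 / norm x powr \<nu>) * indicator (- ball 0 1) x)" for x
  proof -
    have "g x powr \<sigma> = g x powr (\<sigma> - \<sigma>0) * g x powr \<sigma>0" by (simp add: powr_add[symmetric])
    also have "\<dots> \<le> C' powr (\<sigma> - \<sigma>0) * (\<bar>b x\<bar> powr r + (u x)\<^sup>2 + 1 / norm x powr \<nu> * indicator (- ball 0 1) x)"
      using g_nn g_le bound by (intro mult_mono powr_mono2) (auto simp: \<sigma>_def)
    finally have "ennreal (g x powr \<sigma>) \<le> ennreal (C' powr (\<sigma> - \<sigma>0) * (\<bar>b x\<bar> powr r + (u x)\<^sup>2 + 1 / norm x powr \<nu> * indicator (- ball 0 1) x))"
      by (rule ennreal_leI)
    also have "\<dots> = ennreal (C' powr (\<sigma> - \<sigma>0)) * ennreal (\<bar>b x\<bar> powr r + (u x)\<^sup>2 + 1 / norm x powr \<nu> * indicator (- ball 0 1) x)"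
      by (rule ennreal_mult') simp
    also have "ennreal (\<bar>b x\<bar> powr r + (u x)\<^sup>2 + 1 / norm x powr \<nu> * indicator (- ball 0 1) x)
       = ennreal (\<bar>b x\<bar> powr r) + ennreal ((u x)\<^sup>2) + ennreal (1 / norm x powr \<nu>) * indicator (- ball 0 1) x"
      by (auto simp: indicator_def ennreal_plus)
    finally show ?thesis .
  qed
  have u2: "integrable lebesgue (\<lambda>x. (u x)\<^sup>2)" using u_X H1_weak_gradient(5) by (auto simp: X_space_def)
  have tail_meas: "(\<lambda>x::'a. ennreal (1 / norm x powr \<nu>) * indicator (- ball 0 1) x) \<in> borel_measurable borel"
  proof -
    have [measurable]: "- ball (0::'a) 1 \<in> sets borel" by auto
    show ?thesis by measurable
  qed
  then have [measurable]: "(\<lambda>x::'a. ennreal (1 / norm x powr \<nu>) * indicator (- ball 0 1) x) \<in> borel_measurable lebesgue"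
    by (simp add: measurable_completion)
  have "(\<integral>\<^sup>+x. ennreal (g x powr \<sigma>) \<partial>lebesgue) \<le> (\<integral>\<^sup>+x. ennreal (C' powr (\<sigma> - \<sigma>0)) * (ennreal (\<bar>b x\<bar> powr r) + ennreal ((u x)\<^sup>2)
      + ennreal (1 / norm x powr \<nu>) * indicator (- ball 0 1) x) \<partial>lebesgue)"
    by (intro nn_integral_mono bound')
  also have "\<dots> = ennreal (C' powr (\<sigma> - \<sigma>0)) * ((\<integral>\<^sup>+x. ennreal (\<bar>b x\<bar> powr r) \<partial>lebesgue)
      + (\<integral>\<^sup>+x. ennreal ((u x)\<^sup>2) \<partial>lebesgue)
      + (\<integral>\<^sup>+x. ennreal (1 / norm (x::'a) powr \<nu>) * indicator (- ball 0 1) x \<partial>lebesgue))"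
    by (subst nn_integral_cmult, measurable, subst nn_integral_add, measurable, subst nn_integral_add, measurable)
  also have "\<dots> < \<infinity>"
    using b_int u2 norm_powr_integrable_near_infinity[OF \<nu>]
    by (simp add: ennreal_mult_less_top nn_integral_completion integrable_iff_bounded)
  finally have "energy \<mu> (\<lambda>x. ennreal (g x)) (\<lambda>x. ennreal (g x)) < \<infinity>"
    using energy_finite_if_bounded_Lp[OF \<mu> \<mu>_less \<sigma> g_meas g_nn g_le] by simp
  then show ?thesis using energy_cong_AE[OF ae ae] by simp
qed

text \<open>
Let \<open>F\<close> be the product of \<open>b u\<^bsup>p - q\<^esup> / \<bar>x\<bar>\<^sup>\<alpha>\<close> with the potential of \<open>f_u\<close>, which is a multiple of \<open>a\<close>. Where \<open>u \<ge> 1\<close>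
it is at most the energy density of \<open>f_u\<close>; where \<open>u \<le> 1\<close> and \<open>\<bar>x\<bar> > 1\<close> it is the density of a mixed energy,
finite by the Cauchy--Schwarz inequality for the kernel; on the unit ball \<open>a\<close> is bounded.
\<close>

lemma a_integrable:
  fixes r :: real
  assumes pq: "q < p" and r: "0 < r" and b_int: "integrable lebesgue (\<lambda>x. \<bar>b x\<bar> powr r)"
    and gap: "1 - \<mu> / (2 * real DIM('a)) < 1 / r + (p - q) / 2 + \<alpha> / real DIM('a)"
  shows "integrable lebesgue a"
proof -
  have [measurable]: "(\<lambda>x::'a. x) \<in> borel_measurable lebesgue" by (simp add: measurable_completion)
  define w where "w = (\<lambda>x. if 1 < norm x \<and> \<bar>u x\<bar> \<le> 1 then \<bar>u x\<bar> powr (p - q) else 0)"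
  have w_meas[measurable]: "w \<in> borel_measurable lebesgue" unfolding w_def by measurable
  have w_nn: "0 \<le> w x" for x by (simp add: w_def)
  have "energy \<mu> (src w) (src w) < \<infinity>" unfolding w_def by (rule tail_energy_finite[OF assms])
  then have fin: "energy \<mu> f_u (src w) < \<infinity>"
    by (intro mixed_energy_finite[OF \<mu> _ _ energy_u_finite]) measurable
  let ?U = "\<lambda>x. \<bar>u x\<bar> powr p"
  have U_meas: "?U \<in> borel_measurable lebesgue" by measurable
  define c where "c = (2 * p - 2) / ((2 - q) * lam)"
  have c: "0 \<le> c" using p q lam_pos by (simp add: c_def)
  have local: "integrable lebesgue (\<lambda>x. indicator (cball 0 1) x *\<^sub>R a x)"
    using continuous_locally_integrable[OF a_cont] by (simp add: locally_integrable_def set_integrable_def)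
  show ?thesis
  proof (rule Bochner_Integration.integrable_bound)
    show "integrable lebesgue (\<lambda>x. indicator (cball 0 1) x *\<^sub>R a x
        + c * (weighted b \<alpha> ?U x * u_potential x + weighted b \<alpha> w x * u_potential x))"
      using local weighted_potential_integral(1)[OF U_meas _ energy_u_finite] weighted_potential_integral(1)[OF w_meas w_nn fin]
      by auto
    show "AE x in lebesgue. norm (a x) \<le> norm (indicator (cball 0 1) x *\<^sub>R a x
        + c * (weighted b \<alpha> ?U x * u_potential x + weighted b \<alpha> w x * u_potential x))"
      using coefficient_identity
    proof eventually_elim
      case (elim x)
      have nonneg: "0 \<le> weighted b \<alpha> ?U x * u_potential x" "0 \<le> weighted b \<alpha> w x * u_potential x"
        using b_pos w_nn u_potential_nonneg by (auto intro!: mult_nonneg_nonneg weighted_nonneg)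
      have tot: "0 \<le> c * (weighted b \<alpha> ?U x * u_potential x + weighted b \<alpha> w x * u_potential x)"
        using nonneg c by simp
      have "a x \<le> indicator (cball 0 1) x *\<^sub>R a x + c * (weighted b \<alpha> ?U x * u_potential x + weighted b \<alpha> w x * u_potential x)"
      proof (cases "norm x \<le> 1")
        case True
        then show ?thesis using tot by (simp add: indicator_def)
      next
        case False
        have "\<bar>u x\<bar> powr (p - q) \<le> ?U x + w x"
        proof (cases "\<bar>u x\<bar> \<le> 1")
          case True
          then show ?thesis using False by (simp add: w_def)
        next
          case False
          then have "\<bar>u x\<bar> powr (p - q) \<le> ?U x" using q by (intro powr_mono) auto
          then show ?thesis using w_nn[of x] by simp
        qed
        then have "weighted b \<alpha> (\<lambda>x. \<bar>u x\<bar> powr (p - q)) x \<le> weighted b \<alpha> (\<lambda>x. ?U x + w x) x"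
          using b_pos by (intro weighted_mono) auto
        also have "\<dots> = weighted b \<alpha> ?U x + weighted b \<alpha> w x"
          by (simp add: weighted_def algebra_simps add_divide_distrib)
        finally have "weighted b \<alpha> (\<lambda>x. \<bar>u x\<bar> powr (p - q)) x * u_potential x \<le> (weighted b \<alpha> ?U x + weighted b \<alpha> w x) * u_potential x"
          using u_potential_nonneg by (rule mult_right_mono)
        then have "c * (weighted b \<alpha> (\<lambda>x. \<bar>u x\<bar> powr (p - q)) x * u_potential x)
            \<le> c * (weighted b \<alpha> ?U x * u_potential x + weighted b \<alpha> w x * u_potential x)"
          using c by (intro mult_left_mono) (auto simp: distrib_right)
        moreover have "a x = c * (weighted b \<alpha> (\<lambda>x. \<bar>u x\<bar> powr (p - q)) x * u_potential x)"
        proof -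
          have "2 - q \<noteq> 0" "lam \<noteq> 0" using q lam_pos by auto
          then have "a x = ((2 - q) * lam * a x) / ((2 - q) * lam)" by simp
          then show ?thesis unfolding elim c_def by simp
        qed
        ultimately show ?thesis using False by (simp add: indicator_def)
      qed
      then show ?case using a_pos[of x] by simp
    qed
  qed measurable
qed

end

theorem proposition5p1:
  fixes N :: nat and q p \<alpha> \<mu> :: real
    and a b V :: "real ^ 'n \<Rightarrow> real"
  assumes "N = CARD('n)" and "N \<ge> 3"
    and "0 < q" and "q < 1"
    and "0 < \<alpha>" and "\<alpha> < real N" and "\<mu> > 0"
    and "0 < 2 * \<alpha> + \<mu>" and "2 * \<alpha> + \<mu> < real N"
    and "(2 * real N - 2 * \<alpha> - \<mu>) / real N < p"
    and "p < (2 * real N - 2 * \<alpha> - \<mu>) / (real N - 2)"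
    and "continuous_on UNIV a" and "\<And>x. a x > 0"
    and "a \<in> Lp (2 / (2 - q))" and "a \<notin> Lp 1"
    and "b \<in> borel_measurable lebesgue" and "\<And>x. b x > 0"
    and "b \<in> Linfty"
    and "b \<in> Lp (2 * real N / (2 * real N - 2 * \<alpha> - \<mu> - (real N - 2) * (p - q)))"
    and "continuous_on UNIV V" and "\<And>x. V x > 0"
    and "(INF x. V x) > 0"
    and "\<And>M. M > 0 \<Longrightarrow> emeasure lebesgue {x. V x \<le> M} < \<infinity>"
  shows "\<not> (\<exists>u. u \<in> N0 V a b q p \<alpha> \<mu> (lambda_star V a b q p \<alpha> \<mu>) \<and>
              weak_solution V a b q p \<alpha> \<mu> (lambda_star V a b q p \<alpha> \<mu>) u)"
proof
  assume "\<exists>u. u \<in> N0 V a b q p \<alpha> \<mu> (lambda_star V a b q p \<alpha> \<mu>) \<and>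
              weak_solution V a b q p \<alpha> \<mu> (lambda_star V a b q p \<alpha> \<mu>) u"
  then obtain u where u: "u \<in> N0 V a b q p \<alpha> \<mu> (lambda_star V a b q p \<alpha> \<mu>)"
    "weak_solution V a b q p \<alpha> \<mu> (lambda_star V a b q p \<alpha> \<mu>) u" by blast
  have DIM_eq: "real DIM(real ^ 'n) = real N" using assms(1) by simp
  have N: "3 \<le> real N" using assms(2) by simp
  have p: "1 < p"
  proof -
    have "1 < (2 * real N - 2 * \<alpha> - \<mu>) / real N" using assms(9) N by (simp add: field_simps)
    then show ?thesis using assms(10) by simp
  qed
  interpret degenerate_solution a b V q p \<alpha> \<mu> u "lambda_star V a b q p \<alpha> \<mu>"
  proof unfold_locales
    show "2 * \<alpha> + \<mu> < real DIM(real ^ 'n)" unfolding DIM_eq by (rule assms(9))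
    show "\<exists>C. AE x in lebesgue. \<bar>b x\<bar> \<le> C" using assms(18) by (simp add: Linfty_def)
  qed (use assms p u in auto)
  define d where "d = 2 * real N - 2 * \<alpha> - \<mu> - (real N - 2) * (p - q)"
  have "(real N - 2) * p < 2 * real N - 2 * \<alpha> - \<mu>"
    using assms(11) N by (simp add: field_simps)
  moreover have "0 < (real N - 2) * q" using N assms(3) by simp
  ultimately have d: "0 < d" by (simp add: d_def algebra_simps)
  have "integrable lebesgue a"
  proof (rule a_integrable)
    show "q < p" using p assms(4) by simp
    show "0 < 2 * real N / d" using d N by simp
    show "integrable lebesgue (\<lambda>x. \<bar>b x\<bar> powr (2 * real N / d))"
      using assms(19) by (simp add: Lp_def d_def)
    have "1 / (2 * real N / d) + (p - q) / 2 + \<alpha> / real N - (1 - \<mu> / (2 * real N)) = (p - q) / real N"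
      using N by (simp add: d_def field_simps)
    moreover have "0 < (p - q) / real N" using p assms(4) N by simp
    ultimately show "1 - \<mu> / (2 * real DIM(real ^ 'n))
        < 1 / (2 * real N / d) + (p - q) / 2 + \<alpha> / real DIM(real ^ 'n)"
      unfolding DIM_eq by linarith
  qed
  then have "a \<in> Lp 1"
    using a_meas assms(13) by (simp add: Lp_def less_imp_le)
  with assms(15) show False by contradiction
qed

end
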